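(* Fix $1\le p,q<\infty$ and $\alpha,\beta>0$. Assume that $\big(\{M_{\beta n}T_{\alpha k}g\}_{k,n\in\mathbb{Z}},\{M_{\beta n}T_{\alpha k}\gamma\}_{k,n\in\mathbb{Z}}\big)\subseteq M^{p,q}(\mathbb{R})\times(M^{p,q}(\mathbb{R}))^*$ is a Schauder frame for $M^{p,q}(\mathbb{R})$. Then the following statements are equivalent. (a) $\{M_{\beta n}T_{\alpha k}g\}_{k,n\in\mathbb{Z}}$ is an unconditional basis for $M^{p,q}(\mathbb{R})$ plus at most finitely many elements. (b) $f=\sum_{k,n\in\mathbb{Z}}\langle f,\phi_{k,n}\rangle M_{\beta n}T_{\alpha k}g$ with unconditional convergence of the series in $M^{p,q}(\mathbb{R})$ for all $f\in M^{p,q}(\mathbb{R})$ and every alternative dual $\{\phi_{k,n}\}_{k,n\in\mathbb{Z}}$ of $\{M_{\beta n}T_{\alpha k}g\}_{k,n\in\mathbb{Z}}$.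
   Context: For $x,\xi\in\mathbb{R}$, $T_x$ is translation $(T_xg)(t)=g(t-x)$ and $M_\xi$ is modulation $(M_\xi g)(t)=e^{2\pi i\xi t}g(t)$ (extended to tempered distributions as usual). Fix a nonzero $\psi\in S(\mathbb{R})$ and put $V_\psi f(x,w)=\langle f,M_wT_x\psi\rangle$ for $f\in S'(\mathbb{R})$. For $1\le p,q\le\infty$, $M^{p,q}(\mathbb{R})$ is the space of $f\in S'(\mathbb{R})$ with $\|f\|_{M^{p,q}}=\big(\int_{\mathbb{R}}(\int_{\mathbb{R}}|V_\psi f(x,w)|^p\,dx)^{q/p}\,dw\big)^{1/q}<\infty$ (usual modifications for $\infty$). For $1\le p,q<\infty$ with conjugate exponents $p',q'$, $(M^{p,q}(\mathbb{R}))^*$ is identified with $M^{p',q'}(\mathbb{R})$ via $\langle f,h\rangle=\iint V_\psi f\,\overline{V_\psi h}\,dx\,dw$ (with $\|\psi\|_{L^2}=1$). For a Banach space $X$, a Schauder frame for $X$ is a pair of sequences $((x_n)_{n\in\mathbb{N}},(x_n^* )_{n\in\mathbb{N}})\subseteq X\times X^*$ such that $x=\sum_{n=1}^\infty\langle x,x_n^*\rangle x_n$ with norm convergence for every $x\in X$; a sequence $\{y_n^*\}\subseteq X^*$ is an alternative dual of $\{x_n\}$ if $x=\sum_{n=1}^\infty\langle x,y_n^*\rangle x_n$ (norm convergence) for all $x\in X$. Systems indexed by $\mathbb{Z}^2$ are regarded as sequences through one fixed enumeration of $\mathbb{Z}^2$, with respect to which the Schauder frame and alternative dual properties are understood. A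 series converges unconditionally if it converges for every rearrangement. An unconditional basis is a Schauder basis whose expansions converge unconditionally for every $x\in X$; a system is "an unconditional basis plus at most finitely many elements" if removing the elements with indices in some finite (possibly empty) set leaves an unconditional basis for $X$. *)

theory Defs
  imports
    "HOL-Analysis.Analysis"
    "HOL-Probability.Essential_Supremum"
    "HOL-Library.Function_Algebras"
    "HOL-Library.Infinite_Set"
begin

section \<open>Bases and frames in spaces of complex-valued functionals\<close>

text \<open>
  The Banach spaces below are linear spaces \<open>X\<close> of functions \<open>'a \<Rightarrow> complex\<close> with pointwise
  operations (addition and subtraction are those of \<^theory>\<open>HOL-Library.Function_Algebras\<close>), together
  with an extended-valued norm \<open>nrm\<close>.  Keeping the norm in \<^typ>\<open>ennreal\<close> means that a sequence
  whose distance to the limit is infinite is never regarded as convergent.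
\<close>

definition cscale :: "complex \<Rightarrow> ('a \<Rightarrow> complex) \<Rightarrow> 'a \<Rightarrow> complex" (infixr \<open>*\<^sub>C\<close> 75)
  where "c *\<^sub>C u = (\<lambda>a. c * u a)"

definition norm_sums ::
    "(('a \<Rightarrow> complex) \<Rightarrow> ennreal) \<Rightarrow> (nat \<Rightarrow> 'a \<Rightarrow> complex) \<Rightarrow> ('a \<Rightarrow> complex) \<Rightarrow> bool"
  where "norm_sums nrm y s \<longleftrightarrow> (\<lambda>N. nrm ((\<Sum>n<N. y n) - s)) \<longlonglongrightarrow> 0"

definition unconditionally_convergent ::
    "('a \<Rightarrow> complex) set \<Rightarrow> (('a \<Rightarrow> complex) \<Rightarrow> ennreal) \<Rightarrow> (nat \<Rightarrow> 'a \<Rightarrow> complex) \<Rightarrow> bool"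
  where "unconditionally_convergent X nrm y \<longleftrightarrow>
    (\<forall>\<pi>::nat \<Rightarrow> nat. bij \<pi> \<longrightarrow> (\<exists>s\<in>X. norm_sums nrm (y \<circ> \<pi>) s))"

text \<open>Functionals are total functions; only their values on \<open>X\<close> matter.\<close>

definition dual_space ::
    "('a \<Rightarrow> complex) set \<Rightarrow> (('a \<Rightarrow> complex) \<Rightarrow> ennreal) \<Rightarrow> (('a \<Rightarrow> complex) \<Rightarrow> complex) set"
  where "dual_space X nrm =
    {F. (\<forall>u\<in>X. \<forall>v\<in>X. F (u + v) = F u + F v) \<and>
        (\<forall>c. \<forall>u\<in>X. F (c *\<^sub>C u) = c * F u) \<and>
        (\<exists>C::real. \<forall>u\<in>X. ennreal (cmod (F u)) \<le> ennreal C * nrm u)}"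

definition reproducing ::
    "('a \<Rightarrow> complex) set \<Rightarrow> (('a \<Rightarrow> complex) \<Rightarrow> ennreal) \<Rightarrow>
     (nat \<Rightarrow> 'a \<Rightarrow> complex) \<Rightarrow> (nat \<Rightarrow> ('a \<Rightarrow> complex) \<Rightarrow> complex) \<Rightarrow> bool"
  where "reproducing X nrm x y \<longleftrightarrow> (\<forall>f\<in>X. norm_sums nrm (\<lambda>n. y n f *\<^sub>C x n) f)"

definition schauder_frame ::
    "('a \<Rightarrow> complex) set \<Rightarrow> (('a \<Rightarrow> complex) \<Rightarrow> ennreal) \<Rightarrow>
     (nat \<Rightarrow> 'a \<Rightarrow> complex) \<Rightarrow> (nat \<Rightarrow> ('a \<Rightarrow> complex) \<Rightarrow> complex) \<Rightarrow> bool"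
  where "schauder_frame X nrm x y \<longleftrightarrow>
    (\<forall>n. x n \<in> X) \<and> (\<forall>n. y n \<in> dual_space X nrm) \<and> reproducing X nrm x y"

definition alternative_dual ::
    "('a \<Rightarrow> complex) set \<Rightarrow> (('a \<Rightarrow> complex) \<Rightarrow> ennreal) \<Rightarrow>
     (nat \<Rightarrow> 'a \<Rightarrow> complex) \<Rightarrow> (nat \<Rightarrow> ('a \<Rightarrow> complex) \<Rightarrow> complex) \<Rightarrow> bool"
  where "alternative_dual X nrm x y \<longleftrightarrow>
    (\<forall>n. y n \<in> dual_space X nrm) \<and> reproducing X nrm x y"

definition schauder_basis ::
    "('a \<Rightarrow> complex) set \<Rightarrow> (('a \<Rightarrow> complex) \<Rightarrow> ennreal) \<Rightarrow> (nat \<Rightarrow> 'a \<Rightarrow> complex) \<Rightarrow> bool"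
  where "schauder_basis X nrm x \<longleftrightarrow>
    (\<forall>n. x n \<in> X) \<and> (\<forall>f\<in>X. \<exists>!c::nat \<Rightarrow> complex. norm_sums nrm (\<lambda>n. c n *\<^sub>C x n) f)"

definition unconditional_basis ::
    "('a \<Rightarrow> complex) set \<Rightarrow> (('a \<Rightarrow> complex) \<Rightarrow> ennreal) \<Rightarrow> (nat \<Rightarrow> 'a \<Rightarrow> complex) \<Rightarrow> bool"
  where "unconditional_basis X nrm x \<longleftrightarrow> schauder_basis X nrm x \<and>
    (\<forall>f\<in>X. \<forall>c::nat \<Rightarrow> complex. norm_sums nrm (\<lambda>n. c n *\<^sub>C x n) f \<longrightarrow>
       unconditionally_convergent X nrm (\<lambda>n. c n *\<^sub>C x n))"

text \<open>The indices outside the finite set \<open>F\<close> are listed in increasing order by \<^const>\<open>enumerate\<close>.\<close>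

definition unconditional_basis_plus_finite ::
    "('a \<Rightarrow> complex) set \<Rightarrow> (('a \<Rightarrow> complex) \<Rightarrow> ennreal) \<Rightarrow> (nat \<Rightarrow> 'a \<Rightarrow> complex) \<Rightarrow> bool"
  where "unconditional_basis_plus_finite X nrm x \<longleftrightarrow>
    (\<exists>F::nat set. finite F \<and> unconditional_basis X nrm (x \<circ> enumerate (- F)))"


section \<open>Schwartz functions and tempered distributions\<close>

definition nth_derivative :: "nat \<Rightarrow> (real \<Rightarrow> complex) \<Rightarrow> real \<Rightarrow> complex"
  where "nth_derivative n \<phi> = ((\<lambda>h t. vector_derivative h (at t)) ^^ n) \<phi>"

definition schwartz_space :: "(real \<Rightarrow> complex) set"
  where "schwartz_space =
    {\<phi>. (\<forall>n t. nth_derivative n \<phi> differentiable (at t)) \<and>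
        (\<forall>m n. bdd_above (range (\<lambda>t. \<bar>t\<bar> ^ m * cmod (nth_derivative n \<phi> t))))}"

definition schwartz_seminorm :: "nat \<Rightarrow> nat \<Rightarrow> (real \<Rightarrow> complex) \<Rightarrow> real"
  where "schwartz_seminorm m n \<phi> = (SUP t. \<bar>t\<bar> ^ m * cmod (nth_derivative n \<phi> t))"

text \<open>
  A tempered distribution \<open>f\<close> is identified with the functional \<open>\<phi> \<mapsto> \<langle>f, \<phi>\<rangle>\<close>, where
  \<open>\<langle>\<cdot>,\<cdot>\<rangle>\<close> extends the inner product of \<open>L\<^sup>2\<close> and hence is conjugate-linear in \<open>\<phi>\<close>; a function \<open>h\<close>
  corresponds to \<open>\<phi> \<mapsto> \<integral> h(t) cnj (\<phi>(t)) dt\<close>.  The irrelevant values outside the Schwartz space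
  are fixed to be 0, so that equality of distributions is equality of functions.
\<close>

type_synonym distribution = "(real \<Rightarrow> complex) \<Rightarrow> complex"

definition tempered_distributions :: "distribution set"
  where "tempered_distributions =
    {f. (\<forall>\<phi>. \<phi> \<notin> schwartz_space \<longrightarrow> f \<phi> = 0) \<and>
        (\<forall>\<phi>\<in>schwartz_space. \<forall>\<theta>\<in>schwartz_space. f (\<phi> + \<theta>) = f \<phi> + f \<theta>) \<and>
        (\<forall>c. \<forall>\<phi>\<in>schwartz_space. f (c *\<^sub>C \<phi>) = cnj c * f \<phi>) \<and>
        (\<exists>(C::real) K. \<forall>\<phi>\<in>schwartz_space.
            cmod (f \<phi>) \<le> C * (\<Sum>m\<le>K. \<Sum>n\<le>K. schwartz_seminorm m n \<phi>))}"


section \<open>Time-frequency shifts\<close>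

definition translate :: "real \<Rightarrow> (real \<Rightarrow> complex) \<Rightarrow> real \<Rightarrow> complex"
  where "translate x g = (\<lambda>t. g (t - x))"

definition modulate :: "real \<Rightarrow> (real \<Rightarrow> complex) \<Rightarrow> real \<Rightarrow> complex"
  where "modulate \<xi> g = (\<lambda>t. exp (2 * of_real pi * \<i> * of_real \<xi> * of_real t) * g t)"

text \<open>On distributions the operators act by duality: for the conjugate-linear pairing
  the adjoint of \<open>T\<^sub>x\<close> is \<open>T\<^sub>-\<^sub>x\<close> and the adjoint of \<open>M\<^sub>\<xi>\<close> is \<open>M\<^sub>-\<^sub>\<xi>\<close>.\<close>

definition dist_translate :: "real \<Rightarrow> distribution \<Rightarrow> distribution"
  where "dist_translate x f = (\<lambda>\<phi>. f (translate (- x) \<phi>))"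

definition dist_modulate :: "real \<Rightarrow> distribution \<Rightarrow> distribution"
  where "dist_modulate \<xi> f = (\<lambda>\<phi>. f (modulate (- \<xi>) \<phi>))"

definition gabor :: "real \<Rightarrow> real \<Rightarrow> distribution \<Rightarrow> int \<times> int \<Rightarrow> distribution"
  where "gabor \<alpha> \<beta> g = (\<lambda>(k, n). dist_modulate (\<beta> * of_int n) (dist_translate (\<alpha> * of_int k) g))"


section \<open>Modulation spaces\<close>

definition stft :: "(real \<Rightarrow> complex) \<Rightarrow> distribution \<Rightarrow> real \<Rightarrow> real \<Rightarrow> complex"
  where "stft \<psi> f x w = f (modulate w (translate x \<psi>))"

definition epowr :: "ennreal \<Rightarrow> real \<Rightarrow> ennreal"
  where "epowr a r = (if a = top then top else ennreal (enn2real a powr r))"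

definition Lp_norm :: "ennreal \<Rightarrow> (real \<Rightarrow> ennreal) \<Rightarrow> ennreal"
  where "Lp_norm p h =
    (if p = top then esssup lborel h
     else epowr (\<integral>\<^sup>+ x. epowr (h x) (enn2real p) \<partial>lborel) (1 / enn2real p))"

definition modulation_norm ::
    "(real \<Rightarrow> complex) \<Rightarrow> ennreal \<Rightarrow> ennreal \<Rightarrow> distribution \<Rightarrow> ennreal"
  where "modulation_norm \<psi> p q f =
    Lp_norm q (\<lambda>w. Lp_norm p (\<lambda>x. ennreal (cmod (stft \<psi> f x w))))"

definition modulation_space ::
    "(real \<Rightarrow> complex) \<Rightarrow> ennreal \<Rightarrow> ennreal \<Rightarrow> distribution set"
  where "modulation_space \<psi> p q = {f \<in> tempered_distributions. modulation_norm \<psi> p q f < top}"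

text \<open>The functional \<open>f \<mapsto> \<langle>f, h\<rangle>\<close> on \<open>M\<^sup>p\<^sup>,\<^sup>q\<close> induced by an element \<open>h\<close> of the modulation space with
  the conjugate exponents; by Hoelder's inequality the double integral converges absolutely.\<close>

definition modulation_functional ::
    "(real \<Rightarrow> complex) \<Rightarrow> distribution \<Rightarrow> distribution \<Rightarrow> complex"
  where "modulation_functional \<psi> h = (\<lambda>f.
    (\<integral>(x, w). stft \<psi> f x w * cnj (stft \<psi> h x w) \<partial>(lborel :: (real \<times> real) measure)))"

end

theory Submission
  imports Defs "HOL-Probability.Characteristic_Functions" "HOL-Probability.Sinc_Integral"
begin

text \<open>
  Write \<open>x\<^sub>j\<close> for the Gabor system and \<open>y\<^sub>j\<close> for the given dual functionals, and call \<open>c\<close> a null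
  series if \<open>\<Sum> c\<^sub>j x\<^sub>j = 0\<close>.  The equivalence holds for every frame of vectors of nonzero norm
  in a seminormed space that contains no copy of \<open>c\<^sub>0\<close>
  (\<open>near_basis_iff_alternative_duals_unconditional\<close>).

  If the system is an unconditional basis up to a finite set \<open>F\<close>, the expansion of \<open>f\<close> along an
  alternative dual becomes, after removal of the terms in \<open>F\<close>, the expansion of some vector in an
  unconditional basis; putting finitely many terms back does not affect unconditional convergence.

  Conversely, for a null series \<open>c\<close> and a functional \<open>h\<close> the functionals \<open>y\<^sub>j + c\<^sub>j h\<close> form another
  alternative dual.  Hence, if all alternative duals give unconditional convergence, so does every
  null series, and so does every convergent series \<open>\<Sum> c\<^sub>j x\<^sub>j\<close>, because it differs from the
  frame expansion of its sum by a null series (\<open>convergent_imp_unconditional\<close>).  It remains to see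
  that only finitely many vectors are superfluous.  Suppose there were nonzero null series that
  vanish on arbitrarily long initial segments.  A gliding hump argument
  (\<open>tail_series_determined\<close>) selects null series \<open>c\<^sup>1, c\<^sup>2, \<dots>\<close> with partial sums bounded by 1,
  with humps \<open>u\<^sub>j\<close> (partial sums of norm at least 1/2), and so sparse that \<open>\<Sum> a\<^sub>j c\<^sup>j\<close> is again
  a null series for every scalar sequence \<open>a\<^sub>j \<longlonglongrightarrow> 0\<close>.  All these series converge
  unconditionally, which bounds the sums \<open>\<Sum>\<^bsub>j\<in>J\<^esub> a\<^sub>j u\<^sub>j\<close> uniformly over finite \<open>J\<close> and
  \<open>\<bar>a\<^sub>j\<bar> \<le> 1\<close>; this is a copy of \<open>c\<^sub>0\<close>.  So some tail \<open>(x\<^sub>j)\<^bsub>j\<ge>K\<^esub>\<close> has no nonzero null series;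
  enlarging it by as many of the first \<open>K\<close> vectors as possible without creating a null series
  gives a basis (\<open>unconditional_imp_near_basis\<close>).  The combinations \<open>\<Sum> a\<^sub>j c\<^sup>j\<close> are formed from
  complete null series, so that their sums are known to be 0 and no limit has to be constructed.

  For \<open>M\<^sup>p\<^sup>,\<^sup>q\<close> with \<open>p, q < \<infinity>\<close> the absence of \<open>c\<^sub>0\<close> (\<open>contains_no_c0_modulation_space\<close>) is a
  Khinchine argument on the short-time Fourier transform: averaging over the fourth roots of unity
  bounds the mixed norm of the square function \<open>(\<Sum>\<bar>V u\<^sub>j\<bar>\<^sup>2)\<^sup>1\<^sup>/\<^sup>2\<close> by a multiple of the bound for the sums
  \<open>\<Sum> a\<^sub>j u\<^sub>j\<close>.  This function dominates all \<open>\<bar>V u\<^sub>j\<bar>\<close>, which tend to 0 wherever it is finite, so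
  dominated convergence gives \<open>\<parallel>u\<^sub>j\<parallel> \<longlonglongrightarrow> 0\<close>.  The Gabor vectors all have the same norm, and it is
  not 0 because otherwise the whole space would have norm 0, whereas
  \<open>exists_norm_neq_0\<close> exhibits an element of nonzero norm.
\<close>

section \<open>Scalar multiplication and partial sums\<close>

lemma cscale_apply [simp]: "(c *\<^sub>C u) a = c * u a"
  by (simp add: cscale_def)

lemma cscale_simps:
  "c *\<^sub>C (u + v) = c *\<^sub>C u + c *\<^sub>C v" "c *\<^sub>C (u - v) = c *\<^sub>C u - c *\<^sub>C v"
  "(c + d) *\<^sub>C u = c *\<^sub>C u + d *\<^sub>C u" "(c - d) *\<^sub>C u = c *\<^sub>C u - d *\<^sub>C u"
  "c *\<^sub>C d *\<^sub>C u = (c * d) *\<^sub>C u" "1 *\<^sub>C u = u" "0 *\<^sub>C u = 0" "c *\<^sub>C 0 = 0"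
  "(- c) *\<^sub>C u = - (c *\<^sub>C u)"
  by (simp_all add: fun_eq_iff algebra_simps)

lemma sum_fun_apply: "(\<Sum>i\<in>I. u i) a = (\<Sum>i\<in>I. u i a :: complex)"
  by (induct I rule: infinite_finite_induct) simp_all

lemma cscale_sum: "c *\<^sub>C (\<Sum>i\<in>I. u i) = (\<Sum>i\<in>I. c *\<^sub>C u i)"
  by (simp add: fun_eq_iff sum_fun_apply sum_distrib_left)

lemma sum_cscale: "(\<Sum>i\<in>I. c i) *\<^sub>C u = (\<Sum>i\<in>I. c i *\<^sub>C u)"
  by (simp add: fun_eq_iff sum_fun_apply sum_distrib_right)

definition psum :: "(nat \<Rightarrow> 'a \<Rightarrow> complex) \<Rightarrow> (nat \<Rightarrow> complex) \<Rightarrow> nat \<Rightarrow> 'a \<Rightarrow> complex"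
  where "psum x c N = (\<Sum>n<N. c n *\<^sub>C x n)"

lemma psum_scale: "psum x (\<lambda>n. t * c n) N = t *\<^sub>C psum x c N"
  by (simp add: psum_def cscale_sum cscale_simps)

lemma psum_sum: "psum x (\<lambda>n. \<Sum>j\<in>J. c j n) N = (\<Sum>j\<in>J. psum x (c j) N)"
  unfolding psum_def sum_cscale by (rule sum.swap)

lemma psum_eq_0: "(\<And>n. n < N \<Longrightarrow> c n = 0) \<Longrightarrow> psum x c N = 0"
  by (simp add: psum_def cscale_simps)

lemma psum_diff: "m \<le> n \<Longrightarrow> (\<Sum>k\<in>{m..<n}. c k *\<^sub>C x k) = psum x c n - psum x c m"
  by (simp add: psum_def lessThan_atLeast0 sum_diff_nat_ivl)

section \<open>Blocks of natural numbers and rearrangements\<close>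

text \<open>
  The blocks \<open>[M k, M (k + 1))\<close> partition the natural numbers; \<open>b n\<close> is the number of the block
  that contains \<open>n\<close>.
\<close>

lemma block_index:
  fixes M :: "nat \<Rightarrow> nat"
  assumes "strict_mono M" "M 0 = 0"
  obtains b where "\<And>n. M (b n) \<le> n" "\<And>n. n < M (Suc (b n))"
    "\<And>n k. M k \<le> n \<Longrightarrow> n < M (Suc k) \<Longrightarrow> b n = k" "filterlim b at_top at_top"
proof -
  have ex: "\<exists>k. M k \<le> n \<and> n < M (Suc k)" for n
  proof -
    define k where "k = (LEAST k. n < M (Suc k))"
    have "n < M (Suc n)"
      using strict_mono_imp_increasing[OF assms(1), of "Suc n"] by simp
    then have 1: "n < M (Suc k)" unfolding k_def by (rule LeastI)
    have "M k \<le> n"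
    proof (cases k)
      case 0 then show ?thesis using assms by simp
    next
      case (Suc l)
      then have "\<not> n < M (Suc l)" using not_less_Least[of l "\<lambda>k. n < M (Suc k)"]
        by (simp add: k_def)
      then show ?thesis using Suc by simp
    qed
    with 1 show ?thesis by blast
  qed
  then obtain b where b: "\<And>n. M (b n) \<le> n" "\<And>n. n < M (Suc (b n))" by metis
  have uniq: "b n = k" if "M k \<le> n" "n < M (Suc k)" for n k
  proof (rule ccontr)
    assume "b n \<noteq> k"
    then consider "Suc (b n) \<le> k" | "Suc k \<le> b n" by linarith
    then show False
    proof cases
      case 1
      then have "M (Suc (b n)) \<le> M k" using assms(1) by (simp add: strict_mono_less_eq)
      then show False using that b(2)[of n] by linarith
    next
      case 2
      then have "M (Suc k) \<le> M (b n)" using assms(1) by (simp add: strict_mono_less_eq)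
      then show False using that b(1)[of n] by linarith
    qed
  qed
  have "filterlim b at_top at_top"
  proof (rule filterlim_at_top[THEN iffD2], intro allI)
    fix Z
    have "Z \<le> b n" if "M Z \<le> n" for n
    proof (rule ccontr)
      assume "\<not> Z \<le> b n"
      then have "M (Suc (b n)) \<le> M Z" using assms(1) by (simp add: strict_mono_less_eq)
      then show False using that b(2)[of n] by linarith
    qed
    then show "\<forall>\<^sub>F n in sequentially. Z \<le> b n"
      unfolding eventually_sequentially by blast
  qed
  with b uniq show ?thesis using that by blast
qed

text \<open>
  Moving a set \<open>G\<close> to the front of its segment turns the sum over \<open>G\<close> into a difference of two
  partial sums of the rearranged series.
\<close>

lemma permutation_of_segment:
  fixes G :: "nat set"
  assumes "G \<subseteq> {a..<b}" "a \<le> b"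
  obtains \<sigma> where "\<sigma> permutes {a..<b}" "\<sigma> ` {a..<a + card G} = G"
proof -
  have fin: "finite G" using assms finite_subset by blast
  have cG: "card G \<le> b - a" using card_mono[OF _ assms(1)] by simp
  obtain f where f: "bij_betw f {a..<a + card G} G"
    using finite_same_card_bij[of "{a..<a + card G}" G] fin by auto
  have "card {a + card G..<b} = card ({a..<b} - G)"
    using assms fin by (simp add: card_Diff_subset)
  then obtain h where h: "bij_betw h {a + card G..<b} ({a..<b} - G)"
    using finite_same_card_bij[of "{a + card G..<b}" "{a..<b} - G"] by auto
  define \<sigma> where "\<sigma> n = (if n \<in> {a..<a + card G} then f n
     else if n \<in> {a + card G..<b} then h n else n)" for n
  have 1: "bij_betw \<sigma> {a..<a + card G} G"
    by (rule bij_betw_cong[THEN iffD1, OF _ f]) (simp add: \<sigma>_def)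
  have 2: "bij_betw \<sigma> {a + card G..<b} ({a..<b} - G)"
    by (rule bij_betw_cong[THEN iffD1, OF _ h]) (auto simp add: \<sigma>_def)
  have "bij_betw \<sigma> ({a..<a + card G} \<union> {a + card G..<b}) (G \<union> ({a..<b} - G))"
    by (rule bij_betw_combine[OF 1 2]) auto
  moreover have "{a..<a + card G} \<union> {a + card G..<b} = {a..<b}" using cG assms(2) by auto
  moreover have "G \<union> ({a..<b} - G) = {a..<b}" using assms by auto
  ultimately have "bij_betw \<sigma> {a..<b} {a..<b}" by simp
  then have "\<sigma> permutes {a..<b}"
    by (rule bij_imp_permutes) (use cG assms(2) in \<open>auto simp: \<sigma>_def\<close>)
  moreover have "\<sigma> ` {a..<a + card G} = G" using 1 by (simp add: bij_betw_def)
  ultimately show ?thesis using that by blast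
qed

lemma blockwise_permutation:
  fixes M :: "nat \<Rightarrow> nat"
  assumes "strict_mono M" "M 0 = 0" and \<sigma>: "\<And>k. \<sigma> k permutes {M k..<M (Suc k)}"
  obtains \<pi> where "bij \<pi>" "\<And>k n. n \<in> {M k..<M (Suc k)} \<Longrightarrow> \<pi> n = \<sigma> k n"
proof -
  obtain b where b: "\<And>n. M (b n) \<le> n" "\<And>n. n < M (Suc (b n))"
    "\<And>n k. M k \<le> n \<Longrightarrow> n < M (Suc k) \<Longrightarrow> b n = k"
    using block_index[OF assms(1,2)] by metis
  define \<pi> where "\<pi> n = \<sigma> (b n) n" for n
  define \<rho> where "\<rho> n = inv (\<sigma> (b n)) n" for n
  have b1: "b (\<pi> n) = b n" for n
    using permutes_in_image[OF \<sigma>[of "b n"], of n] b by (simp add: \<pi>_def)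
  have b2: "b (\<rho> n) = b n" for n
    using permutes_in_image[OF permutes_inv[OF \<sigma>[of "b n"]], of n] b by (simp add: \<rho>_def)
  have "\<rho> (\<pi> n) = n" "\<pi> (\<rho> n) = n" for n
    unfolding \<rho>_def[of "\<pi> n"] \<pi>_def[of "\<rho> n"] b1 b2
    by (simp_all add: \<pi>_def \<rho>_def permutes_inverses[OF \<sigma>])
  then have "bij \<pi>" by (metis bijI' )
  moreover have "\<pi> n = \<sigma> k n" if "n \<in> {M k..<M (Suc k)}" for n k
    using b(3)[of k n] that by (simp add: \<pi>_def)
  ultimately show ?thesis using that by blast
qed

section \<open>Omitting finitely many terms\<close>

lemma enumerate_compl_finite:
  assumes "finite (F :: nat set)"
  shows "strict_mono (enumerate (- F))" "range (enumerate (- F)) = - F"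
    "bij_betw (enumerate (- F)) UNIV (- F)"
proof -
  have inf: "infinite (- F)" using assms by (simp add: Compl_eq_Diff_UNIV)
  show "strict_mono (enumerate (- F))" "range (enumerate (- F)) = - F"
    "bij_betw (enumerate (- F)) UNIV (- F)"
    using inf by (simp_all add: strict_mono_enumerate range_enumerate bij_enumerate)
qed

text \<open>
  Both kinds of partial sums are partial sums of the other series at an index that tends to
  infinity, so that deleting finitely many zero terms changes neither convergence nor the sum.
\<close>

lemma sum_omit_zeros:
  fixes z :: "nat \<Rightarrow> 'b :: comm_monoid_add"
  assumes F: "finite F" and z: "\<And>n. n \<in> F \<Longrightarrow> z n = 0"
  shows "(\<Sum>k<M. z (enumerate (- F) k)) = (\<Sum>n<enumerate (- F) M. z n)"
    "(\<Sum>n<N. z n) = (\<Sum>k<card ({..<N} - F). z (enumerate (- F) k))"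
proof -
  let ?e = "enumerate (- F)"
  note e = enumerate_compl_finite[OF F]
  have im: "?e ` {..<M} = {..<?e M} - F" for M
  proof (intro equalityI subsetI)
    fix n assume "n \<in> {..<?e M} - F"
    then obtain k where "n = ?e k" "?e k < ?e M" using e(2) by (metis Compl_iff DiffE imageE lessThan_iff)
    then show "n \<in> ?e ` {..<M}" using e(1) by (simp add: strict_mono_less)
  qed (use e in \<open>auto simp: strict_mono_less\<close>)
  have inj: "inj_on ?e A" for A using e(1) using enumerate_compl_finite(3)[OF F] by (meson bij_betw_def inj_on_subset subset_UNIV)
  show *: "(\<Sum>k<M. z (?e k)) = (\<Sum>n<?e M. z n)" for M
  proof -
    have "(\<Sum>k<M. z (?e k)) = sum z (?e ` {..<M})" by (simp add: sum.reindex[OF inj])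
    also have "\<dots> = (\<Sum>n<?e M. z n)" unfolding im
      by (rule sum.mono_neutral_left) (use z in auto)
    finally show ?thesis .
  qed
  define M where "M = (LEAST k. N \<le> ?e k)"
  have "N \<le> ?e N" using e(1) by (rule strict_mono_imp_increasing)
  then have M1: "N \<le> ?e M" unfolding M_def by (rule LeastI)
  have M2: "?e k < N" if "k < M" for k using not_less_Least[of k] that unfolding M_def by force
  have im2: "?e ` {..<M} = {..<N} - F"
  proof (intro equalityI subsetI)
    fix n assume "n \<in> ?e ` {..<M}" then show "n \<in> {..<N} - F" using M2 e(2) by auto
  next
    fix n assume "n \<in> {..<N} - F"
    then have "n \<in> {..<?e M} - F" using M1 by auto
    then show "n \<in> ?e ` {..<M}" using im by blast
  qed
  then have cM: "card ({..<N} - F) = M" using card_image[OF inj, of "{..<M}"] by simp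
  have "(\<Sum>n<N. z n) = sum z ({..<N} - F)"
    by (rule sum.mono_neutral_right) (use z in auto)
  also have "\<dots> = (\<Sum>k<M. z (?e k))"
    unfolding im2[symmetric] by (simp add: sum.reindex[OF inj])
  finally show "(\<Sum>n<N. z n) = (\<Sum>k<card ({..<N} - F). z (?e k))" using cM by simp
qed

lemma norm_sums_omit_zeros:
  assumes F: "finite F" and z: "\<And>n. n \<in> F \<Longrightarrow> z n = 0"
  shows "norm_sums nrm (z \<circ> enumerate (- F)) s \<longleftrightarrow> norm_sums nrm z s"
proof
  let ?e = "enumerate (- F)"
  assume *: "norm_sums nrm (z \<circ> ?e) s"
  have "N - card F \<le> card ({..<N} - F)" for N
    using diff_card_le_card_Diff[OF F, of "{..<N}"] by simp
  then have "filterlim (\<lambda>N. card ({..<N} - F)) at_top at_top"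
    by (intro filterlim_at_top_mono[OF filterlim_minus_const_nat_at_top[of "card F"]] always_eventually) auto
  from filterlim_compose[OF *[unfolded norm_sums_def comp_def] this]
  show "norm_sums nrm z s"
    unfolding norm_sums_def using sum_omit_zeros(2)[of F z, OF F z] by simp
next
  let ?e = "enumerate (- F)"
  assume *: "norm_sums nrm z s"
  have "filterlim ?e at_top at_top"
    using enumerate_compl_finite(1)[OF F] by (rule filterlim_subseq)
  from filterlim_compose[OF *[unfolded norm_sums_def] this]
  show "norm_sums nrm (z \<circ> ?e) s"
    unfolding norm_sums_def comp_def using sum_omit_zeros(1)[of F z, OF F z] by simp
qed

section \<open>Unconditional convergence in seminormed function spaces\<close>

text \<open>
  The norm may vanish on nonzero elements, because series and bases are compared only through the
  norms of differences.
\<close>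

locale seminormed_function_space =
  fixes X :: "('a \<Rightarrow> complex) set" and nrm :: "('a \<Rightarrow> complex) \<Rightarrow> ennreal"
  assumes zero_mem: "0 \<in> X"
    and add_mem: "u \<in> X \<Longrightarrow> v \<in> X \<Longrightarrow> u + v \<in> X"
    and scale_mem: "u \<in> X \<Longrightarrow> c *\<^sub>C u \<in> X"
    and nrm_triangle: "u \<in> X \<Longrightarrow> v \<in> X \<Longrightarrow> nrm (u + v) \<le> nrm u + nrm v"
    and nrm_scale: "u \<in> X \<Longrightarrow> nrm (c *\<^sub>C u) = ennreal (cmod c) * nrm u"
    and nrm_finite: "u \<in> X \<Longrightarrow> nrm u < top"
begin

definition rnorm :: "('a \<Rightarrow> complex) \<Rightarrow> real"
  where "rnorm u = enn2real (nrm u)"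

lemma uminus_mem: "u \<in> X \<Longrightarrow> - u \<in> X"
  using scale_mem[of u "-1"] by (simp add: cscale_simps)

lemma diff_mem: "u \<in> X \<Longrightarrow> v \<in> X \<Longrightarrow> u - v \<in> X"
  using add_mem[of u "- v"] uminus_mem by simp

lemma sum_mem: "(\<And>i. i \<in> I \<Longrightarrow> u i \<in> X) \<Longrightarrow> (\<Sum>i\<in>I. u i) \<in> X"
  by (induct I rule: infinite_finite_induct) (auto simp: zero_mem intro: add_mem)

lemma nrm_eq: "u \<in> X \<Longrightarrow> nrm u = ennreal (rnorm u)"
  unfolding rnorm_def using nrm_finite by simp

lemma rnorm_nonneg: "0 \<le> rnorm u"
  by (simp add: rnorm_def)

lemma rnorm_triangle:
  assumes "u \<in> X" "v \<in> X" shows "rnorm (u + v) \<le> rnorm u + rnorm v"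
proof -
  have "ennreal (rnorm (u + v)) \<le> ennreal (rnorm u + rnorm v)"
    using nrm_triangle[OF assms] assms
    by (simp add: nrm_eq add_mem rnorm_nonneg)
  then show ?thesis by (subst (asm) ennreal_le_iff) (simp_all add: rnorm_nonneg)
qed

lemma rnorm_scale: "u \<in> X \<Longrightarrow> rnorm (c *\<^sub>C u) = cmod c * rnorm u"
  by (simp add: rnorm_def nrm_scale enn2real_mult)

lemma rnorm_zero [simp]: "rnorm 0 = 0"
  using rnorm_scale[OF zero_mem, of 0] by (simp add: cscale_simps)

lemma rnorm_minus: "u \<in> X \<Longrightarrow> rnorm (- u) = rnorm u"
  using rnorm_scale[of u "-1"] by (simp add: cscale_simps)

lemma rnorm_diff: "u \<in> X \<Longrightarrow> v \<in> X \<Longrightarrow> rnorm (u - v) \<le> rnorm u + rnorm v"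
  using rnorm_triangle[of u "- v"] by (simp add: uminus_mem rnorm_minus)

lemma rnorm_sum:
  "(\<And>i. i \<in> I \<Longrightarrow> u i \<in> X) \<Longrightarrow> rnorm (\<Sum>i\<in>I. u i) \<le> (\<Sum>i\<in>I. rnorm (u i))"
proof (induct I rule: infinite_finite_induct)
  case (insert i I)
  then have "rnorm (u i + (\<Sum>i\<in>I. u i)) \<le> rnorm (u i) + rnorm (\<Sum>i\<in>I. u i)"
    by (intro rnorm_triangle sum_mem) auto
  moreover have "rnorm (\<Sum>i\<in>I. u i) \<le> (\<Sum>i\<in>I. rnorm (u i))" using insert by auto
  ultimately show ?case unfolding sum.insert[OF insert.hyps(1,2)] by linarith
qed simp_all

lemma norm_sums_iff:
  assumes "\<And>n. y n \<in> X" "s \<in> X"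
  shows "norm_sums nrm y s \<longleftrightarrow> (\<lambda>n. rnorm ((\<Sum>k<n. y k) - s)) \<longlonglongrightarrow> 0"
proof -
  have "nrm ((\<Sum>k<n. y k) - s) = ennreal (rnorm ((\<Sum>k<n. y k) - s))" for n
    by (intro nrm_eq diff_mem sum_mem assms)
  then have "norm_sums nrm y s \<longleftrightarrow> (\<lambda>n. ennreal (rnorm ((\<Sum>k<n. y k) - s))) \<longlonglongrightarrow> ennreal 0"
    by (simp add: norm_sums_def)
  also have "\<dots> \<longleftrightarrow> (\<lambda>n. rnorm ((\<Sum>k<n. y k) - s)) \<longlonglongrightarrow> 0"
    by (rule tendsto_ennreal_iff) (auto simp: rnorm_nonneg)
  finally show ?thesis .
qed

lemma norm_sums_add:
  assumes y: "\<And>n. y n \<in> X" "s \<in> X" "norm_sums nrm y s"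
    and z: "\<And>n. z n \<in> X" "t \<in> X" "norm_sums nrm z t"
  shows "norm_sums nrm (\<lambda>n. y n + z n) (s + t)"
proof -
  have "(\<lambda>n. rnorm ((\<Sum>k<n. y k) - s) + rnorm ((\<Sum>k<n. z k) - t)) \<longlonglongrightarrow> 0 + 0"
    by (intro tendsto_add) (use norm_sums_iff y z in auto)
  then have *: "(\<lambda>n. rnorm ((\<Sum>k<n. y k) - s) + rnorm ((\<Sum>k<n. z k) - t)) \<longlonglongrightarrow> 0" by simp
  have "rnorm ((\<Sum>k<n. y k + z k) - (s + t)) \<le> rnorm ((\<Sum>k<n. y k) - s) + rnorm ((\<Sum>k<n. z k) - t)" for n
    using rnorm_triangle[of "(\<Sum>k<n. y k) - s" "(\<Sum>k<n. z k) - t"] y z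
    by (simp add: diff_mem sum_mem sum.distrib algebra_simps)
  then have "(\<lambda>n. rnorm ((\<Sum>k<n. y k + z k) - (s + t))) \<longlonglongrightarrow> 0"
    by (intro tendsto_sandwich[OF _ _ tendsto_const *]) (auto simp: rnorm_nonneg)
  then show ?thesis using y z by (subst norm_sums_iff) (auto intro: add_mem)
qed

lemma norm_sums_scale:
  assumes y: "\<And>n. y n \<in> X" "s \<in> X" "norm_sums nrm y s"
  shows "norm_sums nrm (\<lambda>n. c *\<^sub>C y n) (c *\<^sub>C s)"
proof -
  have "(\<lambda>n. cmod c * rnorm ((\<Sum>k<n. y k) - s)) \<longlonglongrightarrow> cmod c * 0"
    by (intro tendsto_mult_left) (use norm_sums_iff y in auto)
  moreover have "rnorm ((\<Sum>k<n. c *\<^sub>C y k) - c *\<^sub>C s) = cmod c * rnorm ((\<Sum>k<n. y k) - s)" for n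
    by (simp add: rnorm_scale[symmetric] y diff_mem sum_mem cscale_sum[symmetric] cscale_simps(2)[symmetric])
  ultimately have "(\<lambda>n. rnorm ((\<Sum>k<n. c *\<^sub>C y k) - c *\<^sub>C s)) \<longlonglongrightarrow> 0" by simp
  then show ?thesis using y by (subst norm_sums_iff) (auto intro: scale_mem)
qed

lemma norm_sums_finite:
  assumes "\<And>n. y n \<in> X" "finite F"
  shows "norm_sums nrm (\<lambda>n. if n \<in> F then y n else 0) (\<Sum>n\<in>F. y n)"
proof -
  obtain K where K: "F \<subseteq> {..<K}" using assms(2) finite_nat_iff_bounded by blast
  have "(\<Sum>n<N. if n \<in> F then y n else 0) - (\<Sum>n\<in>F. y n) = 0" if "N \<ge> K" for N
  proof -
    have "(\<Sum>n<N. if n \<in> F then y n else 0) = (\<Sum>n\<in>F. y n)"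
      by (subst sum.mono_neutral_cong_right[of _ F _ y]) (use that K in auto)
    then show ?thesis by simp
  qed
  then have "(\<lambda>N. rnorm ((\<Sum>n<N. if n \<in> F then y n else 0) - (\<Sum>n\<in>F. y n))) \<longlonglongrightarrow> 0"
    by (intro tendsto_eventually eventually_sequentiallyI[of K]) simp
  then show ?thesis using assms by (subst norm_sums_iff) (auto intro: zero_mem sum_mem)
qed

lemma unconditionally_convergent_add:
  assumes "\<And>n. y n \<in> X" "\<And>n. z n \<in> X"
    "unconditionally_convergent X nrm y" "unconditionally_convergent X nrm z"
  shows "unconditionally_convergent X nrm (\<lambda>n. y n + z n)"
  unfolding unconditionally_convergent_def
proof (intro allI impI)
  fix \<pi> :: "nat \<Rightarrow> nat" assume "bij \<pi>"
  then obtain s t where "s \<in> X" "norm_sums nrm (y \<circ> \<pi>) s" "t \<in> X" "norm_sums nrm (z \<circ> \<pi>) t"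
    using assms(3,4) unfolding unconditionally_convergent_def by blast
  then have "norm_sums nrm (\<lambda>n. (y \<circ> \<pi>) n + (z \<circ> \<pi>) n) (s + t)"
    by (intro norm_sums_add) (use assms in \<open>auto simp: comp_def\<close>)
  then show "\<exists>s\<in>X. norm_sums nrm ((\<lambda>n. y n + z n) \<circ> \<pi>) s"
    using add_mem \<open>s \<in> X\<close> \<open>t \<in> X\<close> by (auto simp: comp_def)
qed

lemma unconditionally_convergent_scale:
  assumes "\<And>n. y n \<in> X" "unconditionally_convergent X nrm y"
  shows "unconditionally_convergent X nrm (\<lambda>n. c *\<^sub>C y n)"
  unfolding unconditionally_convergent_def
proof (intro allI impI)
  fix \<pi> :: "nat \<Rightarrow> nat" assume "bij \<pi>"
  then obtain s where "s \<in> X" "norm_sums nrm (y \<circ> \<pi>) s"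
    using assms(2) unfolding unconditionally_convergent_def by blast
  then have "norm_sums nrm (\<lambda>n. c *\<^sub>C (y \<circ> \<pi>) n) (c *\<^sub>C s)"
    by (intro norm_sums_scale) (use assms in \<open>auto simp: comp_def\<close>)
  then show "\<exists>s\<in>X. norm_sums nrm ((\<lambda>n. c *\<^sub>C y n) \<circ> \<pi>) s"
    using scale_mem \<open>s \<in> X\<close> by (auto simp: comp_def)
qed

lemma unconditionally_convergent_finite:
  assumes y: "\<And>n. y n \<in> X" and F: "finite F"
  shows "unconditionally_convergent X nrm (\<lambda>n. if n \<in> F then y n else 0)"
  unfolding unconditionally_convergent_def
proof (intro allI impI)
  fix \<pi> :: "nat \<Rightarrow> nat" assume "bij \<pi>"
  then have "finite (\<pi> -` F)" using F by (simp add: bij_is_inj finite_vimageI)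
  then have "norm_sums nrm (\<lambda>n. if n \<in> \<pi> -` F then y (\<pi> n) else 0) (\<Sum>n\<in>\<pi> -` F. y (\<pi> n))"
    by (intro norm_sums_finite y)
  then show "\<exists>s\<in>X. norm_sums nrm ((\<lambda>n. if n \<in> F then y n else 0) \<circ> \<pi>) s"
    using y by (auto simp: comp_def intro: sum_mem)
qed

text \<open>
  A permutation of the shortened series extends by the identity on \<open>F\<close>.  Conversely, a permutation
  \<open>\<pi>\<close> of the full series maps the complement of \<open>\<pi>\<^sup>-\<^sup>1(F)\<close> onto the complement of \<open>F\<close>; in terms of
  the two increasing enumerations it is a permutation of the shortened series.
\<close>

lemma unconditionally_convergent_omit_zeros:
  assumes F: "finite F" and z: "\<And>n. n \<in> F \<Longrightarrow> z n = 0"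
  shows "unconditionally_convergent X nrm (z \<circ> enumerate (- F)) \<longleftrightarrow> unconditionally_convergent X nrm z"
proof
  let ?e = "enumerate (- F)"
  note e = enumerate_compl_finite[OF F]
  assume *: "unconditionally_convergent X nrm (z \<circ> ?e)"
  show "unconditionally_convergent X nrm z"
    unfolding unconditionally_convergent_def
  proof (intro allI impI)
    fix \<pi> :: "nat \<Rightarrow> nat" assume bij: "bij \<pi>"
    let ?G = "\<pi> -` F"
    have G: "finite ?G" using F bij by (simp add: bij_is_inj finite_vimageI)
    note e' = enumerate_compl_finite[OF G]
    have "bij_betw \<pi> (- ?G) (- F)"
      using bij by (auto simp: bij_betw_def inj_on_def surj_def image_iff)
    then have "bij (inv_into UNIV ?e \<circ> (\<pi> \<circ> enumerate (- ?G)))"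
      using bij_betw_trans[OF bij_betw_trans[OF e'(3)] bij_betw_inv_into[OF e(3)]] by blast
    then obtain s where s: "s \<in> X" "norm_sums nrm ((z \<circ> ?e) \<circ> (inv_into UNIV ?e \<circ> (\<pi> \<circ> enumerate (- ?G)))) s"
      using * unfolding unconditionally_convergent_def by blast
    have "?e (inv_into UNIV ?e (\<pi> (enumerate (- ?G) n))) = \<pi> (enumerate (- ?G) n)" for n
      by (rule f_inv_into_f) (use e(2) e'(2) in blast)
    then have "norm_sums nrm ((z \<circ> \<pi>) \<circ> enumerate (- ?G)) s"
      using s(2) by (simp add: comp_def)
    then have "norm_sums nrm (z \<circ> \<pi>) s"
      by (subst (asm) norm_sums_omit_zeros[OF G]) (use z in auto)
    then show "\<exists>s\<in>X. norm_sums nrm (z \<circ> \<pi>) s" using s by blast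
  qed
next
  let ?e = "enumerate (- F)"
  note e = enumerate_compl_finite[OF F]
  assume *: "unconditionally_convergent X nrm z"
  show "unconditionally_convergent X nrm (z \<circ> ?e)"
    unfolding unconditionally_convergent_def
  proof (intro allI impI)
    fix \<pi> :: "nat \<Rightarrow> nat" assume bij: "bij \<pi>"
    define \<sigma> where "\<sigma> n = (if n \<in> F then n else ?e (\<pi> (inv_into UNIV ?e n)))" for n
    have "bij_betw (?e \<circ> (\<pi> \<circ> inv_into UNIV ?e)) (- F) (- F)"
      using bij_betw_trans[OF bij_betw_trans[OF bij_betw_inv_into[OF e(3)] bij] e(3)] by (simp add: comp_assoc)
    then have 1: "bij_betw \<sigma> (- F) (- F)"
      by (rule bij_betw_cong[THEN iffD1, rotated]) (simp add: \<sigma>_def)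
    have 2: "bij_betw \<sigma> F F"
      by (rule bij_betw_cong[THEN iffD1, OF _ bij_betw_id]) (simp add: \<sigma>_def)
    have "bij \<sigma>" using bij_betw_combine[OF 1 2] by (simp add: Un_commute)
    then obtain s where s: "s \<in> X" "norm_sums nrm (z \<circ> \<sigma>) s"
      using * unfolding unconditionally_convergent_def by blast
    have "norm_sums nrm (z \<circ> \<sigma> \<circ> ?e) s"
      by (subst norm_sums_omit_zeros[OF F]) (use z s in \<open>auto simp: \<sigma>_def\<close>)
    moreover have "\<sigma> (?e n) = ?e (\<pi> n)" for n
    proof -
      have "?e n \<notin> F" using e(2) by blast
      then show ?thesis using e(3) by (simp add: \<sigma>_def bij_betw_def)
    qed
    ultimately have "norm_sums nrm ((z \<circ> ?e) \<circ> \<pi>) s" by (simp add: comp_def)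
    then show "\<exists>s\<in>X. norm_sums nrm ((z \<circ> ?e) \<circ> \<pi>) s" using s by blast
  qed
qed

text \<open>
  If sums over finite sets far out do not become small, choose such sets \<open>G\<^sub>0, G\<^sub>1, \<dots>\<close> in successive
  blocks and move each of them to the front of its block.  The partial sums of this rearrangement
  are not Cauchy.
\<close>

lemma unconditionally_convergent_Cauchy:
  assumes y: "\<And>n. y n \<in> X" and uc: "unconditionally_convergent X nrm y" and "\<epsilon> > 0"
  obtains M where "\<And>G. finite G \<Longrightarrow> G \<subseteq> {M..} \<Longrightarrow> rnorm (\<Sum>n\<in>G. y n) \<le> \<epsilon>"
proof (rule ccontr)
  assume "\<not> thesis"
  then have "\<forall>M. \<exists>G. finite G \<and> G \<subseteq> {M..} \<and> rnorm (\<Sum>n\<in>G. y n) > \<epsilon>"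
    using that by (meson not_le)
  then obtain G where G: "\<And>M. finite (G M)" "\<And>M. G M \<subseteq> {M..}"
      "\<And>M. rnorm (\<Sum>n\<in>G M. y n) > \<epsilon>"
    by metis
  define M where "M = rec_nat 0 (\<lambda>_ m. Suc (Max (insert m (G m))))"
  have M0: "M 0 = 0" and MS: "M (Suc k) = Suc (Max (insert (M k) (G (M k))))" for k
    by (simp_all add: M_def)
  have sub: "G (M k) \<subseteq> {M k..<M (Suc k)}" for k
    using G(1)[of "M k"] G(2)[of "M k"] by (auto simp: MS less_Suc_eq_le intro: Max_ge)
  have mono: "strict_mono M"
    by (rule strict_mono_Suc_iff[THEN iffD2]) (use G(1) in \<open>simp add: MS less_Suc_eq_le\<close>)
  then have le: "M k \<le> M (Suc k)" for k by (simp add: strict_mono_less_eq)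
  have "\<exists>\<sigma>. \<sigma> permutes {M k..<M (Suc k)} \<and> \<sigma> ` {M k..<M k + card (G (M k))} = G (M k)" for k
    using permutation_of_segment[OF sub le] by metis
  then obtain \<sigma> where \<sigma>: "\<And>k. \<sigma> k permutes {M k..<M (Suc k)}"
      "\<And>k. \<sigma> k ` {M k..<M k + card (G (M k))} = G (M k)"
    by metis
  obtain \<pi> where \<pi>: "bij \<pi>" "\<And>k n. n \<in> {M k..<M (Suc k)} \<Longrightarrow> \<pi> n = \<sigma> k n"
    using blockwise_permutation[OF mono M0 \<sigma>(1)] by metis
  obtain s where s: "s \<in> X" "norm_sums nrm (y \<circ> \<pi>) s"
    using uc \<pi>(1) unfolding unconditionally_convergent_def by blast
  have "(\<lambda>n. rnorm ((\<Sum>k<n. y (\<pi> k)) - s)) \<longlonglongrightarrow> 0"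
    using norm_sums_iff[of "y \<circ> \<pi>" s] y s by simp
  then obtain K where K: "\<And>n. n \<ge> K \<Longrightarrow> rnorm ((\<Sum>k<n. y (\<pi> k)) - s) < \<epsilon> / 2"
    using LIMSEQ_D[of _ 0 "\<epsilon> / 2"] \<open>\<epsilon> > 0\<close> rnorm_nonneg by fastforce
  let ?a = "M K" let ?b = "M K + card (G (M K))"
  have "K \<le> ?a" using strict_mono_imp_increasing[OF mono] .
  have "card (G ?a) \<le> M (Suc K) - ?a"
    using card_mono[OF finite_atLeastLessThan sub[of K]] by (simp only: card_atLeastLessThan)
  then have b: "?b \<le> M (Suc K)" using le[of K] by linarith
  have "\<pi> ` {?a..<?b} = \<sigma> K ` {?a..<?b}"
    by (rule image_cong) (use \<pi>(2)[of _ K] b in auto)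
  then have "\<pi> ` {?a..<?b} = G ?a" using \<sigma>(2)[of K] by simp
  then have "(\<Sum>n\<in>G ?a. y n) = (\<Sum>k\<in>{?a..<?b}. y (\<pi> k))"
    using sum.reindex[of \<pi> "{?a..<?b}" y] \<pi>(1) by (simp add: bij_is_inj inj_on_subset[OF bij_is_inj])
  also have "\<dots> = (\<Sum>k<?b. y (\<pi> k)) - (\<Sum>k<?a. y (\<pi> k))"
    by (simp add: lessThan_atLeast0 sum_diff_nat_ivl)
  also have "\<dots> = ((\<Sum>k<?b. y (\<pi> k)) - s) - ((\<Sum>k<?a. y (\<pi> k)) - s)" by simp
  finally have "rnorm (\<Sum>n\<in>G ?a. y n) = rnorm (((\<Sum>k<?b. y (\<pi> k)) - s) - ((\<Sum>k<?a. y (\<pi> k)) - s))"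
    by (rule arg_cong)
  also have "\<dots> \<le> rnorm ((\<Sum>k<?b. y (\<pi> k)) - s) + rnorm ((\<Sum>k<?a. y (\<pi> k)) - s)"
    by (intro rnorm_diff diff_mem sum_mem s y)
  also have "\<dots> < \<epsilon> / 2 + \<epsilon> / 2"
    using K[of ?a] K[of ?b] \<open>K \<le> ?a\<close> by (intro add_strict_mono) auto
  finally show False using G(3)[of ?a] by linarith
qed

text \<open>
  After the terms with index in \<open>F\<close> are removed, the series is an expansion in the unconditional
  basis.
\<close>

lemma near_basis_unconditional:
  assumes x: "\<And>n. x n \<in> X" and basis: "unconditional_basis_plus_finite X nrm x"
    and f: "f \<in> X" "norm_sums nrm (\<lambda>n. c n *\<^sub>C x n) f"
  shows "unconditionally_convergent X nrm (\<lambda>n. c n *\<^sub>C x n)"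
proof -
  obtain F where F: "finite F" "unconditional_basis X nrm (x \<circ> enumerate (- F))"
    using basis unfolding unconditional_basis_plus_finite_def by blast
  let ?e = "enumerate (- F)"
  let ?y = "\<lambda>n. c n *\<^sub>C x n"
  let ?p = "\<lambda>n. if n \<in> F then ?y n else 0"
  let ?z = "\<lambda>n. if n \<in> F then 0 else ?y n"
  have y: "?y n \<in> X" for n by (simp add: scale_mem x)
  have p: "?p n \<in> X" for n using y zero_mem by simp
  have z: "?z n \<in> X" for n using y zero_mem by simp
  have "norm_sums nrm (\<lambda>n. ?y n + (- 1) *\<^sub>C ?p n) (f + (- 1) *\<^sub>C (\<Sum>n\<in>F. ?y n))"
    by (intro norm_sums_add norm_sums_scale norm_sums_finite scale_mem sum_mem p F f x)
  moreover have "(\<lambda>n. ?y n + (- 1) *\<^sub>C ?p n) = ?z" by (auto simp: fun_eq_iff)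
  ultimately have "norm_sums nrm ?z (f - (\<Sum>n\<in>F. ?y n))" by (simp add: cscale_simps)
  then have "norm_sums nrm (?z \<circ> ?e) (f - (\<Sum>n\<in>F. ?y n))"
    by (subst norm_sums_omit_zeros[OF F(1)]) auto
  moreover have ze: "?z \<circ> ?e = (\<lambda>n. c (?e n) *\<^sub>C (x \<circ> ?e) n)"
    using enumerate_compl_finite(2)[OF F(1)] by (auto simp: fun_eq_iff)
  moreover have "f - (\<Sum>n\<in>F. ?y n) \<in> X" by (intro diff_mem sum_mem y f)
  ultimately have "unconditionally_convergent X nrm (?z \<circ> ?e)"
    using F(2) unfolding unconditional_basis_def by auto
  then have "unconditionally_convergent X nrm ?z"
    by (rule unconditionally_convergent_omit_zeros[OF F(1), THEN iffD1, rotated]) simp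
  then have "unconditionally_convergent X nrm (\<lambda>n. ?z n + ?p n)"
    using unconditionally_convergent_finite[of ?y F] y F(1)
    by (intro unconditionally_convergent_add z p) auto
  moreover have "(\<lambda>n. ?z n + ?p n) = ?y" by (auto simp: fun_eq_iff)
  ultimately show ?thesis by simp
qed

end

section \<open>Null series of a frame\<close>

context seminormed_function_space
begin

lemma psum_mem: "(\<And>n. x n \<in> X) \<Longrightarrow> psum x c N \<in> X"
  by (auto simp: psum_def intro!: sum_mem scale_mem)

lemma norm_sums_psum:
  assumes "\<And>n. x n \<in> X" "f \<in> X"
  shows "norm_sums nrm (\<lambda>n. c n *\<^sub>C x n) f \<longleftrightarrow> (\<lambda>N. rnorm (psum x c N - f)) \<longlonglongrightarrow> 0"
  using norm_sums_iff[of "\<lambda>n. c n *\<^sub>C x n" f] assms by (simp add: psum_def scale_mem)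

lemma norm_sums_coeff_add:
  assumes x: "\<And>n. x n \<in> X" and "f \<in> X" "g \<in> X"
    and "norm_sums nrm (\<lambda>n. c n *\<^sub>C x n) f" "norm_sums nrm (\<lambda>n. d n *\<^sub>C x n) g"
  shows "norm_sums nrm (\<lambda>n. (c n + t * d n) *\<^sub>C x n) (f + t *\<^sub>C g)"
proof -
  have "norm_sums nrm (\<lambda>n. c n *\<^sub>C x n + t *\<^sub>C d n *\<^sub>C x n) (f + t *\<^sub>C g)"
    by (intro norm_sums_add norm_sums_scale scale_mem assms)
  then show ?thesis by (simp add: cscale_simps)
qed

text \<open>
  In a Banach space a bound of this kind means that \<open>\<Sum> u\<^sub>j\<close> is weakly unconditionally Cauchy; by
  the theorem of Bessaga and Pelczynski, such a sequence whose norms do not tend to 0 exists exactly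
  when the space has a subspace isomorphic to \<open>c\<^sub>0\<close>.
\<close>

definition contains_no_c0 :: bool
  where "contains_no_c0 \<longleftrightarrow> (\<forall>u C. (\<forall>j::nat. u j \<in> X) \<longrightarrow>
     (\<forall>a J. finite J \<longrightarrow> (\<forall>j. cmod (a j) \<le> 1) \<longrightarrow> rnorm (\<Sum>j\<in>J. a j *\<^sub>C u j) \<le> C) \<longrightarrow>
     (\<lambda>j. rnorm (u j)) \<longlonglongrightarrow> 0)"

lemma alternative_dual_add_null:
  assumes frame: "schauder_frame X nrm x y"
    and null: "norm_sums nrm (\<lambda>n. d n *\<^sub>C x n) 0" and h: "h \<in> dual_space X nrm"
  shows "alternative_dual X nrm x (\<lambda>n f. y n f + h f * d n)"
  unfolding alternative_dual_def
proof (intro conjI allI)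
  have x: "x n \<in> X" and y: "y n \<in> dual_space X nrm" for n
    using frame by (auto simp: schauder_frame_def)
  show "reproducing X nrm x (\<lambda>n f. y n f + h f * d n)"
    unfolding reproducing_def
  proof
    fix f assume f: "f \<in> X"
    then have "norm_sums nrm (\<lambda>n. y n f *\<^sub>C x n) f"
      using frame by (simp add: schauder_frame_def reproducing_def)
    from norm_sums_coeff_add[OF x f zero_mem this null, of "h f"]
    show "norm_sums nrm (\<lambda>n. (y n f + h f * d n) *\<^sub>C x n) f" by (simp add: cscale_simps)
  qed
  fix n
  obtain C D where C: "\<And>u. u \<in> X \<Longrightarrow> ennreal (cmod (y n u)) \<le> ennreal C * nrm u"
    and D: "\<And>u. u \<in> X \<Longrightarrow> ennreal (cmod (h u)) \<le> ennreal D * nrm u"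
    using y[of n] h unfolding dual_space_def by blast
  have "ennreal (cmod (y n u + h u * d n)) \<le> ennreal (\<bar>C\<bar> + \<bar>D\<bar> * cmod (d n)) * nrm u" if u: "u \<in> X" for u
  proof -
    have "cmod (y n u) \<le> \<bar>C\<bar> * rnorm u" "cmod (h u) \<le> \<bar>D\<bar> * rnorm u"
    proof -
      have "ennreal (cmod (y n u)) \<le> ennreal \<bar>C\<bar> * nrm u"
        using C[OF u] by (rule order_trans) (intro mult_right_mono ennreal_leI, auto)
      then show "cmod (y n u) \<le> \<bar>C\<bar> * rnorm u"
        by (simp add: nrm_eq u rnorm_nonneg flip: ennreal_mult)
      have "ennreal (cmod (h u)) \<le> ennreal \<bar>D\<bar> * nrm u"
        using D[OF u] by (rule order_trans) (intro mult_right_mono ennreal_leI, auto)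
      then show "cmod (h u) \<le> \<bar>D\<bar> * rnorm u"
        by (simp add: nrm_eq u rnorm_nonneg flip: ennreal_mult)
    qed
    then have "cmod (y n u) + cmod (h u) * cmod (d n) \<le> \<bar>C\<bar> * rnorm u + (\<bar>D\<bar> * rnorm u) * cmod (d n)"
      by (intro add_mono mult_right_mono) auto
    moreover have "cmod (y n u + h u * d n) \<le> cmod (y n u) + cmod (h u) * cmod (d n)"
      using norm_triangle_ineq[of "y n u" "h u * d n"] by (simp add: norm_mult)
    ultimately have "cmod (y n u + h u * d n) \<le> (\<bar>C\<bar> + \<bar>D\<bar> * cmod (d n)) * rnorm u"
      by (simp add: algebra_simps)
    then show ?thesis
      by (simp add: nrm_eq u rnorm_nonneg ennreal_leI flip: ennreal_mult del: ennreal_plus)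
  qed
  then have "\<exists>C. \<forall>u\<in>X. ennreal (cmod (y n u + h u * d n)) \<le> ennreal C * nrm u" by blast
  moreover have "y n (u + v) + h (u + v) * d n = (y n u + h u * d n) + (y n v + h v * d n)"
    "y n (t *\<^sub>C u) + h (t *\<^sub>C u) * d n = t * (y n u + h u * d n)" if "u \<in> X" "v \<in> X" for t u v
    using y[of n] h that unfolding dual_space_def by (simp_all add: algebra_simps)
  ultimately show "(\<lambda>f. y n f + h f * d n) \<in> dual_space X nrm"
    unfolding dual_space_def by blast
qed

text \<open>
  Subtracting the frame expansion of \<open>f\<close> leaves a null series \<open>d\<close>.  Some functional \<open>y\<^sub>m\<close> of the
  frame does not vanish at \<open>e\<close>, and the expansions of \<open>e\<close> along \<open>y\<close> and along the alternative dual
  \<open>y\<^sub>n + d\<^sub>n y\<^sub>m\<close> differ by a nonzero multiple of \<open>\<Sum> d\<^sub>n x\<^sub>n\<close>.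
\<close>

lemma convergent_imp_unconditional:
  assumes frame: "schauder_frame X nrm x y" and nz: "e \<in> X" "rnorm e \<noteq> 0"
    and alt: "\<And>\<phi> f. alternative_dual X nrm x \<phi> \<Longrightarrow> f \<in> X \<Longrightarrow>
      unconditionally_convergent X nrm (\<lambda>n. \<phi> n f *\<^sub>C x n)"
    and f: "f \<in> X" "norm_sums nrm (\<lambda>n. c n *\<^sub>C x n) f"
  shows "unconditionally_convergent X nrm (\<lambda>n. c n *\<^sub>C x n)"
proof -
  have x: "x n \<in> X" and y: "y n \<in> dual_space X nrm" for n
    using frame by (auto simp: schauder_frame_def)
  have rep: "norm_sums nrm (\<lambda>n. y n f *\<^sub>C x n) f" if "f \<in> X" for f
    using frame that by (simp add: schauder_frame_def reproducing_def)
  have "\<exists>m. y m e \<noteq> 0"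
  proof (rule ccontr)
    assume "\<not> (\<exists>m. y m e \<noteq> 0)"
    then have "(\<lambda>N. rnorm (psum x (\<lambda>n. 0) N - e)) \<longlonglongrightarrow> 0"
      using rep[OF nz(1)] norm_sums_psum[OF x nz(1), of "\<lambda>n. 0"] by simp
    then have "(\<lambda>N::nat. rnorm e) \<longlonglongrightarrow> 0" using rnorm_minus[OF nz(1)] by (simp add: psum_eq_0)
    then show False using nz(2) LIMSEQ_const_iff by blast
  qed
  then obtain m where m: "y m e \<noteq> 0" by blast
  define d where "d n = c n + (- 1) * y n f" for n
  have "norm_sums nrm (\<lambda>n. d n *\<^sub>C x n) (f + (- 1) *\<^sub>C f)"
    unfolding d_def by (rule norm_sums_coeff_add[OF x f(1) f(1) f(2) rep[OF f(1)]])
  then have "norm_sums nrm (\<lambda>n. d n *\<^sub>C x n) 0" by (simp add: cscale_simps)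
  from alt[OF alternative_dual_add_null[OF frame this y[of m]] nz(1)]
  have 1: "unconditionally_convergent X nrm (\<lambda>n. (y n e + y m e * d n) *\<^sub>C x n)" .
  have self: "alternative_dual X nrm x y"
    using frame by (simp add: alternative_dual_def schauder_frame_def)
  have "unconditionally_convergent X nrm
     (\<lambda>n. (1 / y m e) *\<^sub>C ((y n e + y m e * d n) *\<^sub>C x n + (- 1) *\<^sub>C y n e *\<^sub>C x n) + y n f *\<^sub>C x n)"
    by (intro unconditionally_convergent_add unconditionally_convergent_scale 1 alt[OF self]
        scale_mem add_mem x nz f)
  moreover have "(1 / y m e) *\<^sub>C ((y n e + y m e * d n) *\<^sub>C x n + (- 1) *\<^sub>C y n e *\<^sub>C x n) + y n f *\<^sub>C x n
     = c n *\<^sub>C x n" for n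
    using m by (simp add: fun_eq_iff d_def field_simps)
  ultimately show ?thesis by simp
qed

text \<open>
  The partial sums of a nonzero null series are bounded and not all 0, since consecutive ones
  differ by the terms; so their supremum can be scaled to 1.
\<close>

lemma normalized_null_series:
  assumes x: "\<And>n. x n \<in> X" "\<And>n. rnorm (x n) \<noteq> 0"
    and c: "(\<lambda>N. rnorm (psum x c N)) \<longlonglongrightarrow> 0" "c m \<noteq> 0"
  obtains t H where "t \<noteq> 0" "\<And>N. rnorm (psum x (\<lambda>n. t * c n) N) \<le> 1"
    "rnorm (psum x (\<lambda>n. t * c n) H) \<ge> 1/2"
proof -
  let ?r = "\<lambda>N. rnorm (psum x c N)"
  have bdd: "bdd_above (range ?r)"
    by (rule Bseq_bdd_above[OF convergent_imp_Bseq[OF convergentI[OF c(1)]]])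
  define s where "s = (SUP N. ?r N)"
  have le: "?r N \<le> s" for N unfolding s_def by (rule cSUP_upper[OF _ bdd]) simp
  have "0 < rnorm (x m)" using x(2)[of m] rnorm_nonneg[of "x m"] by linarith
  then have "0 < rnorm (c m *\<^sub>C x m)" using c(2) by (simp add: rnorm_scale x)
  also have "c m *\<^sub>C x m = psum x c (Suc m) - psum x c m" by (simp add: psum_def)
  also have "rnorm \<dots> \<le> ?r (Suc m) + ?r m" by (intro rnorm_diff psum_mem x)
  also have "\<dots> \<le> s + s" by (intro add_mono le)
  finally have s: "s > 0" by simp
  obtain H where H: "?r H > s / 2"
    using less_cSUP_iff[OF _ bdd, of "s / 2"] s unfolding s_def[symmetric] by auto
  have eq: "rnorm (psum x (\<lambda>n. complex_of_real (1/s) * c n) N) = ?r N / s" for N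
    unfolding psum_scale using s by (simp add: rnorm_scale psum_mem x norm_divide)
  show ?thesis
    using that[of "complex_of_real (1/s)" H] unfolding eq using s le H by (simp add: field_simps)
qed

text \<open>
  The gliding hump.  Otherwise there are normalized null series with arbitrarily late beginning.
  The one with number \<open>j\<close> vanishes before \<open>M j\<close>, has its hump before \<open>M (j + 1)\<close>, and \<open>M (j + 1)\<close>
  lies so far out that from there on the partial sums of the series \<open>0, \<dots>, j\<close> are at most
  \<open>4\<^sup>-\<^sup>(\<^sup>j\<^sup>+\<^sup>1\<^sup>)\<close>.
\<close>

lemma tail_series_determined:
  assumes x: "\<And>n. x n \<in> X" "\<And>n. rnorm (x n) \<noteq> 0"
    and uc: "\<And>c. norm_sums nrm (\<lambda>n. c n *\<^sub>C x n) 0 \<Longrightarrow> unconditionally_convergent X nrm (\<lambda>n. c n *\<^sub>C x n)"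
    and c0: contains_no_c0
  obtains K where "\<And>c. norm_sums nrm (\<lambda>n. c n *\<^sub>C x n) 0 \<Longrightarrow> (\<And>n. n < K \<Longrightarrow> c n = 0) \<Longrightarrow> c = (\<lambda>_. 0)"
proof (rule ccontr)
  let ?null = "\<lambda>c. (\<lambda>N. rnorm (psum x c N)) \<longlonglongrightarrow> 0"
  have null_iff: "norm_sums nrm (\<lambda>n. c n *\<^sub>C x n) 0 \<longleftrightarrow> ?null c" for c
    using norm_sums_psum[OF x(1) zero_mem] by simp
  assume "\<not> thesis"
  then have ex: "\<exists>c m. ?null c \<and> (\<forall>n<K. c n = 0) \<and> c m \<noteq> 0" for K
    using that null_iff by (metis ext)
  have "\<exists>c H. ?null c \<and> (\<forall>n<K. c n = 0) \<and> (\<forall>N. rnorm (psum x c N) \<le> 1) \<and> rnorm (psum x c H) \<ge> 1/2" for K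
  proof -
    obtain c m where c: "?null c" "\<forall>n<K. c n = 0" "c m \<noteq> 0" using ex by blast
    obtain t H where t: "\<And>N. rnorm (psum x (\<lambda>n. t * c n) N) \<le> 1" "rnorm (psum x (\<lambda>n. t * c n) H) \<ge> 1/2"
      using normalized_null_series[OF x c(1,3)] by metis
    have "(\<lambda>N. cmod t * rnorm (psum x c N)) \<longlonglongrightarrow> cmod t * 0" by (intro tendsto_mult_left c)
    then have "?null (\<lambda>n. t * c n)" unfolding psum_scale by (simp add: rnorm_scale psum_mem x)
    then show ?thesis using t c(2) by (intro exI[of _ "\<lambda>n. t * c n"] exI[of _ H]) auto
  qed
  then obtain C H where C: "\<And>K. ?null (C K)" "\<And>K n. n < K \<Longrightarrow> C K n = 0"
      "\<And>K N. rnorm (psum x (C K) N) \<le> 1" and H: "\<And>K. rnorm (psum x (C K) (H K)) \<ge> 1/2"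
    by metis
  have "\<exists>T. \<forall>N\<ge>T. rnorm (psum x (C K) N) \<le> (1/4) ^ j" for K and j :: nat
    using LIMSEQ_D[OF C(1), of "(1/4)^j" K] rnorm_nonneg by (force simp: less_imp_le)
  then obtain T where T: "\<And>K j N. N \<ge> T K j \<Longrightarrow> rnorm (psum x (C K) N) \<le> (1/4) ^ j" by metis
  \<comment> \<open>The sum over all \<open>i \<le> M j\<close> exceeds the thresholds of all earlier series at once.\<close>
  define M where "M = rec_nat 0 (\<lambda>j m. Suc (m + H m + (\<Sum>i\<le>m. T i (Suc j))))"
  have M0: "M 0 = 0" and MS: "M (Suc j) = Suc (M j + H (M j) + (\<Sum>i\<le>M j. T i (Suc j)))" for j
    by (simp_all add: M_def)
  have mono: "strict_mono M" by (rule strict_mono_Suc_iff[THEN iffD2]) (simp add: MS)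
  have id_le: "j \<le> M j" for j using strict_mono_imp_increasing[OF mono] .
  obtain b where b: "\<And>n. M (b n) \<le> n" "\<And>n. n < M (Suc (b n))" and b_lim: "filterlim b at_top at_top"
    using block_index[OF mono M0] by metis
  define c where "c j = C (M j)" for j
  define h where "h j = H (M j)" for j
  define u where "u j = psum x (c j) (h j)" for j
  have c_lt: "c j n = 0" if "n < M j" for j n using C(2) that by (simp add: c_def)
  have c1: "rnorm (psum x (c j) N) \<le> 1" for j N using C(3) by (simp add: c_def)
  have small: "rnorm (psum x (c i) N) \<le> (1/4) ^ j" if ij: "i < j" "M j \<le> N" for i j N
  proof -
    obtain l where l: "j = Suc l" using ij(1) by (cases j) auto
    have "M i \<le> M l" using mono ij l by (simp add: strict_mono_less_eq)
    then have "T (M i) j \<le> (\<Sum>i\<le>M l. T i j)"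
      using member_le_sum[of "M i" "{..M l}" "\<lambda>i. T i j"] by simp
    also have "\<dots> < M j" unfolding l MS by linarith
    also have "M j \<le> N" by (rule ij)
    finally have "T (M i) j \<le> N" by simp
    then show ?thesis unfolding c_def by (rule T)
  qed
  have psum_c_0: "psum x (c j) N = 0" if "N \<le> M j" for j N
    by (rule psum_eq_0) (use that c_lt in auto)
  have u_ge: "rnorm (u j) \<ge> 1/2" for j using H by (simp add: u_def c_def h_def)
  have u_le: "rnorm (u j) \<le> 1" for j using c1 by (simp add: u_def)
  have uX: "u j \<in> X" for j by (simp add: u_def psum_mem x)
  have h_ge: "M j \<le> h j" for j
  proof (rule ccontr)
    assume "\<not> M j \<le> h j"
    then have "u j = 0" unfolding u_def by (intro psum_c_0) simp
    then show False using u_ge[of j] by simp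
  qed
  have h_lt: "h j < M (Suc j)" for j by (simp add: MS h_def)
  \<comment> \<open>The coefficients of \<open>\<Sum>\<^sub>j a\<^sub>j c\<^sup>j\<close>; the terms with \<open>j > n\<close> vanish because \<open>n < j \<le> M j\<close>.\<close>
  define s where "s a n = (\<Sum>j\<le>n. a j * c j n)" for a :: "nat \<Rightarrow> complex" and n
  have psum_s: "psum x (s a) N = (\<Sum>j\<le>J. a j *\<^sub>C psum x (c j) N)" if N: "N \<le> M (Suc J)" for a N J
  proof -
    have "s a n = (\<Sum>j\<le>J. a j * c j n)" if n: "n < N" for n
      unfolding s_def
    proof (rule sum.mono_neutral_cong)
      fix j assume "j \<in> {..J} - {..n}"
      then have "n < M j" using id_le[of j] by simp
      then show "a j * c j n = 0" by (simp add: c_lt)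
    next
      fix j assume "j \<in> {..n} - {..J}"
      then have "M (Suc J) \<le> M j" using mono by (simp add: strict_mono_less_eq)
      then show "a j * c j n = 0" using n N by (simp add: c_lt)
    qed auto
    then have "psum x (s a) N = psum x (\<lambda>n. \<Sum>j\<le>J. a j * c j n) N"
      by (simp add: psum_def)
    then show ?thesis by (simp add: psum_sum psum_scale)
  qed
  \<comment> \<open>There are \<open>j\<close> terms of size \<open>4\<^sup>-\<^sup>j\<close>, and \<open>j \<le> 2\<^sup>j\<close>.\<close>
  have earlier: "rnorm (\<Sum>i<j. a i *\<^sub>C psum x (c i) N) \<le> (1/2)^j"
    if "\<And>j. cmod (a j) \<le> 1" "M j \<le> N" for a j N
  proof -
    have "rnorm (\<Sum>i<j. a i *\<^sub>C psum x (c i) N) \<le> (\<Sum>i<j. rnorm (a i *\<^sub>C psum x (c i) N))"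
      by (intro rnorm_sum scale_mem psum_mem x)
    also have "\<dots> \<le> (\<Sum>i<j. (1/4)^j)"
    proof (intro sum_mono)
      fix i assume "i \<in> {..<j}"
      then show "rnorm (a i *\<^sub>C psum x (c i) N) \<le> (1/4)^j"
        using mult_mono[OF that(1) small[of i j N]] that(2) rnorm_nonneg
        by (simp add: rnorm_scale psum_mem x)
    qed
    also have "\<dots> = real j * (1/4)^j" by simp
    also have "\<dots> \<le> 2^j * (1/4)^j"
      by (intro mult_right_mono) (use of_nat_less_two_power[of j, where ?'a = real] in auto)
    also have "\<dots> = (1/2)^j" by (simp flip: power_mult_distrib)
    finally show ?thesis .
  qed
  have s_null: "?null (s a)" if a: "\<And>j. cmod (a j) \<le> 1" "a \<longlonglongrightarrow> 0" for a
  proof -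
    have bound: "rnorm (psum x (s a) N) \<le> (1/2) ^ b N + cmod (a (b N))" for N
    proof -
      have eq: "psum x (s a) N = (\<Sum>j<b N. a j *\<^sub>C psum x (c j) N) + a (b N) *\<^sub>C psum x (c (b N)) N"
        using psum_s[of N "b N" a] b(2)[of N] by (simp add: less_imp_le flip: lessThan_Suc_atMost)
      have "rnorm (psum x (s a) N) \<le> rnorm (\<Sum>j<b N. a j *\<^sub>C psum x (c j) N) + rnorm (a (b N) *\<^sub>C psum x (c (b N)) N)"
        unfolding eq by (intro rnorm_triangle sum_mem scale_mem psum_mem x)
      also have "\<dots> \<le> (1/2) ^ b N + cmod (a (b N)) * 1"
      proof (rule add_mono)
        show "rnorm (\<Sum>j<b N. a j *\<^sub>C psum x (c j) N) \<le> (1/2) ^ b N"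
          by (rule earlier) (use a b in auto)
        show "rnorm (a (b N) *\<^sub>C psum x (c (b N)) N) \<le> cmod (a (b N)) * 1"
          unfolding rnorm_scale[OF psum_mem[OF x(1)]] by (intro mult_left_mono c1 norm_ge_zero)
      qed
      finally show ?thesis by simp
    qed
    have "(\<lambda>J. (1/2)^J + cmod (a J)) \<longlonglongrightarrow> 0 + cmod 0"
      by (intro tendsto_add tendsto_norm a LIMSEQ_power_zero) simp
    then have "(\<lambda>N. (1/2) ^ b N + cmod (a (b N))) \<longlonglongrightarrow> 0"
      using filterlim_compose[OF _ b_lim, of "\<lambda>J. (1/2)^J + cmod (a J)" "nhds 0"] by simp
    then show ?thesis
      by (rule tendsto_sandwich[OF _ _ tendsto_const, rotated 2]) (use bound rnorm_nonneg in auto)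
  qed
  \<comment> \<open>If the sums were unbounded, they would be unbounded on each tail.  Then successive sets \<open>J\<^sub>k\<close> with
  sums larger than \<open>(k + 1)\<^sup>2\<close>, weighted by \<open>1 / (k + 1)\<close>, give coefficients \<open>a\<^sub>j \<longlonglongrightarrow> 0\<close> for which
  the series \<open>\<Sum> a\<^sub>j c\<^sup>j\<close> is not unconditionally Cauchy.\<close>
  have "\<exists>B. \<forall>a J. finite J \<longrightarrow> (\<forall>j. cmod (a j) \<le> 1) \<longrightarrow> rnorm (\<Sum>j\<in>J. a j *\<^sub>C u j) \<le> B"
  proof (rule ccontr)
    assume "\<not> ?thesis"
    then have unb: "\<exists>a J. finite J \<and> (\<forall>j. cmod (a j) \<le> 1) \<and> rnorm (\<Sum>j\<in>J. a j *\<^sub>C u j) > B" for B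
      unfolding not_ex not_all not_imp not_le by blast
    have "\<exists>a J. finite J \<and> J \<subseteq> {L..} \<and> (\<forall>j. cmod (a j) \<le> 1) \<and> rnorm (\<Sum>j\<in>J. a j *\<^sub>C u j) > B" for L :: nat and B
    proof -
      obtain a J where J: "finite J" "\<And>j. cmod (a j) \<le> 1" "rnorm (\<Sum>j\<in>J. a j *\<^sub>C u j) > B + L"
        using unb[of "B + L"] by blast
      let ?v = "\<lambda>j. a j *\<^sub>C u j"
      have v: "?v j \<in> X" for j by (simp add: scale_mem uX)
      have "rnorm (?v j) \<le> 1" for j
        using mult_mono[OF J(2)[of j] u_le[of j] zero_le_one rnorm_nonneg] by (simp add: rnorm_scale uX)
      then have "(\<Sum>j\<in>J \<inter> {..<L}. rnorm (?v j)) \<le> card (J \<inter> {..<L})"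
        using sum_mono[of "J \<inter> {..<L}" "\<lambda>j. rnorm (?v j)" "\<lambda>_. 1"] by simp
      also have "\<dots> \<le> L" using card_mono[of "{..<L}" "J \<inter> {..<L}"] by simp
      finally have 1: "rnorm (sum ?v (J \<inter> {..<L})) \<le> L" using rnorm_sum[of "J \<inter> {..<L}" ?v, OF v] by linarith
      have "sum ?v J = sum ?v (J \<inter> {..<L}) + sum ?v (J - {..<L})"
        using sum.union_disjoint[of "J \<inter> {..<L}" "J - {..<L}" ?v] J(1) by (simp add: Int_Diff_Un Int_Diff_disjoint)
      then have "rnorm (sum ?v J) \<le> rnorm (sum ?v (J \<inter> {..<L})) + rnorm (sum ?v (J - {..<L}))"
        using rnorm_triangle[OF sum_mem sum_mem, of "J \<inter> {..<L}" ?v "J - {..<L}" ?v] v by simp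
      then have "rnorm (sum ?v (J - {..<L})) > B" using 1 J(3) by linarith
      then show ?thesis using J by (intro exI[of _ a] exI[of _ "J - {..<L}"]) auto
    qed
    then obtain A J where J: "\<And>L B. finite (J L B)" "\<And>L B. J L B \<subseteq> {L..}" and A: "\<And>L B j. cmod (A L B j) \<le> 1"
      and AJ: "\<And>L B. rnorm (\<Sum>j\<in>J L B. A L B j *\<^sub>C u j) > B"
      by metis
    define L where "L = rec_nat 0 (\<lambda>k l. Suc (Max (insert l (J l ((real k + 1)^2)))))"
    define Jk where "Jk k = J (L k) ((real k + 1)^2)" for k
    define Ak where "Ak k = A (L k) ((real k + 1)^2)" for k
    have L0: "L 0 = 0" and LS: "L (Suc k) = Suc (Max (insert (L k) (Jk k)))" for k
      by (simp_all add: L_def Jk_def)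
    have Jk: "finite (Jk k)" "Jk k \<subseteq> {L k..<L (Suc k)}" for k
      using J[of "L k" "(real k + 1)^2"] by (auto simp: LS Jk_def less_Suc_eq_le intro: Max_ge)
    have Lmono: "strict_mono L"
      by (rule strict_mono_Suc_iff[THEN iffD2]) (use Jk(1) in \<open>simp add: LS less_Suc_eq_le\<close>)
    obtain p where p: "\<And>n k. L k \<le> n \<Longrightarrow> n < L (Suc k) \<Longrightarrow> p n = k" and p_lim: "filterlim p at_top at_top"
      using block_index[OF Lmono L0] by metis
    define a where "a j = Ak (p j) j / (of_nat (p j) + 1)" for j
    have a_le: "cmod (a j) \<le> 1 / (real (p j) + 1)" for j
    proof -
      have "cmod (of_nat (p j) + 1 :: complex) = real (p j) + 1"
        by (metis norm_of_nat of_nat_Suc add.commute)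
      then show ?thesis using A by (simp add: a_def Ak_def norm_divide divide_right_mono)
    qed
    have a1: "cmod (a j) \<le> 1" for j using a_le[of j] by (rule order_trans) simp
    have "(\<lambda>j. 1 / (real (p j) + 1)) \<longlonglongrightarrow> 0"
      using filterlim_compose[OF LIMSEQ_inverse_real_of_nat p_lim] by (simp add: inverse_eq_divide add.commute)
    then have "(\<lambda>j. cmod (a j)) \<longlonglongrightarrow> 0"
      by (rule tendsto_sandwich[OF _ _ tendsto_const, rotated 2]) (use a_le in auto)
    then have a0: "a \<longlonglongrightarrow> 0" by (rule tendsto_norm_zero_cancel)
    obtain M' where M': "\<And>G. finite G \<Longrightarrow> G \<subseteq> {M'..} \<Longrightarrow> rnorm (\<Sum>n\<in>G. s a n *\<^sub>C x n) \<le> 1"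
      using unconditionally_convergent_Cauchy[OF _ uc[unfolded null_iff, OF s_null[OF a1 a0]], of 1] x scale_mem
      by (metis zero_less_one)
    \<comment> \<open>The block sum over \<open>J\<^sub>k\<close> exceeds \<open>k + 1\<close>, the tails of the earlier series contribute at most
    4, and the Cauchy bound is 1.\<close>
    define k where "k = M' + 5"
    have big: "rnorm (\<Sum>j\<in>Jk k. a j *\<^sub>C u j) > real k + 1"
    proof -
      have "(\<Sum>j\<in>Jk k. a j *\<^sub>C u j) = (1 / (of_nat k + 1)) *\<^sub>C (\<Sum>j\<in>Jk k. Ak k j *\<^sub>C u j)"
        unfolding cscale_sum
      proof (rule sum.cong[OF refl])
        fix j assume "j \<in> Jk k"
        then have "p j = k" using Jk(2)[of k] by (intro p) auto
        then show "a j *\<^sub>C u j = (1 / (of_nat k + 1)) *\<^sub>C Ak k j *\<^sub>C u j"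
          by (simp add: a_def cscale_simps)
      qed
      moreover have "cmod (1 / (of_nat k + 1)) = 1 / (real k + 1)"
        by (metis norm_of_nat of_nat_Suc add.commute norm_divide norm_one)
      ultimately have "rnorm (\<Sum>j\<in>Jk k. a j *\<^sub>C u j) = rnorm (\<Sum>j\<in>Jk k. Ak k j *\<^sub>C u j) / (real k + 1)"
        by (simp add: rnorm_scale sum_mem scale_mem uX)
      moreover have "rnorm (\<Sum>j\<in>Jk k. Ak k j *\<^sub>C u j) > (real k + 1)^2"
        using AJ[where L = "L k" and B = "(real k + 1)^2"] by (simp add: Jk_def Ak_def)
      ultimately show ?thesis by (simp only: less_divide_eq power2_eq_square) simp
    qed
    define G where "G = (\<Union>j\<in>Jk k. {M j..<h j})"
    have "G \<subseteq> {M'..}"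
    proof
      fix n assume "n \<in> G"
      then obtain j where j: "j \<in> Jk k" "M j \<le> n" by (auto simp: G_def)
      then have "k \<le> L k" "L k \<le> j" "j \<le> M j"
        using strict_mono_imp_increasing[OF Lmono] Jk(2)[of k] id_le by auto
      then show "n \<in> {M'..}" using j k_def by simp
    qed
    then have G1: "rnorm (\<Sum>n\<in>G. s a n *\<^sub>C x n) \<le> 1" using Jk(1) by (intro M') (simp_all add: G_def)
    \<comment> \<open>What the tails of the earlier null series contribute to the block of \<open>u j\<close>.\<close>
    define e where "e j = (\<Sum>i<j. a i *\<^sub>C psum x (c i) (h j)) - (\<Sum>i<j. a i *\<^sub>C psum x (c i) (M j))" for j
    have eX: "e j \<in> X" for j unfolding e_def by (intro diff_mem sum_mem scale_mem psum_mem x)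
    have e_le: "rnorm (e j) \<le> 2 * (1/2)^j" for j
    proof -
      have "rnorm (e j) \<le> rnorm (\<Sum>i<j. a i *\<^sub>C psum x (c i) (h j)) + rnorm (\<Sum>i<j. a i *\<^sub>C psum x (c i) (M j))"
        unfolding e_def by (intro rnorm_diff sum_mem scale_mem psum_mem x)
      also have "\<dots> \<le> (1/2)^j + (1/2)^j" by (intro add_mono earlier a1 h_ge order_refl)
      finally show ?thesis by simp
    qed
    have block: "(\<Sum>n\<in>{M j..<h j}. s a n *\<^sub>C x n) = a j *\<^sub>C u j + e j" for j
    proof -
      have 1: "(\<Sum>n\<in>{M j..<h j}. s a n *\<^sub>C x n) = psum x (s a) (h j) - psum x (s a) (M j)"
        by (rule psum_diff[OF h_ge])
      have 2: "psum x (s a) (h j) = (\<Sum>i<j. a i *\<^sub>C psum x (c i) (h j)) + a j *\<^sub>C u j"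
        using psum_s[of "h j" j a] h_lt[of j] by (simp add: u_def flip: lessThan_Suc_atMost)
      have 3: "psum x (s a) (M j) = (\<Sum>i<j. a i *\<^sub>C psum x (c i) (M j))"
        using psum_s[of "M j" j a] mono
        by (simp add: strict_mono_less_eq psum_c_0 cscale_simps flip: lessThan_Suc_atMost)
      show ?thesis unfolding 1 2 3 e_def by simp
    qed
    have "(\<Sum>n\<in>G. s a n *\<^sub>C x n) = (\<Sum>j\<in>Jk k. \<Sum>n\<in>{M j..<h j}. s a n *\<^sub>C x n)"
      unfolding G_def
    proof (rule sum.UNION_disjoint)
      show "\<forall>i\<in>Jk k. \<forall>j\<in>Jk k. i \<noteq> j \<longrightarrow> {M i..<h i} \<inter> {M j..<h j} = {}"
      proof (intro ballI impI)
        fix i j :: nat assume "i \<noteq> j"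
        have aux: "{M i..<h i} \<inter> {M j..<h j} = {}" if "i < j" for i j
        proof -
          have "M (Suc i) \<le> M j" using that mono by (simp add: strict_mono_less_eq)
          then show ?thesis using h_lt[of i] by auto
        qed
        show "{M i..<h i} \<inter> {M j..<h j} = {}"
          using aux[of i j] aux[of j i] \<open>i \<noteq> j\<close> by (cases "i < j") auto
      qed
    qed (use Jk in auto)
    also have "\<dots> = (\<Sum>j\<in>Jk k. a j *\<^sub>C u j) + (\<Sum>j\<in>Jk k. e j)" by (simp add: block sum.distrib)
    finally have "(\<Sum>j\<in>Jk k. a j *\<^sub>C u j) = (\<Sum>n\<in>G. s a n *\<^sub>C x n) - (\<Sum>j\<in>Jk k. e j)" by simp
    then have "rnorm (\<Sum>j\<in>Jk k. a j *\<^sub>C u j) \<le> rnorm (\<Sum>n\<in>G. s a n *\<^sub>C x n) + rnorm (\<Sum>j\<in>Jk k. e j)"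
      using rnorm_diff[OF sum_mem sum_mem, of G "\<lambda>n. s a n *\<^sub>C x n" "Jk k" e] eX scale_mem x by simp
    moreover have "rnorm (\<Sum>j\<in>Jk k. e j) \<le> 4"
    proof -
      have "rnorm (\<Sum>j\<in>Jk k. e j) \<le> (\<Sum>j\<in>Jk k. rnorm (e j))" by (intro rnorm_sum eX)
      also have "\<dots> \<le> (\<Sum>j\<in>Jk k. 2 * (1/2)^j)" by (intro sum_mono e_le)
      also have "\<dots> \<le> (\<Sum>j. 2 * (1/2)^j)"
        by (intro sum_le_suminf Jk(1) summable_mult summable_geometric) auto
      also have "\<dots> = 4" by (simp add: suminf_mult summable_geometric suminf_geometric)
      finally show ?thesis .
    qed
    ultimately show False using G1 big k_def by simp
  qed
  then obtain B where B: "\<forall>a J. finite J \<longrightarrow> (\<forall>j. cmod (a j) \<le> 1) \<longrightarrow> rnorm (\<Sum>j\<in>J. a j *\<^sub>C u j) \<le> B"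
    by blast
  have "(\<lambda>j. rnorm (u j)) \<longlonglongrightarrow> 0"
    using c0[unfolded contains_no_c0_def, rule_format, of u B] uX B by blast
  then have "0 \<ge> (1/2 :: real)"
    by (rule LIMSEQ_le_const) (use u_ge in blast)
  then show False by simp
qed

end

section \<open>Near-bases and alternative duals\<close>

context seminormed_function_space
begin

text \<open>
  Among the sets \<open>F \<subseteq> {..<K}\<close> whose complement carries no nonzero null series choose a smallest one.
  By minimality each \<open>m \<in> F\<close> admits a null series that is 1 at \<open>m\<close> and 0 elsewhere on \<open>F\<close>, and
  these null series remove the terms with index in \<open>F\<close> from any frame expansion.
\<close>

lemma unconditional_imp_near_basis:
  assumes frame: "schauder_frame X nrm x y" and nz: "\<And>n. rnorm (x n) \<noteq> 0" and c0: contains_no_c0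
    and uc: "\<And>c f. f \<in> X \<Longrightarrow> norm_sums nrm (\<lambda>n. c n *\<^sub>C x n) f \<Longrightarrow>
      unconditionally_convergent X nrm (\<lambda>n. c n *\<^sub>C x n)"
  shows "unconditional_basis_plus_finite X nrm x"
proof -
  have x: "x n \<in> X" for n using frame by (auto simp: schauder_frame_def)
  let ?null = "\<lambda>c. norm_sums nrm (\<lambda>n. c n *\<^sub>C x n) 0"
  define indep where "indep D \<longleftrightarrow> (\<forall>c. ?null c \<longrightarrow> (\<forall>n. n \<notin> D \<longrightarrow> c n = 0) \<longrightarrow> c = (\<lambda>_. 0))" for D :: "nat set"
  obtain K where K: "\<And>c. ?null c \<Longrightarrow> (\<And>n. n < K \<Longrightarrow> c n = 0) \<Longrightarrow> c = (\<lambda>_. 0)"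
    using tail_series_determined[OF x nz uc[OF zero_mem] c0] by metis
  have "\<exists>F. (F \<subseteq> {..<K} \<and> indep (- F)) \<and> (\<forall>F'. F' \<subseteq> {..<K} \<and> indep (- F') \<longrightarrow> card F \<le> card F')"
  proof (rule ex_has_least_nat)
    show "{..<K} \<subseteq> {..<K} \<and> indep (- {..<K})" using K by (auto simp: indep_def)
  qed
  then obtain F where F: "F \<subseteq> {..<K}" "indep (- F)"
      and least: "\<And>F'. F' \<subseteq> {..<K} \<Longrightarrow> indep (- F') \<Longrightarrow> card F \<le> card F'"
    by blast
  have fin: "finite F" using F(1) finite_subset by blast
  let ?e = "enumerate (- F)"
  note e = enumerate_compl_finite[OF fin]
  have e_notin: "?e k \<notin> F" for k using e(2) by blast

  have "\<exists>c. ?null c \<and> c m = 1 \<and> (\<forall>n\<in>F. n \<noteq> m \<longrightarrow> c n = 0)" if m: "m \<in> F" for m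
  proof -
    have "card (F - {m}) < card F" using m fin by (intro card_Diff1_less)
    then have "\<not> indep (- (F - {m}))" using least[of "F - {m}"] F(1) by fastforce
    then obtain c where c: "?null c" "\<And>n. n \<in> F - {m} \<Longrightarrow> c n = 0" "c \<noteq> (\<lambda>_. 0)"
      unfolding indep_def by blast
    have cm: "c m \<noteq> 0"
    proof
      assume "c m = 0"
      then have "\<forall>n. n \<notin> - F \<longrightarrow> c n = 0" using c(2) by auto
      then show False using F(2) c(1,3) unfolding indep_def by blast
    qed
    have "norm_sums nrm (\<lambda>n. (1 / c m) *\<^sub>C c n *\<^sub>C x n) ((1 / c m) *\<^sub>C 0)"
      by (intro norm_sums_scale scale_mem x zero_mem c)
    then have "?null (\<lambda>n. c n / c m)" by (simp add: cscale_simps)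
    then show ?thesis using cm c(2) by (intro exI[of _ "\<lambda>n. c n / c m"]) auto
  qed
  then obtain C where C: "\<And>m. m \<in> F \<Longrightarrow> ?null (C m)" "\<And>m. m \<in> F \<Longrightarrow> C m m = 1"
      "\<And>m n. m \<in> F \<Longrightarrow> n \<in> F \<Longrightarrow> n \<noteq> m \<Longrightarrow> C m n = 0"
    by metis

  have exists: "\<exists>d. norm_sums nrm (\<lambda>n. d n *\<^sub>C x n) f \<and> (\<forall>n\<in>F. d n = 0)" if f: "f \<in> X" for f
  proof -
    have "norm_sums nrm (\<lambda>n. (y n f + (\<Sum>m\<in>G. - y m f * C m n)) *\<^sub>C x n) f" if "finite G" "G \<subseteq> F" for G
      using that
    proof (induct G)
      case empty
      then show ?case using frame f by (simp add: schauder_frame_def reproducing_def del: cscale_apply)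
    next
      case (insert m G)
      have "norm_sums nrm (\<lambda>n. ((y n f + (\<Sum>m\<in>G. - y m f * C m n)) + (- y m f) * C m n) *\<^sub>C x n)
         (f + (- y m f) *\<^sub>C 0)"
        by (rule norm_sums_coeff_add) (use insert x f zero_mem C in \<open>auto simp del: cscale_apply\<close>)
      moreover have "(y n f + (\<Sum>m\<in>G. - y m f * C m n)) + (- y m f) * C m n
          = y n f + (\<Sum>m\<in>insert m G. - y m f * C m n)" for n
        using insert by (simp add: algebra_simps)
      ultimately show ?case by (simp only: cscale_simps add_0_right)
    qed
    from this[OF fin order_refl]
    have "norm_sums nrm (\<lambda>n. (y n f + (\<Sum>m\<in>F. - y m f * C m n)) *\<^sub>C x n) f" .
    moreover have "y n f + (\<Sum>m\<in>F. - y m f * C m n) = 0" if "n \<in> F" for n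
    proof -
      have "(\<Sum>m\<in>F. - y m f * C m n) = (\<Sum>m\<in>F. if m = n then - y m f else 0)"
        by (intro sum.cong refl) (use C that in auto)
      then show ?thesis using fin that by simp
    qed
    ultimately show ?thesis
      by (intro exI[of _ "\<lambda>n. y n f + (\<Sum>m\<in>F. - y m f * C m n)"]) blast
  qed

  \<comment> \<open>Coefficient sequences of the subsystem are those of the full system that vanish on \<open>F\<close>.\<close>
  define ext where "ext c n = (if n \<in> F then 0 else c (inv_into UNIV ?e n))" for c :: "nat \<Rightarrow> complex" and n
  have ext_e: "ext c (?e k) = c k" for c k
    using e_notin e(3) by (simp add: ext_def bij_betw_def)
  have ext_F: "ext c n = 0" if "n \<in> F" for c n using that by (simp add: ext_def)
  have sub: "(\<lambda>n. d n *\<^sub>C x n) \<circ> ?e = (\<lambda>k. d (?e k) *\<^sub>C (x \<circ> ?e) k)" for d by (simp add: fun_eq_iff)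
  have sums_sub: "norm_sums nrm (\<lambda>k. d (?e k) *\<^sub>C (x \<circ> ?e) k) f \<longleftrightarrow> norm_sums nrm (\<lambda>n. d n *\<^sub>C x n) f"
    if "\<And>n. n \<in> F \<Longrightarrow> d n = 0" for d f
    using norm_sums_omit_zeros[OF fin, of "\<lambda>n. d n *\<^sub>C x n" nrm f] that
    unfolding sub by (simp add: cscale_simps)
  have sums_ext: "norm_sums nrm (\<lambda>k. c k *\<^sub>C (x \<circ> ?e) k) f \<longleftrightarrow> norm_sums nrm (\<lambda>n. ext c n *\<^sub>C x n) f" for c f
    using sums_sub[of "ext c" f] ext_F by (simp add: ext_e)

  have "unconditional_basis X nrm (x \<circ> ?e)"
    unfolding unconditional_basis_def schauder_basis_def
  proof (intro conjI allI ballI impI)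
    show "(x \<circ> ?e) k \<in> X" for k using x by simp
  next
    fix f assume f: "f \<in> X"
    obtain d where d: "norm_sums nrm (\<lambda>n. d n *\<^sub>C x n) f" "\<And>n. n \<in> F \<Longrightarrow> d n = 0"
      using exists[OF f] by blast
    show "\<exists>!c. norm_sums nrm (\<lambda>k. c k *\<^sub>C (x \<circ> ?e) k) f"
    proof (rule ex1I)
      show "norm_sums nrm (\<lambda>k. d (?e k) *\<^sub>C (x \<circ> ?e) k) f" by (rule sums_sub[THEN iffD2, OF d(2,1)])
      fix c assume "norm_sums nrm (\<lambda>k. c k *\<^sub>C (x \<circ> ?e) k) f"
      then have "norm_sums nrm (\<lambda>n. ext c n *\<^sub>C x n) f" by (simp only: sums_ext)
      from norm_sums_coeff_add[OF x f f this d(1), of "-1"]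
      have "?null (\<lambda>n. ext c n + (- 1) * d n)" by (simp add: cscale_simps)
      moreover have "\<forall>n. n \<notin> - F \<longrightarrow> ext c n + (- 1) * d n = 0" using ext_F d(2) by simp
      ultimately have "(\<lambda>n. ext c n + (- 1) * d n) = (\<lambda>_. 0)"
        using F(2)[unfolded indep_def, rule_format, of "\<lambda>n. ext c n + (- 1) * d n"] by blast
      then have "ext c (?e k) = d (?e k)" for k by (simp add: fun_eq_iff)
      then show "c = (\<lambda>k. d (?e k))" by (simp add: ext_e fun_eq_iff)
    qed
  next
    fix f c assume f: "f \<in> X" "norm_sums nrm (\<lambda>k. c k *\<^sub>C (x \<circ> ?e) k) f"
    then have "unconditionally_convergent X nrm (\<lambda>n. ext c n *\<^sub>C x n)"
      using uc by (simp only: sums_ext)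
    then have "unconditionally_convergent X nrm ((\<lambda>n. ext c n *\<^sub>C x n) \<circ> ?e)"
      by (rule unconditionally_convergent_omit_zeros[OF fin, THEN iffD2, rotated])
        (simp add: ext_F cscale_simps)
    then show "unconditionally_convergent X nrm (\<lambda>k. c k *\<^sub>C (x \<circ> ?e) k)"
      unfolding sub by (simp add: ext_e)
  qed
  then show ?thesis using fin unfolding unconditional_basis_plus_finite_def by blast
qed

lemma near_basis_iff_alternative_duals_unconditional:
  assumes frame: "schauder_frame X nrm x y" and nz: "\<And>n. rnorm (x n) \<noteq> 0" and c0: contains_no_c0
  shows "unconditional_basis_plus_finite X nrm x \<longleftrightarrow>
    (\<forall>\<phi>. alternative_dual X nrm x \<phi> \<longrightarrow>
      (\<forall>f\<in>X. unconditionally_convergent X nrm (\<lambda>n. \<phi> n f *\<^sub>C x n)))"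
proof
  have x: "x n \<in> X" for n using frame by (auto simp: schauder_frame_def)
  show "\<forall>\<phi>. alternative_dual X nrm x \<phi> \<longrightarrow>
      (\<forall>f\<in>X. unconditionally_convergent X nrm (\<lambda>n. \<phi> n f *\<^sub>C x n))"
    if "unconditional_basis_plus_finite X nrm x"
    using near_basis_unconditional[OF x that]
    by (auto simp: alternative_dual_def reproducing_def)
  show "unconditional_basis_plus_finite X nrm x"
    if "\<forall>\<phi>. alternative_dual X nrm x \<phi> \<longrightarrow>
      (\<forall>f\<in>X. unconditionally_convergent X nrm (\<lambda>n. \<phi> n f *\<^sub>C x n))"
    using unconditional_imp_near_basis[OF frame nz c0] convergent_imp_unconditional[OF frame x nz] that
    by blast
qed

end

section \<open>Lebesgue norms of extended nonnegative functions\<close>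

lemma epowr_top [simp]: "epowr top r = top"
  by (simp add: epowr_def)

lemma epowr_ennreal: "0 \<le> x \<Longrightarrow> epowr (ennreal x) r = ennreal (x powr r)"
  by (simp add: epowr_def)

lemma epowr_0 [simp]: "epowr 0 r = 0"
  by (simp add: epowr_def)

lemma epowr_mono: "a \<le> b \<Longrightarrow> 0 \<le> r \<Longrightarrow> epowr a r \<le> epowr b r"
  by (cases a; cases b) (auto simp: epowr_ennreal top_unique intro!: ennreal_leI powr_mono2)

lemma epowr_mult: "0 < r \<Longrightarrow> epowr (a * b) r = epowr a r * epowr b r"
proof (cases a; cases b)
  fix x y assume "0 \<le> x" "a = ennreal x" "0 \<le> y" "b = ennreal y"
  then show ?thesis by (simp add: epowr_ennreal powr_mult flip: ennreal_mult)
next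
  fix x assume r: "0 < r" "0 \<le> x" "a = ennreal x" "b = top"
  show ?thesis
    by (cases "x = 0") (use r in \<open>simp_all add: epowr_ennreal ennreal_mult_top\<close>)
next
  fix y assume r: "0 < r" "a = top" "0 \<le> y" "b = ennreal y"
  show ?thesis
    by (cases "y = 0") (use r in \<open>simp_all add: epowr_ennreal ennreal_top_mult\<close>)
qed simp

lemma epowr_inverse: "0 < r \<Longrightarrow> epowr (epowr a r) (1 / r) = a"
  by (cases a) (simp_all add: epowr_ennreal powr_powr)

lemma epowr_inverse': "0 < r \<Longrightarrow> epowr (epowr a (1 / r)) r = a"
  by (cases a) (simp_all add: epowr_ennreal powr_powr)

text \<open>
  The power is an order isomorphism of the extended nonnegative reals; it therefore commutes with
  suprema and preserves convergence to 0.
\<close>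

lemma epowr_le_iff: "0 < r \<Longrightarrow> epowr a r \<le> b \<longleftrightarrow> a \<le> epowr b (1 / r)"
  by (metis epowr_inverse epowr_inverse' epowr_mono less_imp_le zero_less_divide_1_iff)

lemma epowr_less_top_iff: "epowr a r < top \<longleftrightarrow> a < top"
  by (simp add: epowr_def less_top)

lemma epowr_eq_0_iff: "0 < r \<Longrightarrow> epowr a r = 0 \<longleftrightarrow> a = 0"
  by (metis epowr_0 epowr_inverse)

lemma epowr_SUP: "0 < r \<Longrightarrow> epowr (SUP i\<in>I. f i) r = (SUP i\<in>I. epowr (f i) r)"
proof (rule antisym)
  assume r: "0 < r"
  show "epowr (SUP i\<in>I. f i) r \<le> (SUP i\<in>I. epowr (f i) r)"
    unfolding epowr_le_iff[OF r] by (rule SUP_least) (auto simp: epowr_le_iff[OF r, symmetric] intro: SUP_upper)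
  show "(SUP i\<in>I. epowr (f i) r) \<le> epowr (SUP i\<in>I. f i) r"
    by (rule SUP_least) (use r in \<open>auto intro: epowr_mono SUP_upper\<close>)
qed

lemma epowr_tendsto_0:
  assumes "0 < r" "(f \<longlongrightarrow> 0) F" shows "((\<lambda>x. epowr (f x) r) \<longlongrightarrow> 0) F"
proof (rule order_tendstoI)
  fix a :: ennreal assume a: "0 < a"
  have "0 < epowr a (1 / r)" using a epowr_eq_0_iff[of "1/r" a] assms(1) by (simp add: zero_less_iff_neq_zero)
  with assms(2) have "\<forall>\<^sub>F x in F. f x < epowr a (1 / r)" by (rule order_tendstoD(2))
  then show "\<forall>\<^sub>F x in F. epowr (f x) r < a"
  proof eventually_elim
    case (elim x)
    then have "\<not> a \<le> epowr (f x) r"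
      using epowr_mono[of a "epowr (f x) r" "1/r"] assms(1) epowr_inverse[OF assms(1)] by auto
    then show ?case by simp
  qed
qed simp

lemma measurable_epowr [measurable (raw)]:
  assumes [measurable]: "f \<in> borel_measurable M"
  shows "(\<lambda>x. epowr (f x) r) \<in> borel_measurable M"
proof -
  have [measurable]: "{x \<in> space M. f x = top} \<in> sets M"
    using measurable_sets[OF assms, of "{top}"] by (simp add: vimage_def Int_def conj_commute)
  have [measurable]: "(\<lambda>x. r) \<in> borel_measurable M" by simp
  show ?thesis unfolding epowr_def by measurable
qed

locale finite_exponent =
  fixes p :: ennreal
  assumes p_ge: "1 \<le> p" and p_fin: "p < top"
begin

abbreviation "P \<equiv> enn2real p"

lemma P_ge: "1 \<le> P"
  using p_ge p_fin enn2real_mono[of 1 p] by simp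

lemma P_pos: "0 < P" "0 < 1 / P"
  using P_ge by auto

lemma Lp_norm_eq: "Lp_norm p h = epowr (\<integral>\<^sup>+x. epowr (h x) P \<partial>lborel) (1 / P)"
  using p_fin by (auto simp: Lp_norm_def)

lemma Lp_norm_epowr: "epowr (Lp_norm p h) P = (\<integral>\<^sup>+x. epowr (h x) P \<partial>lborel)"
  by (simp add: Lp_norm_eq epowr_inverse' P_pos)

lemma Lp_norm_mono: "(\<And>x. h x \<le> k x) \<Longrightarrow> Lp_norm p h \<le> Lp_norm p k"
  unfolding Lp_norm_eq using P_pos by (intro epowr_mono nn_integral_mono) auto

lemma Lp_norm_zero [simp]: "Lp_norm p (\<lambda>x. 0) = 0"
  by (simp add: Lp_norm_eq)

lemma Lp_norm_cong_AE: "AE x in lborel. h x = k x \<Longrightarrow> Lp_norm p h = Lp_norm p k"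
  unfolding Lp_norm_eq by (intro arg_cong[of _ _ "\<lambda>z. epowr z (1 / P)"] nn_integral_cong_AE) auto

lemma Lp_norm_cmult:
  assumes [measurable]: "h \<in> borel_measurable lborel"
  shows "Lp_norm p (\<lambda>x. c * h x) = c * Lp_norm p h"
  unfolding Lp_norm_eq using P_pos
  by (simp add: epowr_mult nn_integral_cmult epowr_inverse)

lemma Lp_norm_eq_0D:
  assumes [measurable]: "h \<in> borel_measurable lborel" and "Lp_norm p h = 0"
  shows "AE x in lborel. h x = 0"
proof -
  have "(\<integral>\<^sup>+x. epowr (h x) P \<partial>lborel) = 0"
    using Lp_norm_epowr[of h] assms(2) by simp
  then have "AE x in lborel. epowr (h x) P = 0" by (subst (asm) nn_integral_0_iff_AE) auto
  then show ?thesis using P_pos by (simp add: epowr_eq_0_iff)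
qed

lemma Lp_norm_finite_AE:
  assumes [measurable]: "h \<in> borel_measurable lborel" and "Lp_norm p h < top"
  shows "AE x in lborel. h x < top"
proof -
  have "(\<integral>\<^sup>+x. epowr (h x) P \<partial>lborel) < top"
    using Lp_norm_epowr[of h] assms(2) epowr_less_top_iff by metis
  then have "AE x in lborel. epowr (h x) P \<noteq> \<infinity>"
    by (intro nn_integral_PInf_AE) (auto simp: less_top)
  then show ?thesis by eventually_elim (metis epowr_top infinity_ennreal_def less_top)
qed

lemma powr_convex_nonneg:
  assumes "0 \<le> u" "0 \<le> v" "0 \<le> t" "t \<le> 1"
  shows "(t * u + (1 - t) * v) powr P \<le> t * u powr P + (1 - t) * v powr P"
proof -
  have *: "(s * w) powr P \<le> s * w powr P" if "0 \<le> s" "s \<le> 1" "0 \<le> w" for s w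
  proof -
    have "s powr P \<le> s powr 1" if "s > 0"
      using powr_mono'[of 1 P s] P_ge \<open>s \<le> 1\<close> that by simp
    then have "s powr P \<le> s" using that by (cases "s = 0") auto
    then show ?thesis using that by (simp add: powr_mult mult_right_mono)
  qed
  consider "u = 0" | "v = 0" | "u > 0" "v > 0" using assms by linarith
  then show ?thesis
  proof cases
    case 1 then show ?thesis using *[of "1 - t" v] assms by simp
  next
    case 2 then show ?thesis using *[of t u] assms by simp
  next
    case 3 then show ?thesis
      using convex_onD[OF powr_convex[OF P_ge], of "1 - t" u v] assms by simp
  qed
qed

text \<open>
  Minkowski's inequality is this convexity estimate, integrated with \<open>u = h x\<close>, \<open>v = k x\<close> and with
  \<open>a\<close>, \<open>b\<close> the norms of \<open>h\<close>, \<open>k\<close>: then the right-hand side integrates to \<open>(a + b)\<^sup>P\<close>.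
\<close>

lemma powr_add_weighted:
  assumes "0 < a" "0 < b" "0 \<le> u" "0 \<le> v"
  shows "(u + v) powr P \<le> ((a + b) powr P * (a / (a + b)) / a powr P) * u powr P
     + ((a + b) powr P * (b / (a + b)) / b powr P) * v powr P"
proof -
  let ?t = "a / (a + b)"
  have t: "1 - ?t = b / (a + b)" "0 \<le> ?t" "?t \<le> 1" using assms by (auto simp: field_simps)
  have "u + v = (a + b) * (?t * (u / a) + (1 - ?t) * (v / b))"
    using assms unfolding t by (simp add: add_divide_distrib[symmetric] add_pos_pos)
  then have "(u + v) powr P = (a + b) powr P * (?t * (u / a) + (1 - ?t) * (v / b)) powr P"
    by (metis powr_mult)
  also have "\<dots> \<le> (a + b) powr P * (?t * (u / a) powr P + (1 - ?t) * (v / b) powr P)"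
    by (intro mult_left_mono powr_convex_nonneg) (use assms t in auto)
  also have "\<dots> = ((a + b) powr P * (a / (a + b)) / a powr P) * u powr P
     + ((a + b) powr P * (b / (a + b)) / b powr P) * v powr P"
    unfolding t using assms by (simp add: powr_divide field_simps)
  finally show ?thesis .
qed

lemma Lp_norm_triangle:
  assumes [measurable]: "h \<in> borel_measurable lborel" "k \<in> borel_measurable lborel"
  shows "Lp_norm p (\<lambda>x. h x + k x) \<le> Lp_norm p h + Lp_norm p k"
proof -
  let ?A = "Lp_norm p h" and ?B = "Lp_norm p k"
  consider "?A = top \<or> ?B = top" | "?A = 0" | "?B = 0" | "?A \<noteq> top" "?B \<noteq> top" "?A \<noteq> 0" "?B \<noteq> 0"
    by blast
  then show ?thesis
  proof cases
    case 2
    from Lp_norm_eq_0D[OF assms(1) this]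
    have "Lp_norm p (\<lambda>x. h x + k x) = ?B" by (intro Lp_norm_cong_AE) (auto elim: eventually_mono)
    then show ?thesis by simp
  next
    case 3
    from Lp_norm_eq_0D[OF assms(2) this]
    have "Lp_norm p (\<lambda>x. h x + k x) = ?A" by (intro Lp_norm_cong_AE) (auto elim: eventually_mono)
    then show ?thesis by simp
  next
    case 4
    define a b where "a = enn2real ?A" and "b = enn2real ?B"
    have A: "?A = ennreal a" "?B = ennreal b" using 4 by (simp_all add: a_def b_def less_top)
    have ab: "0 < a" "0 < b"
      using 4 A by (metis ennreal_eq_0_iff not_less)+
    define c where "c = (a + b) powr P * (a / (a + b)) / a powr P"
    define d where "d = (a + b) powr P * (b / (a + b)) / b powr P"
    have cd: "0 < c" "0 < d" using ab by (simp_all add: c_def d_def)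
    have "epowr (h x + k x) P \<le> ennreal c * epowr (h x) P + ennreal d * epowr (k x) P" for x
    proof (cases "h x"; cases "k x")
      fix u v assume "0 \<le> u" "h x = ennreal u" "0 \<le> v" "k x = ennreal v"
      then show ?thesis
        using powr_add_weighted[OF ab, of u v] cd unfolding c_def[symmetric] d_def[symmetric]
        by (simp add: epowr_ennreal flip: ennreal_plus ennreal_mult)
    qed (use cd in \<open>simp_all add: ennreal_mult_top\<close>)
    then have "(\<integral>\<^sup>+x. epowr (h x + k x) P \<partial>lborel)
        \<le> (\<integral>\<^sup>+x. ennreal c * epowr (h x) P + ennreal d * epowr (k x) P \<partial>lborel)"
      by (rule nn_integral_mono)
    also have "\<dots> = ennreal c * epowr ?A P + ennreal d * epowr ?B P"
      by (simp add: nn_integral_add nn_integral_cmult Lp_norm_epowr)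
    also have "\<dots> = ennreal (c * a powr P + d * b powr P)"
      unfolding A using ab cd by (simp add: epowr_ennreal ennreal_plus ennreal_mult)
    also have "c * a powr P + d * b powr P = (a + b) powr P"
      using ab by (simp add: c_def d_def distrib_left[symmetric] add_divide_distrib[symmetric] add_pos_pos)
    also have "ennreal ((a + b) powr P) = epowr (?A + ?B) P"
      unfolding A using ab by (simp add: epowr_ennreal flip: ennreal_plus)
    finally have "Lp_norm p (\<lambda>x. h x + k x) \<le> epowr (epowr (?A + ?B) P) (1 / P)"
      unfolding Lp_norm_eq[of "\<lambda>x. h x + k x"] using P_pos by (intro epowr_mono) auto
    then show ?thesis using P_pos by (simp add: epowr_inverse)
  qed auto
qed

lemma Lp_norm_SUP:
  assumes [measurable]: "\<And>n. h n \<in> borel_measurable lborel" and inc: "\<And>x. incseq (\<lambda>n::nat. h n x)"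
  shows "Lp_norm p (\<lambda>x. SUP n. h n x) = (SUP n. Lp_norm p (h n))"
proof -
  have "(\<integral>\<^sup>+x. (SUP n. epowr (h n x) P) \<partial>lborel) = (SUP n. \<integral>\<^sup>+x. epowr (h n x) P \<partial>lborel)"
    by (rule nn_integral_monotone_convergence_SUP)
      (use inc P_pos in \<open>auto simp: incseq_def le_fun_def intro!: epowr_mono\<close>)
  then show ?thesis unfolding Lp_norm_eq using P_pos by (simp add: epowr_SUP)
qed

text \<open>
  The limit is required only where the dominating function is finite.  In this form the statement
  can be applied to itself in the two variables of a mixed norm.
\<close>

lemma Lp_norm_dominated:
  assumes [measurable]: "\<And>n. h n \<in> borel_measurable lborel" "H \<in> borel_measurable lborel"
    and le: "\<And>n x. h n x \<le> H x" and fin: "Lp_norm p H < top"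
    and lim: "\<And>x. H x < top \<Longrightarrow> (\<lambda>n. h n x) \<longlonglongrightarrow> 0"
  shows "(\<lambda>n. Lp_norm p (h n)) \<longlonglongrightarrow> 0"
proof -
  have "(\<lambda>n. \<integral>\<^sup>+x. epowr (h n x) P \<partial>lborel) \<longlonglongrightarrow> (\<integral>\<^sup>+x. 0 \<partial>(lborel :: real measure))"
  proof (rule nn_integral_dominated_convergence[where w = "\<lambda>x. epowr (H x) P" and u' = "\<lambda>x. 0"
      and u = "\<lambda>n x. epowr (h n x) P" and M = lborel])
    show "AE x in lborel. epowr (h n x) P \<le> epowr (H x) P" for n
      using le P_pos by (auto intro!: epowr_mono)
    show "(\<integral>\<^sup>+x. epowr (H x) P \<partial>lborel) < \<infinity>"
      using fin Lp_norm_epowr[of H] epowr_less_top_iff by (metis infinity_ennreal_def)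
    show "AE x in lborel. (\<lambda>n. epowr (h n x) P) \<longlonglongrightarrow> 0"
      using Lp_norm_finite_AE[OF assms(2) fin] by eventually_elim (intro epowr_tendsto_0 lim P_pos)
  qed measurable
  then show ?thesis unfolding Lp_norm_eq using P_pos by (intro epowr_tendsto_0) auto
qed

lemma Lp_norm_translate:
  assumes [measurable]: "h \<in> borel_measurable lborel"
  shows "Lp_norm p (\<lambda>x. h (x - a)) = Lp_norm p h"
proof -
  have "(\<integral>\<^sup>+x. epowr (h x) P \<partial>lborel) = (\<integral>\<^sup>+x. epowr (h x) P \<partial>distr lborel borel ((+) (- a)))"
    by (simp add: lborel_distr_plus)
  also have "\<dots> = (\<integral>\<^sup>+x. epowr (h (x - a)) P \<partial>lborel)"
    by (subst nn_integral_distr) auto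
  finally show ?thesis by (simp add: Lp_norm_eq)
qed

lemma measurable_Lp_norm [measurable]:
  assumes [measurable]: "(\<lambda>(w, x). F x w) \<in> borel_measurable (M \<Otimes>\<^sub>M lborel)"
  shows "(\<lambda>w. Lp_norm p (\<lambda>x. F x w)) \<in> borel_measurable M"
  unfolding Lp_norm_eq by measurable

end

section \<open>Schwartz functions and their time-frequency shifts\<close>

text \<open>
  Iterated derivatives are computed by exhibiting the whole sequence of derivatives.
\<close>

lemma nth_derivative_eq:
  assumes "\<And>n t. (F n has_vector_derivative F (Suc n) t) (at t)"
  shows "nth_derivative n (F 0) = F n"
proof (induct n)
  case (Suc n)
  have "nth_derivative (Suc n) (F 0) = (\<lambda>t. vector_derivative (nth_derivative n (F 0)) (at t))"
    by (simp add: nth_derivative_def)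
  then show ?case using Suc vector_derivative_at[OF assms] by simp
qed (simp add: nth_derivative_def)

lemma nth_derivative_0 [simp]: "nth_derivative 0 \<phi> = \<phi>"
  by (simp add: nth_derivative_def)

lemma nth_derivative_Suc: "nth_derivative (Suc n) \<phi> = nth_derivative n (nth_derivative (Suc 0) \<phi>)"
  unfolding nth_derivative_def by (subst funpow_Suc_right) simp

lemma schwartz_has_derivative:
  assumes "\<phi> \<in> schwartz_space"
  shows "(nth_derivative n \<phi> has_vector_derivative nth_derivative (Suc n) \<phi> t) (at t)"
  using assms by (simp add: schwartz_space_def nth_derivative_def vector_derivative_works)

lemma schwartz_bound:
  assumes "\<phi> \<in> schwartz_space"
  obtains B where "\<And>t. \<bar>t\<bar> ^ m * cmod (nth_derivative n \<phi> t) \<le> B"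
  using assms unfolding schwartz_space_def bdd_above_def by blast

lemma schwartz_spaceI:
  assumes F: "\<And>n t. (F n has_vector_derivative F (Suc n) t) (at t)"
    and "\<And>m n. \<exists>B. \<forall>t. \<bar>t\<bar> ^ m * cmod (F n t) \<le> B"
  shows "F 0 \<in> schwartz_space"
proof -
  have eq: "nth_derivative n (F 0) = F n" for n by (rule nth_derivative_eq) (rule F)
  show ?thesis
    unfolding schwartz_space_def mem_Collect_eq eq
    using assms by (auto simp: bdd_above_def intro: differentiableI_vector)
qed

lemma schwartz_derivative: "\<phi> \<in> schwartz_space \<Longrightarrow> nth_derivative (Suc 0) \<phi> \<in> schwartz_space"
  unfolding schwartz_space_def by (simp flip: nth_derivative_Suc)

lemma schwartz_lincomb:
  assumes "\<phi> \<in> schwartz_space" "\<theta> \<in> schwartz_space"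
  shows "(\<lambda>t. \<phi> t + c * \<theta> t) \<in> schwartz_space"
    and "nth_derivative n (\<lambda>t. \<phi> t + c * \<theta> t) = (\<lambda>t. nth_derivative n \<phi> t + c * nth_derivative n \<theta> t)"
proof -
  define F where "F n t = nth_derivative n \<phi> t + c * nth_derivative n \<theta> t" for n t
  have F: "(F n has_vector_derivative F (Suc n) t) (at t)" for n t
    unfolding F_def[abs_def]
    by (intro has_vector_derivative_add has_vector_derivative_mult_right schwartz_has_derivative assms)
  have F0: "F 0 = (\<lambda>t. \<phi> t + c * \<theta> t)" by (simp add: F_def[abs_def])
  have "\<exists>B. \<forall>t. \<bar>t\<bar> ^ m * cmod (F n t) \<le> B" for m n
  proof -
    obtain B1 where B1: "\<And>t. \<bar>t\<bar> ^ m * cmod (nth_derivative n \<phi> t) \<le> B1"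
      using schwartz_bound[OF assms(1)] by blast
    obtain B2 where B2: "\<And>t. \<bar>t\<bar> ^ m * cmod (nth_derivative n \<theta> t) \<le> B2"
      using schwartz_bound[OF assms(2)] by blast
    have "\<bar>t\<bar> ^ m * cmod (F n t) \<le> B1 + cmod c * B2" for t
    proof -
      have "\<bar>t\<bar> ^ m * cmod (F n t) \<le> \<bar>t\<bar> ^ m * (cmod (nth_derivative n \<phi> t) + cmod c * cmod (nth_derivative n \<theta> t))"
        unfolding F_def by (intro mult_left_mono) (auto simp: norm_mult intro: order_trans[OF norm_triangle_ineq])
      also have "\<dots> = \<bar>t\<bar> ^ m * cmod (nth_derivative n \<phi> t) + cmod c * (\<bar>t\<bar> ^ m * cmod (nth_derivative n \<theta> t))"
        by (simp add: algebra_simps)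
      also have "\<dots> \<le> B1 + cmod c * B2" by (intro add_mono B1 mult_left_mono B2) simp
      finally show ?thesis .
    qed
    then show ?thesis by blast
  qed
  from schwartz_spaceI[of F, OF F this] show "(\<lambda>t. \<phi> t + c * \<theta> t) \<in> schwartz_space"
    unfolding F0 .
  show "nth_derivative n (\<lambda>t. \<phi> t + c * \<theta> t) = (\<lambda>t. nth_derivative n \<phi> t + c * nth_derivative n \<theta> t)"
    using nth_derivative_eq[of F n, OF F] unfolding F0 by (simp add: F_def[abs_def])
qed

text \<open>With \<open>c = 2 \<pi> \<i> w\<close> this is the operator \<open>(d/dt + c)\<^sup>n\<close> applied to \<open>\<phi>\<close>, which is what the
  \<open>n\<close>-th derivative becomes after conjugation with the modulation \<open>M\<^sub>w\<close>.\<close>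

primrec shifted_derivative :: "complex \<Rightarrow> nat \<Rightarrow> (real \<Rightarrow> complex) \<Rightarrow> real \<Rightarrow> complex"
  where "shifted_derivative c 0 \<phi> = \<phi>"
  | "shifted_derivative c (Suc n) \<phi> =
      (\<lambda>t. shifted_derivative c n (nth_derivative (Suc 0) \<phi>) t + c * shifted_derivative c n \<phi> t)"

definition char_exponent :: "real \<Rightarrow> complex"
  where "char_exponent w = 2 * of_real pi * \<i> * of_real w"

lemma modulate_eq: "modulate w \<phi> t = exp (char_exponent w * of_real t) * \<phi> t"
  by (simp add: modulate_def char_exponent_def)

lemma Re_char_exponent [simp]: "Re (char_exponent w) = 0"
  by (simp add: char_exponent_def)

lemma norm_char_exponent: "cmod (char_exponent w) = 2 * pi * \<bar>w\<bar>"
  by (simp add: char_exponent_def norm_mult)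

lemma char_exponent_diff: "char_exponent w - char_exponent w' = char_exponent (w - w')"
  by (simp add: char_exponent_def algebra_simps)

lemma has_derivative_shifted_derivative:
  assumes "\<phi> \<in> schwartz_space"
  shows "(shifted_derivative c n \<phi> has_vector_derivative shifted_derivative c n (nth_derivative (Suc 0) \<phi>) t) (at t)"
  using assms
proof (induct n arbitrary: \<phi>)
  case 0
  then show ?case using schwartz_has_derivative[of \<phi> 0] by simp
next
  case (Suc n)
  show ?case
    using Suc.hyps[OF Suc.prems] Suc.hyps[OF schwartz_derivative[OF Suc.prems]]
    by (auto intro!: has_vector_derivative_add has_vector_derivative_mult_right)
qed

text \<open>
  This is the \<open>n\<close>-th derivative of \<open>M\<^sub>w T\<^sub>x \<phi>\<close>.
\<close>

definition tf_derivative :: "nat \<Rightarrow> (real \<Rightarrow> complex) \<Rightarrow> real \<Rightarrow> real \<Rightarrow> real \<Rightarrow> complex"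
  where "tf_derivative n \<phi> x w t =
    exp (char_exponent w * of_real t) * shifted_derivative (char_exponent w) n \<phi> (t - x)"

lemma tf_derivative_0: "tf_derivative 0 \<phi> x w = modulate w (translate x \<phi>)"
  by (simp add: fun_eq_iff tf_derivative_def modulate_eq translate_def)

lemma tf_derivative_Suc: "tf_derivative (Suc n) \<phi> x w t =
    tf_derivative n (nth_derivative (Suc 0) \<phi>) x w t + char_exponent w * tf_derivative n \<phi> x w t"
  by (simp add: tf_derivative_def algebra_simps)

lemma has_derivative_tf_derivative:
  assumes "\<phi> \<in> schwartz_space"
  shows "(tf_derivative n \<phi> x w has_vector_derivative tf_derivative (Suc n) \<phi> x w t) (at t)"
proof -
  let ?e = "\<lambda>t::real. exp (char_exponent w * of_real t)"
  let ?s = "shifted_derivative (char_exponent w) n"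
  have e: "(?e has_vector_derivative char_exponent w * ?e t) (at t)"
    by (rule has_vector_derivative_real_field) (auto intro!: derivative_eq_intros)
  have s: "((\<lambda>t. ?s \<phi> (t - x)) has_vector_derivative ?s (nth_derivative (Suc 0) \<phi>) (t - x)) (at t)"
    using vector_diff_chain_at[of "\<lambda>t. t - x" 1 t "?s \<phi>" "?s (nth_derivative (Suc 0) \<phi>) (t - x)"]
      has_derivative_shifted_derivative[OF assms, of "char_exponent w" n "t - x"]
    by (auto simp: o_def has_vector_derivative_diff_const has_vector_derivative_id)
  show ?thesis
    using has_vector_derivative_mult[OF e s]
    unfolding tf_derivative_def[abs_def] by (simp add: algebra_simps)
qed

text \<open>
  The factor \<open>2\<^sup>m\<close> comes from \<open>\<bar>t\<bar> \<le> 2 max (\<bar>t - x\<bar>, R)\<close>.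
\<close>

lemma weight_shift_bound:
  fixes t x R :: real
  assumes "\<bar>x\<bar> \<le> R" shows "\<bar>t\<bar> ^ m \<le> 2 ^ m * (\<bar>t - x\<bar> ^ m + R ^ m)"
proof -
  have "\<bar>t\<bar> \<le> 2 * max \<bar>t - x\<bar> R" using assms by (simp add: max_def abs_if split: if_splits)
  then have "\<bar>t\<bar> ^ m \<le> 2 ^ m * max \<bar>t - x\<bar> R ^ m"
    using power_mono[of "\<bar>t\<bar>" "2 * max \<bar>t - x\<bar> R" m] by (simp add: power_mult_distrib)
  moreover have "max \<bar>t - x\<bar> R ^ m \<le> \<bar>t - x\<bar> ^ m + R ^ m"
    using assms by (simp add: max_def)
  ultimately show ?thesis by (meson mult_left_mono order_trans zero_le_numeral zero_le_power)
qed

lemma shifted_schwartz_bound: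
  assumes "\<phi> \<in> schwartz_space"
  obtains B where "0 \<le> B" "\<And>x t. \<bar>x\<bar> \<le> R \<Longrightarrow> \<bar>t\<bar> ^ m * cmod (nth_derivative n \<phi> (t - x)) \<le> B"
proof -
  obtain B1 where B1: "\<And>t. \<bar>t\<bar> ^ m * cmod (nth_derivative n \<phi> t) \<le> B1"
    using schwartz_bound[OF assms] by blast
  obtain B2 where B2: "\<And>t. \<bar>t\<bar> ^ 0 * cmod (nth_derivative n \<phi> t) \<le> B2"
    using schwartz_bound[OF assms] by blast
  have "\<bar>t\<bar> ^ m * cmod (nth_derivative n \<phi> (t - x)) \<le> 2 ^ m * (B1 + \<bar>R\<bar> ^ m * B2)" if "\<bar>x\<bar> \<le> R" for x t
  proof -
    have "\<bar>t\<bar> ^ m * cmod (nth_derivative n \<phi> (t - x))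
        \<le> 2 ^ m * (\<bar>t - x\<bar> ^ m + \<bar>R\<bar> ^ m) * cmod (nth_derivative n \<phi> (t - x))"
      using that by (intro mult_right_mono weight_shift_bound) auto
    also have "\<dots> = 2 ^ m * (\<bar>t - x\<bar> ^ m * cmod (nth_derivative n \<phi> (t - x))
        + \<bar>R\<bar> ^ m * cmod (nth_derivative n \<phi> (t - x)))" by (simp add: algebra_simps)
    also have "\<dots> \<le> 2 ^ m * (B1 + \<bar>R\<bar> ^ m * B2)"
      using B1[of "t - x"] B2[of "t - x"] by (intro mult_left_mono add_mono) auto
    finally show ?thesis .
  qed
  then show ?thesis
    by (intro that[of "max 0 (2 ^ m * (B1 + \<bar>R\<bar> ^ m * B2))"]) (auto simp: le_max_iff_disj)
qed

lemma tf_derivative_bound: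
  assumes "\<phi> \<in> schwartz_space"
  shows "\<exists>B. 0 \<le> B \<and> (\<forall>x w t. \<bar>x\<bar> \<le> R \<longrightarrow> \<bar>w\<bar> \<le> R \<longrightarrow> \<bar>t\<bar> ^ m * cmod (tf_derivative n \<phi> x w t) \<le> B)"
  using assms
proof (induct n arbitrary: \<phi>)
  case 0
  obtain B where "0 \<le> B" "\<And>x t. \<bar>x\<bar> \<le> R \<Longrightarrow> \<bar>t\<bar> ^ m * cmod (nth_derivative 0 \<phi> (t - x)) \<le> B"
    using shifted_schwartz_bound[OF 0] by blast
  then show ?case by (auto simp: tf_derivative_def norm_mult)
next
  case (Suc n)
  obtain B where B: "0 \<le> B" "\<And>x w t. \<bar>x\<bar> \<le> R \<Longrightarrow> \<bar>w\<bar> \<le> R \<Longrightarrow> \<bar>t\<bar> ^ m * cmod (tf_derivative n \<phi> x w t) \<le> B"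
    using Suc by blast
  obtain B' where B': "0 \<le> B'"
      "\<And>x w t. \<bar>x\<bar> \<le> R \<Longrightarrow> \<bar>w\<bar> \<le> R \<Longrightarrow> \<bar>t\<bar> ^ m * cmod (tf_derivative n (nth_derivative (Suc 0) \<phi>) x w t) \<le> B'"
    using Suc(1)[OF schwartz_derivative[OF Suc(2)]] by blast
  have "\<bar>t\<bar> ^ m * cmod (tf_derivative (Suc n) \<phi> x w t) \<le> B' + 2 * pi * \<bar>R\<bar> * B"
    if "\<bar>x\<bar> \<le> R" "\<bar>w\<bar> \<le> R" for x w t
  proof -
    have "\<bar>t\<bar> ^ m * cmod (tf_derivative (Suc n) \<phi> x w t)
      \<le> \<bar>t\<bar> ^ m * (cmod (tf_derivative n (nth_derivative (Suc 0) \<phi>) x w t) + 2 * pi * \<bar>w\<bar> * cmod (tf_derivative n \<phi> x w t))"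
      unfolding tf_derivative_Suc
      by (intro mult_left_mono order_trans[OF norm_triangle_ineq]) (auto simp: norm_mult norm_char_exponent)
    also have "\<dots> = \<bar>t\<bar> ^ m * cmod (tf_derivative n (nth_derivative (Suc 0) \<phi>) x w t)
        + 2 * pi * \<bar>w\<bar> * (\<bar>t\<bar> ^ m * cmod (tf_derivative n \<phi> x w t))" by (simp add: algebra_simps)
    also have "\<dots> \<le> B' + 2 * pi * \<bar>R\<bar> * B"
      using that B B' by (intro add_mono mult_mono) auto
    finally show ?thesis .
  qed
  then show ?case using B B' by (intro exI[of _ "B' + 2 * pi * \<bar>R\<bar> * B"]) auto
qed

lemma norm_exp_char_diff:
  "cmod (exp (char_exponent w * of_real t) - exp (char_exponent w' * of_real t)) \<le> 2 * pi * \<bar>w - w'\<bar> * \<bar>t\<bar>"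
proof -
  have e: "exp (char_exponent v * of_real t) = exp (\<i> * of_real (2 * pi * v * t))" for v
    by (simp add: char_exponent_def algebra_simps)
  have "exp (char_exponent w * of_real t) - exp (char_exponent w' * of_real t)
      = exp (char_exponent w' * of_real t) * (exp (\<i> * of_real (2 * pi * (w - w') * t)) - 1)"
    unfolding e by (simp only: right_diff_distrib mult_exp_exp) (simp add: algebra_simps)
  then have "cmod (exp (char_exponent w * of_real t) - exp (char_exponent w' * of_real t))
      = cmod (exp (\<i> * of_real (2 * pi * (w - w') * t)) - 1)" by (simp add: norm_mult)
  also have "\<dots> \<le> \<bar>2 * pi * (w - w') * t\<bar>"
    using iexp_approx1[of "2 * pi * (w - w') * t" 0] by simp
  finally show ?thesis by (simp add: abs_mult)
qed

text \<open>
  For \<open>n = 0\<close> the modulation costs a factor \<open>\<bar>t\<bar>\<close> and the translation a derivative, and both are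
  absorbed by the decay of \<open>\<phi>\<close>.  The step uses the recursion for \<open>(d/dt + c)\<^sup>n\<close> and thereby avoids
  the Leibniz formula.
\<close>

lemma tf_derivative_Lipschitz:
  assumes "\<phi> \<in> schwartz_space"
  shows "\<exists>L. 0 \<le> L \<and> (\<forall>x w x' w' t. \<bar>x\<bar> \<le> R \<longrightarrow> \<bar>w\<bar> \<le> R \<longrightarrow> \<bar>x'\<bar> \<le> R \<longrightarrow> \<bar>w'\<bar> \<le> R \<longrightarrow>
     \<bar>t\<bar> ^ m * cmod (tf_derivative n \<phi> x w t - tf_derivative n \<phi> x' w' t) \<le> L * (\<bar>x - x'\<bar> + \<bar>w - w'\<bar>))"
  using assms
proof (induct n arbitrary: \<phi>)
  case 0
  obtain B where B: "0 \<le> B" "\<And>x t. \<bar>x\<bar> \<le> R \<Longrightarrow> \<bar>t\<bar> ^ Suc m * cmod (nth_derivative 0 \<phi> (t - x)) \<le> B"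
    using shifted_schwartz_bound[OF 0] by blast
  obtain B' where B': "0 \<le> B'" "\<And>x t. \<bar>x\<bar> \<le> R \<Longrightarrow> \<bar>t\<bar> ^ m * cmod (nth_derivative (Suc 0) \<phi> (t - x)) \<le> B'"
    using shifted_schwartz_bound[OF 0] by blast
  have "\<bar>t\<bar> ^ m * cmod (tf_derivative 0 \<phi> x w t - tf_derivative 0 \<phi> x' w' t)
      \<le> (2 * pi * B + B') * (\<bar>x - x'\<bar> + \<bar>w - w'\<bar>)"
    if *: "\<bar>x\<bar> \<le> R" "\<bar>w\<bar> \<le> R" "\<bar>x'\<bar> \<le> R" "\<bar>w'\<bar> \<le> R" for x w x' w' t
  proof -
    let ?e = "\<lambda>w. exp (char_exponent w * of_real t)"
    have "tf_derivative 0 \<phi> x w t - tf_derivative 0 \<phi> x' w' t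
        = (?e w - ?e w') * \<phi> (t - x) + ?e w' * (\<phi> (t - x) - \<phi> (t - x'))"
      by (simp add: tf_derivative_def algebra_simps)
    then have "cmod (tf_derivative 0 \<phi> x w t - tf_derivative 0 \<phi> x' w' t)
        \<le> cmod ((?e w - ?e w') * \<phi> (t - x)) + cmod (?e w' * (\<phi> (t - x) - \<phi> (t - x')))"
      by (metis norm_triangle_ineq)
    also have "\<dots> \<le> 2 * pi * \<bar>w - w'\<bar> * \<bar>t\<bar> * cmod (\<phi> (t - x)) + cmod (\<phi> (t - x) - \<phi> (t - x'))"
      using norm_exp_char_diff[of w t w'] by (auto simp: norm_mult intro!: mult_right_mono)
    finally have "\<bar>t\<bar> ^ m * cmod (tf_derivative 0 \<phi> x w t - tf_derivative 0 \<phi> x' w' t)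
      \<le> \<bar>t\<bar> ^ m * (2 * pi * \<bar>w - w'\<bar> * \<bar>t\<bar> * cmod (\<phi> (t - x)) + cmod (\<phi> (t - x) - \<phi> (t - x')))"
      by (intro mult_left_mono) auto
    also have "\<dots> = 2 * pi * \<bar>w - w'\<bar> * (\<bar>t\<bar> ^ Suc m * cmod (\<phi> (t - x))) + \<bar>t\<bar> ^ m * cmod (\<phi> (t - x) - \<phi> (t - x'))"
      by (simp add: algebra_simps)
    also have "\<dots> \<le> 2 * pi * \<bar>w - w'\<bar> * B + B' * \<bar>x - x'\<bar>"
    proof (intro add_mono mult_left_mono)
      show "\<bar>t\<bar> ^ Suc m * cmod (\<phi> (t - x)) \<le> B" using B(2)[OF *(1), of t] by simp
      have "norm (of_real (\<bar>t\<bar> ^ m) * \<phi> (t - x) - of_real (\<bar>t\<bar> ^ m) * \<phi> (t - x')) \<le> B' * norm (x - x')"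
      proof (rule differentiable_bound[where S = "{-R..R}"
            and f = "\<lambda>s. of_real (\<bar>t\<bar> ^ m) * \<phi> (t - s)"
            and f' = "\<lambda>s h. h *\<^sub>R (of_real (\<bar>t\<bar> ^ m) * (- nth_derivative (Suc 0) \<phi> (t - s)))"])
        show "convex {-R..R}" by simp
        show "x \<in> {-R..R}" using *(1) by (simp add: abs_le_iff)
        show "x' \<in> {-R..R}" using *(3) by (simp add: abs_le_iff)
        fix s assume s: "s \<in> {-R..R}"
        have "((\<lambda>s. of_real (\<bar>t\<bar> ^ m) * \<phi> (t - s)) has_vector_derivative
            of_real (\<bar>t\<bar> ^ m) * (- nth_derivative (Suc 0) \<phi> (t - s))) (at s within {-R..R})"
        proof (rule has_vector_derivative_at_within, rule has_vector_derivative_mult_right)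
          have "((\<lambda>s. t - s) has_vector_derivative - 1) (at s)"
            using has_vector_derivative_diff[OF has_vector_derivative_const has_vector_derivative_id, of t "at s"] by simp
          from vector_diff_chain_at[OF this schwartz_has_derivative[OF 0, of 0 "t - s"]]
          show "((\<lambda>s. \<phi> (t - s)) has_vector_derivative - nth_derivative (Suc 0) \<phi> (t - s)) (at s)"
            by (simp add: o_def)
        qed
        then show "((\<lambda>s. of_real (\<bar>t\<bar> ^ m) * \<phi> (t - s)) has_derivative
            (\<lambda>h. h *\<^sub>R (of_real (\<bar>t\<bar> ^ m) * (- nth_derivative (Suc 0) \<phi> (t - s))))) (at s within {-R..R})"
          by (simp add: has_vector_derivative_def)
        show "onorm (\<lambda>h. h *\<^sub>R (of_real (\<bar>t\<bar> ^ m) * (- nth_derivative (Suc 0) \<phi> (t - s)))) \<le> B'"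
        proof (rule onorm_le)
          fix h :: real
          have "\<bar>t\<bar> ^ m * cmod (nth_derivative (Suc 0) \<phi> (t - s)) \<le> B'"
            using s by (intro B'(2)) auto
          then have "\<bar>h\<bar> * (\<bar>t\<bar> ^ m * cmod (nth_derivative (Suc 0) \<phi> (t - s))) \<le> \<bar>h\<bar> * B'"
            by (intro mult_left_mono) auto
          then show "norm (h *\<^sub>R (of_real (\<bar>t\<bar> ^ m) * (- nth_derivative (Suc 0) \<phi> (t - s)))) \<le> B' * norm h"
            by (simp add: norm_mult norm_power mult.commute)
        qed
      qed
      then show "\<bar>t\<bar> ^ m * cmod (\<phi> (t - x) - \<phi> (t - x')) \<le> B' * \<bar>x - x'\<bar>"
        by (simp add: norm_mult norm_power flip: right_diff_distrib)
    qed auto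
    also have "\<dots> \<le> (2 * pi * B + B') * (\<bar>x - x'\<bar> + \<bar>w - w'\<bar>)"
      using B(1) B'(1) by (simp add: algebra_simps)
    finally show ?thesis .
  qed
  then show ?case using B(1) B'(1) by (intro exI[of _ "2 * pi * B + B'"]) auto
next
  case (Suc n)
  obtain L where L: "0 \<le> L" "\<And>x w x' w' t. \<bar>x\<bar> \<le> R \<Longrightarrow> \<bar>w\<bar> \<le> R \<Longrightarrow> \<bar>x'\<bar> \<le> R \<Longrightarrow> \<bar>w'\<bar> \<le> R \<Longrightarrow>
     \<bar>t\<bar> ^ m * cmod (tf_derivative n \<phi> x w t - tf_derivative n \<phi> x' w' t) \<le> L * (\<bar>x - x'\<bar> + \<bar>w - w'\<bar>)"
    using Suc(1)[OF Suc(2)] by blast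
  obtain L' where L': "0 \<le> L'" "\<And>x w x' w' t. \<bar>x\<bar> \<le> R \<Longrightarrow> \<bar>w\<bar> \<le> R \<Longrightarrow> \<bar>x'\<bar> \<le> R \<Longrightarrow> \<bar>w'\<bar> \<le> R \<Longrightarrow>
     \<bar>t\<bar> ^ m * cmod (tf_derivative n (nth_derivative (Suc 0) \<phi>) x w t - tf_derivative n (nth_derivative (Suc 0) \<phi>) x' w' t)
       \<le> L' * (\<bar>x - x'\<bar> + \<bar>w - w'\<bar>)"
    using Suc(1)[OF schwartz_derivative[OF Suc(2)]] by blast
  obtain B where B: "0 \<le> B" "\<And>x w t. \<bar>x\<bar> \<le> R \<Longrightarrow> \<bar>w\<bar> \<le> R \<Longrightarrow> \<bar>t\<bar> ^ m * cmod (tf_derivative n \<phi> x w t) \<le> B"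
    using tf_derivative_bound[OF Suc(2)] by blast
  have "\<bar>t\<bar> ^ m * cmod (tf_derivative (Suc n) \<phi> x w t - tf_derivative (Suc n) \<phi> x' w' t)
      \<le> (L' + 2 * pi * \<bar>R\<bar> * L + 2 * pi * B) * (\<bar>x - x'\<bar> + \<bar>w - w'\<bar>)"
    if *: "\<bar>x\<bar> \<le> R" "\<bar>w\<bar> \<le> R" "\<bar>x'\<bar> \<le> R" "\<bar>w'\<bar> \<le> R" for x w x' w' t
  proof -
    let ?a = "tf_derivative n (nth_derivative (Suc 0) \<phi>) x w t - tf_derivative n (nth_derivative (Suc 0) \<phi>) x' w' t"
    let ?b = "tf_derivative n \<phi> x w t - tf_derivative n \<phi> x' w' t"
    let ?d = "\<bar>x - x'\<bar> + \<bar>w - w'\<bar>"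
    have "tf_derivative (Suc n) \<phi> x w t - tf_derivative (Suc n) \<phi> x' w' t
        = ?a + char_exponent w * ?b + char_exponent (w - w') * tf_derivative n \<phi> x' w' t"
      unfolding tf_derivative_Suc by (simp add: algebra_simps flip: char_exponent_diff)
    then have "cmod (tf_derivative (Suc n) \<phi> x w t - tf_derivative (Suc n) \<phi> x' w' t)
        \<le> cmod ?a + cmod (char_exponent w * ?b) + cmod (char_exponent (w - w') * tf_derivative n \<phi> x' w' t)"
      by (metis norm_triangle_ineq norm_triangle_le add_mono order_refl)
    also have "\<dots> = cmod ?a + 2 * pi * \<bar>w\<bar> * cmod ?b + 2 * pi * \<bar>w - w'\<bar> * cmod (tf_derivative n \<phi> x' w' t)"
      by (simp add: norm_mult norm_char_exponent)
    finally have "\<bar>t\<bar> ^ m * cmod (tf_derivative (Suc n) \<phi> x w t - tf_derivative (Suc n) \<phi> x' w' t)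
      \<le> \<bar>t\<bar> ^ m * (cmod ?a + 2 * pi * \<bar>w\<bar> * cmod ?b + 2 * pi * \<bar>w - w'\<bar> * cmod (tf_derivative n \<phi> x' w' t))"
      by (intro mult_left_mono) auto
    also have "\<dots> = \<bar>t\<bar> ^ m * cmod ?a + 2 * pi * \<bar>w\<bar> * (\<bar>t\<bar> ^ m * cmod ?b)
        + 2 * pi * \<bar>w - w'\<bar> * (\<bar>t\<bar> ^ m * cmod (tf_derivative n \<phi> x' w' t))"
      by (simp add: algebra_simps)
    also have "\<dots> \<le> L' * ?d + 2 * pi * \<bar>R\<bar> * (L * ?d) + 2 * pi * ?d * B"
      using * by (intro add_mono L' mult_mono L B) (auto intro: L B)
    also have "\<dots> = (L' + 2 * pi * \<bar>R\<bar> * L + 2 * pi * B) * ?d" by (simp add: algebra_simps)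
    finally show ?thesis .
  qed
  then show ?case using L(1) L'(1) B(1) by (intro exI[of _ "L' + 2 * pi * \<bar>R\<bar> * L + 2 * pi * B"]) auto
qed

section \<open>Continuity of the short-time Fourier transform\<close>

lemma schwartz_tf_shift:
  assumes "\<phi> \<in> schwartz_space"
  shows "modulate w (translate x \<phi>) \<in> schwartz_space"
    and "nth_derivative n (modulate w (translate x \<phi>)) = tf_derivative n \<phi> x w"
proof -
  have "\<exists>B. \<forall>t. \<bar>t\<bar> ^ m * cmod (tf_derivative n \<phi> x w t) \<le> B" for m n
  proof -
    obtain B where "\<forall>x' w' t. \<bar>x'\<bar> \<le> max \<bar>x\<bar> \<bar>w\<bar> \<longrightarrow> \<bar>w'\<bar> \<le> max \<bar>x\<bar> \<bar>w\<bar> \<longrightarrow>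
        \<bar>t\<bar> ^ m * cmod (tf_derivative n \<phi> x' w' t) \<le> B"
      using tf_derivative_bound[OF assms, of "max \<bar>x\<bar> \<bar>w\<bar>" m n] by (elim exE conjE)
    from this[rule_format, of x w, OF max.cobounded1 max.cobounded2] show ?thesis by blast
  qed
  from schwartz_spaceI[of "\<lambda>n. tf_derivative n \<phi> x w", OF has_derivative_tf_derivative[OF assms] this]
  show "modulate w (translate x \<phi>) \<in> schwartz_space" by (simp add: tf_derivative_0)
  show "nth_derivative n (modulate w (translate x \<phi>)) = tf_derivative n \<phi> x w"
    using nth_derivative_eq[of "\<lambda>n. tf_derivative n \<phi> x w" n, OF has_derivative_tf_derivative[OF assms]]
    by (simp add: tf_derivative_0)
qed

lemma translate_0 [simp]: "translate 0 \<phi> = \<phi>" and modulate_0 [simp]: "modulate 0 \<phi> = \<phi>"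
  by (simp_all add: translate_def modulate_def)

lemma tempered_add: "f \<in> tempered_distributions \<Longrightarrow> \<phi> \<in> schwartz_space \<Longrightarrow> \<theta> \<in> schwartz_space \<Longrightarrow>
    f (\<phi> + \<theta>) = f \<phi> + f \<theta>"
  by (simp add: tempered_distributions_def)

lemma tempered_scale: "f \<in> tempered_distributions \<Longrightarrow> \<phi> \<in> schwartz_space \<Longrightarrow> f (c *\<^sub>C \<phi>) = cnj c * f \<phi>"
  by (simp add: tempered_distributions_def)

lemma schwartz_seminorm_nonneg:
  assumes "\<phi> \<in> schwartz_space"
  shows "0 \<le> schwartz_seminorm m n \<phi>"
proof -
  have "bdd_above (range (\<lambda>t. \<bar>t\<bar> ^ m * cmod (nth_derivative n \<phi> t)))"
    using assms by (simp add: schwartz_space_def)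
  then have "\<bar>0\<bar> ^ m * cmod (nth_derivative n \<phi> 0) \<le> schwartz_seminorm m n \<phi>"
    unfolding schwartz_seminorm_def by (intro cSUP_upper) auto
  then show ?thesis by (rule order_trans[rotated]) simp
qed

lemma tempered_bound:
  assumes "f \<in> tempered_distributions"
  obtains C K where "0 \<le> C" "\<And>\<phi>. \<phi> \<in> schwartz_space \<Longrightarrow>
    cmod (f \<phi>) \<le> C * (\<Sum>m\<le>K. \<Sum>n\<le>K. schwartz_seminorm m n \<phi>)"
proof -
  obtain C :: real and K where C: "\<And>\<phi>. \<phi> \<in> schwartz_space \<Longrightarrow>
    cmod (f \<phi>) \<le> C * (\<Sum>m\<le>K. \<Sum>n\<le>K. schwartz_seminorm m n \<phi>)"
    using assms unfolding tempered_distributions_def by blast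
  have "cmod (f \<phi>) \<le> \<bar>C\<bar> * (\<Sum>m\<le>K. \<Sum>n\<le>K. schwartz_seminorm m n \<phi>)" if "\<phi> \<in> schwartz_space" for \<phi>
    using C[OF that] by (rule order_trans) (intro mult_right_mono sum_nonneg schwartz_seminorm_nonneg that, simp)
  then show ?thesis using that[of "\<bar>C\<bar>" K] by simp
qed

lemma schwartz_seminorm_le:
  "(\<And>t. \<bar>t\<bar> ^ m * cmod (nth_derivative n \<phi> t) \<le> B) \<Longrightarrow> schwartz_seminorm m n \<phi> \<le> B"
  unfolding schwartz_seminorm_def by (rule cSUP_least) auto

text \<open>
  A tempered distribution is bounded by finitely many Schwartz seminorms, and each of them is
  locally Lipschitz along the family \<open>M\<^sub>w T\<^sub>x \<psi>\<close>.
\<close>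

lemma stft_Lipschitz:
  assumes f: "f \<in> tempered_distributions" and \<psi>: "\<psi> \<in> schwartz_space"
  shows "\<exists>L. \<forall>x w x' w'. \<bar>x\<bar> \<le> R \<longrightarrow> \<bar>w\<bar> \<le> R \<longrightarrow> \<bar>x'\<bar> \<le> R \<longrightarrow> \<bar>w'\<bar> \<le> R \<longrightarrow>
    cmod (stft \<psi> f x w - stft \<psi> f x' w') \<le> L * (\<bar>x - x'\<bar> + \<bar>w - w'\<bar>)"
proof -
  obtain C K where C: "0 \<le> C" "\<And>\<phi>. \<phi> \<in> schwartz_space \<Longrightarrow>
    cmod (f \<phi>) \<le> C * (\<Sum>m\<le>K. \<Sum>n\<le>K. schwartz_seminorm m n \<phi>)"
    using tempered_bound[OF f] by blast
  have "\<exists>l. \<forall>m n. 0 \<le> l m n \<and> (\<forall>x w x' w' t. \<bar>x\<bar> \<le> R \<longrightarrow> \<bar>w\<bar> \<le> R \<longrightarrow> \<bar>x'\<bar> \<le> R \<longrightarrow> \<bar>w'\<bar> \<le> R \<longrightarrow>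
     \<bar>t\<bar> ^ m * cmod (tf_derivative n \<psi> x w t - tf_derivative n \<psi> x' w' t) \<le> l m n * (\<bar>x - x'\<bar> + \<bar>w - w'\<bar>))"
    using tf_derivative_Lipschitz[OF \<psi>, of R] by metis
  then obtain l where l: "\<And>x w x' w' m n t. \<bar>x\<bar> \<le> R \<Longrightarrow> \<bar>w\<bar> \<le> R \<Longrightarrow> \<bar>x'\<bar> \<le> R \<Longrightarrow> \<bar>w'\<bar> \<le> R \<Longrightarrow>
     \<bar>t\<bar> ^ m * cmod (tf_derivative n \<psi> x w t - tf_derivative n \<psi> x' w' t) \<le> l m n * (\<bar>x - x'\<bar> + \<bar>w - w'\<bar>)"
    by metis
  have "cmod (stft \<psi> f x w - stft \<psi> f x' w') \<le> (C * (\<Sum>m\<le>K. \<Sum>n\<le>K. l m n)) * (\<bar>x - x'\<bar> + \<bar>w - w'\<bar>)"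
    if *: "\<bar>x\<bar> \<le> R" "\<bar>w\<bar> \<le> R" "\<bar>x'\<bar> \<le> R" "\<bar>w'\<bar> \<le> R" for x w x' w'
  proof -
    let ?a = "modulate w (translate x \<psi>)" and ?b = "modulate w' (translate x' \<psi>)"
    let ?d = "\<lambda>t. ?a t + (-1) * ?b t"
    note ab = schwartz_tf_shift(1)[OF \<psi>, of w x] schwartz_tf_shift(1)[OF \<psi>, of w' x']
    have d: "?d \<in> schwartz_space" by (rule schwartz_lincomb(1)[OF ab])
    have "f ?d = f (?a + (-1) *\<^sub>C ?b)" by (rule arg_cong[of _ _ f]) (simp add: fun_eq_iff cscale_def)
    also have "\<dots> = f ?a - f ?b"
      using schwartz_lincomb(1)[OF _ ab(2), of "\<lambda>_. 0" "-1"] tempered_add[OF f ab(1), of "(-1) *\<^sub>C ?b"]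
        tempered_scale[OF f ab(2), of "-1"] ab schwartz_lincomb(1)[OF ab(2) ab(2), of "-2"]
      by (simp add: cscale_def)
    finally have "cmod (stft \<psi> f x w - stft \<psi> f x' w') = cmod (f ?d)" by (simp add: stft_def)
    also have "\<dots> \<le> C * (\<Sum>m\<le>K. \<Sum>n\<le>K. schwartz_seminorm m n ?d)" by (rule C(2)[OF d])
    also have "\<dots> \<le> C * (\<Sum>m\<le>K. \<Sum>n\<le>K. l m n * (\<bar>x - x'\<bar> + \<bar>w - w'\<bar>))"
    proof (intro mult_left_mono sum_mono schwartz_seminorm_le C(1))
      fix m n t
      have "nth_derivative n ?d t = tf_derivative n \<psi> x w t - tf_derivative n \<psi> x' w' t"
        unfolding schwartz_lincomb(2)[OF ab] schwartz_tf_shift(2)[OF \<psi>] by simp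
      then show "\<bar>t\<bar> ^ m * cmod (nth_derivative n ?d t) \<le> l m n * (\<bar>x - x'\<bar> + \<bar>w - w'\<bar>)"
        using l[OF *] by simp
    qed
    also have "\<dots> = (C * (\<Sum>m\<le>K. \<Sum>n\<le>K. l m n)) * (\<bar>x - x'\<bar> + \<bar>w - w'\<bar>)"
      by (simp add: sum_distrib_right mult.assoc)
    finally show ?thesis .
  qed
  then show ?thesis by blast
qed

lemma continuous_stft:
  assumes f: "f \<in> tempered_distributions" and \<psi>: "\<psi> \<in> schwartz_space"
  shows "continuous_on UNIV (\<lambda>z. stft \<psi> f (fst z) (snd z))"
proof -
  have "isCont (\<lambda>z. stft \<psi> f (fst z) (snd z)) z0" for z0
  proof -
    obtain x0 w0 where z0: "z0 = (x0, w0)" by fastforce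
    \<comment> \<open>A box that contains the unit ball around \<open>(x\<^sub>0, w\<^sub>0)\<close>.\<close>
    define R where "R = max \<bar>x0\<bar> \<bar>w0\<bar> + 1"
    obtain L where L: "\<And>x w x' w'. \<bar>x\<bar> \<le> R \<Longrightarrow> \<bar>w\<bar> \<le> R \<Longrightarrow> \<bar>x'\<bar> \<le> R \<Longrightarrow> \<bar>w'\<bar> \<le> R \<Longrightarrow>
      cmod (stft \<psi> f x w - stft \<psi> f x' w') \<le> L * (\<bar>x - x'\<bar> + \<bar>w - w'\<bar>)"
      using stft_Lipschitz[OF f \<psi>, of R] by blast
    have ev: "\<forall>\<^sub>F z in at z0. dist z z0 < 1" unfolding eventually_at by (rule exI[of _ 1]) auto
    have "((\<lambda>z. L * (\<bar>fst z - fst z0\<bar> + \<bar>snd z - snd z0\<bar>)) \<longlongrightarrow> L * (\<bar>fst z0 - fst z0\<bar> + \<bar>snd z0 - snd z0\<bar>)) (at z0)"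
      by (intro tendsto_intros)
    then have lim: "((\<lambda>z. L * (\<bar>fst z - fst z0\<bar> + \<bar>snd z - snd z0\<bar>)) \<longlongrightarrow> 0) (at z0)" by simp
    have "\<forall>\<^sub>F z in at z0. norm (stft \<psi> f (fst z) (snd z) - stft \<psi> f (fst z0) (snd z0))
        \<le> L * (\<bar>fst z - fst z0\<bar> + \<bar>snd z - snd z0\<bar>)"
      using ev
    proof eventually_elim
      case (elim z)
      have "\<bar>fst z - x0\<bar> < 1" "\<bar>snd z - w0\<bar> < 1"
        using elim dist_fst_le[of z z0] dist_snd_le[of z z0] by (auto simp: z0 dist_real_def)
      then show ?case using L[of "fst z" "snd z" x0 w0] by (auto simp: R_def z0)
    qed
    from Lim_null_comparison[OF this lim]
    have "((\<lambda>z. stft \<psi> f (fst z) (snd z) - stft \<psi> f (fst z0) (snd z0)) \<longlongrightarrow> 0) (at z0)" .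
    then show ?thesis unfolding isCont_def by (rule LIM_zero_cancel)
  qed
  then show ?thesis by (simp add: continuous_at_imp_continuous_on)
qed

lemma measurable_stft:
  assumes "f \<in> tempered_distributions" "\<psi> \<in> schwartz_space"
  shows "(\<lambda>z. stft \<psi> f (fst z) (snd z)) \<in> borel_measurable borel"
  by (rule borel_measurable_continuous_onI[OF continuous_stft[OF assms]])

text \<open>
  Time-frequency shifts compose up to a phase factor.
\<close>

lemma stft_gabor:
  assumes f: "f \<in> tempered_distributions" and \<psi>: "\<psi> \<in> schwartz_space"
  shows "cmod (stft \<psi> (gabor \<alpha> \<beta> f (k, n)) x w) = cmod (stft \<psi> f (x - \<alpha> * of_int k) (w - \<beta> * of_int n))"
proof -
  define a b where "a = \<alpha> * of_int k" and "b = \<beta> * of_int n"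
  have "translate (- a) (modulate (- b) (modulate w (translate x \<psi>)))
      = exp (char_exponent (w - b) * of_real a) *\<^sub>C modulate (w - b) (translate (x - a) \<psi>)"
  proof
    fix t
    have "char_exponent (- b) * of_real (t + a) + char_exponent w * of_real (t + a)
        = char_exponent (w - b) * of_real a + char_exponent (w - b) * of_real t"
      by (simp add: char_exponent_def algebra_simps)
    then have "exp (char_exponent (- b) * of_real (t + a)) * exp (char_exponent w * of_real (t + a))
        = exp (char_exponent (w - b) * of_real a) * exp (char_exponent (w - b) * of_real t)"
      unfolding mult_exp_exp by (rule arg_cong)
    moreover have "t + a - x = t - (x - a)" by simp
    ultimately show "translate (- a) (modulate (- b) (modulate w (translate x \<psi>))) t
        = (exp (char_exponent (w - b) * of_real a) *\<^sub>C modulate (w - b) (translate (x - a) \<psi>)) t"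
      unfolding translate_def modulate_eq cscale_def diff_minus_eq_add
      by (simp only: mult.assoc[symmetric])
  qed
  then have "stft \<psi> (gabor \<alpha> \<beta> f (k, n)) x w
      = f (exp (char_exponent (w - b) * of_real a) *\<^sub>C modulate (w - b) (translate (x - a) \<psi>))"
    by (simp add: stft_def gabor_def dist_modulate_def dist_translate_def a_def b_def)
  also have "\<dots> = cnj (exp (char_exponent (w - b) * of_real a)) * stft \<psi> f (x - a) (w - b)"
    unfolding stft_def by (intro tempered_scale f schwartz_tf_shift \<psi>)
  finally show ?thesis by (simp add: norm_mult a_def b_def)
qed

lemma gabor_tempered_0: "gabor \<alpha> \<beta> f (0, 0) = f"
  by (simp add: gabor_def dist_modulate_def dist_translate_def)

section \<open>Averaging over the fourth roots of unity\<close>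

text \<open>
  With \<open>y = \<sigma>\<^sup>2\<close> the square of the right-hand side is \<open>2 + 2 \<surd>(1 - y)\<close>.  The coefficient 1/4 is
  the exact second-order term, which has to be kept for a gain proportional to \<open>\<bar>b\<bar>\<^sup>2\<close> when \<open>b\<close> is small
  compared with \<open>a\<close> in the inequality for four phases; 3/8 is a convenient value that
  makes the bound valid up to \<open>y = 1\<close>.
\<close>

lemma sqrt_pair_lower_bound:
  fixes \<sigma> :: real
  assumes "\<bar>\<sigma>\<bar> \<le> 1"
  shows "2 - \<sigma>\<^sup>2 / 4 - 3 / 8 * (\<sigma>\<^sup>2)\<^sup>2 \<le> sqrt (1 + \<sigma>) + sqrt (1 - \<sigma>)"
proof -
  define y where "y = \<sigma>\<^sup>2"
  have y: "0 \<le> y" "y \<le> 1" using assms by (auto simp: y_def abs_square_le_1)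
  have y2: "y^3 \<le> y\<^sup>2" "y^4 \<le> y\<^sup>2" using y by (auto intro: power_decreasing)
  have "(1 - y / 2 - y\<^sup>2 / 2)\<^sup>2 = 1 - y - 3 / 4 * y\<^sup>2 + y^3 / 2 + y^4 / 4"
    by (simp add: power2_eq_square power3_eq_cube power4_eq_xxxx field_simps)
  also have "\<dots> \<le> 1 - y" using y2 by simp
  finally have "1 - y / 2 - y\<^sup>2 / 2 \<le> sqrt (1 - y)" by (rule real_le_rsqrt)
  moreover have "sqrt (1 - y) = sqrt (1 + \<sigma>) * sqrt (1 - \<sigma>)"
    by (simp add: y_def power2_eq_square algebra_simps flip: real_sqrt_mult)
  ultimately have 1: "4 - y - y\<^sup>2 \<le> (sqrt (1 + \<sigma>) + sqrt (1 - \<sigma>))\<^sup>2"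
    using assms by (simp add: power2_sum)
  have "(2 - y / 4 - 3 / 8 * y\<^sup>2)\<^sup>2 = 4 - y - 3 / 2 * y\<^sup>2 + y\<^sup>2 / 16 + 3 / 16 * y^3 + 9 / 64 * y^4"
    by (simp add: power2_eq_square power3_eq_cube power4_eq_xxxx field_simps)
  also have "\<dots> \<le> 4 - y - y\<^sup>2"
    using y2 zero_le_power2[of y] by linarith
  finally have "(2 - y / 4 - 3 / 8 * y\<^sup>2)\<^sup>2 \<le> (sqrt (1 + \<sigma>) + sqrt (1 - \<sigma>))\<^sup>2"
    using 1 by linarith
  then have "2 - y / 4 - 3 / 8 * y\<^sup>2 \<le> sqrt (1 + \<sigma>) + sqrt (1 - \<sigma>)"
    by (rule power2_le_imp_le) (use assms in auto)
  then show ?thesis by (simp add: y_def)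
qed

text \<open>
  The previous lemma bounds the right-hand side below by \<open>4 - A B - 6 (A B)\<^sup>2\<close>, and the left-hand
  side is at most \<open>4 - 7 B / 4\<close>; what remains is the cubic inequality
  \<open>A + 6 A\<^sup>2 (1 - A) \<le> 7/4\<close>, visible after splitting off \<open>(A - 3/4)\<^sup>2\<close>.
\<close>

lemma sqrt_four_phases:
  fixes A B \<sigma> \<tau> :: real
  assumes "0 \<le> A" "0 \<le> B" "A + B \<le> 1" and st: "\<sigma>\<^sup>2 + \<tau>\<^sup>2 = 4 * A * B" and le: "\<bar>\<sigma>\<bar> \<le> 1" "\<bar>\<tau>\<bar> \<le> 1"
  shows "4 * sqrt (1 - 7 / 8 * B) \<le> sqrt (1 + \<sigma>) + sqrt (1 - \<sigma>) + sqrt (1 + \<tau>) + sqrt (1 - \<tau>)"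
proof -
  have sq: "sqrt (1 - 7 / 8 * B) \<le> 1 - 7 / 16 * B"
    by (rule real_le_lsqrt) (use assms in \<open>auto simp: power2_eq_square field_simps\<close>)
  have "A - 6 * A^3 + 6 * A\<^sup>2 \<le> 7 / 4"
  proof -
    have "7 / 4 - (A - 6 * A^3 + 6 * A\<^sup>2) = (A - 3 / 4)\<^sup>2 * (6 * A + 3) + A / 8 + 1 / 16"
      by (simp add: power2_eq_square power3_eq_cube field_simps)
    moreover have "0 \<le> (A - 3 / 4)\<^sup>2 * (6 * A + 3)" using assms by (intro mult_nonneg_nonneg) auto
    ultimately show ?thesis using assms by linarith
  qed
  moreover have "6 * A\<^sup>2 * B \<le> 6 * A\<^sup>2 * (1 - A)" using assms by (intro mult_left_mono) auto
  ultimately have "A + 6 * A\<^sup>2 * B \<le> 7 / 4" by (simp add: algebra_simps power2_eq_square power3_eq_cube)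
  from mult_right_mono[OF this assms(2)]
  have poly: "A * B + 6 * (A * B)\<^sup>2 \<le> 7 / 4 * B" by (simp add: algebra_simps power2_eq_square)
  have "(\<sigma>\<^sup>2)\<^sup>2 + (\<tau>\<^sup>2)\<^sup>2 \<le> (\<sigma>\<^sup>2 + \<tau>\<^sup>2)\<^sup>2" by (simp add: power2_sum)
  also have "\<dots> = 16 * (A * B)\<^sup>2" unfolding st by (simp add: power_mult_distrib)
  finally have "(\<sigma>\<^sup>2)\<^sup>2 + (\<tau>\<^sup>2)\<^sup>2 \<le> 16 * (A * B)\<^sup>2" .
  then show ?thesis
    using sqrt_pair_lower_bound[OF le(1)] sqrt_pair_lower_bound[OF le(2)] st poly sq by linarith
qed

text \<open>
  The elementary step of the Khinchine inequality.  With \<open>R = \<bar>a\<bar>\<^sup>2 + \<bar>b\<bar>\<^sup>2 + D\<close> the four terms on the right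
  are \<open>\<surd>(R \<plusminus> s)\<close> and \<open>\<surd>(R \<plusminus> t)\<close>, where \<open>s\<^sup>2 + t\<^sup>2 = 4 \<bar>a\<bar>\<^sup>2 \<bar>b\<bar>\<^sup>2\<close>.  The four phases are essential: for
  the signs \<open>\<plusminus>1\<close> alone, \<open>D = 0\<close> and real \<open>a\<close>, \<open>b\<close> with \<open>\<bar>b\<bar> \<le> \<bar>a\<bar>\<close> there is no gain.  The summand \<open>D\<close> carries
  the contribution of the other vectors in the induction.
\<close>

lemma phase_average_lower_bound:
  fixes a b :: complex
  assumes "0 \<le> D"
  shows "4 * sqrt ((cmod a)\<^sup>2 + (cmod b)\<^sup>2 / 8 + D) \<le> (\<Sum>k<4. sqrt ((cmod (a + \<i> ^ k * b))\<^sup>2 + D))"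
proof -
  define R where "R = (cmod a)\<^sup>2 + (cmod b)\<^sup>2 + D"
  define s where "s = 2 * Re (a * cnj b)"
  define t where "t = 2 * Im (a * cnj b)"
  have rhs: "(\<Sum>k<4. sqrt ((cmod (a + \<i> ^ k * b))\<^sup>2 + D)) = sqrt (R + s) + sqrt (R - s) + sqrt (R + t) + sqrt (R - t)"
  proof -
    have "(cmod (a + b))\<^sup>2 + D = R + s" "(cmod (a - b))\<^sup>2 + D = R - s"
      "(cmod (a + \<i> * b))\<^sup>2 + D = R + t" "(cmod (a - \<i> * b))\<^sup>2 + D = R - t"
      unfolding R_def s_def t_def cmod_power2 by (simp_all add: power2_eq_square algebra_simps)
    then show ?thesis by (simp add: numeral_eq_Suc)
  qed
  have lhs: "(cmod a)\<^sup>2 + (cmod b)\<^sup>2 / 8 + D = R - 7 / 8 * (cmod b)\<^sup>2" by (simp add: R_def)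
  have st: "s\<^sup>2 + t\<^sup>2 = 4 * (cmod a)\<^sup>2 * (cmod b)\<^sup>2"
  proof -
    have "s\<^sup>2 + t\<^sup>2 = 4 * (cmod (a * cnj b))\<^sup>2" by (simp only: s_def t_def cmod_power2 power_mult_distrib) simp
    then show ?thesis by (simp add: norm_mult power_mult_distrib)
  qed
  show ?thesis
  proof (cases "R = 0")
    case True
    then have "cmod a = 0" "cmod b = 0" "D = 0"
      using assms unfolding R_def by (smt (verit) zero_le_power2 zero_eq_power2)+
    then show ?thesis by simp
  next
    case False
    then have R: "R > 0" using assms unfolding R_def by (smt (verit) zero_le_power2)
    have bound: "\<bar>s\<bar> \<le> R" "\<bar>t\<bar> \<le> R"
    proof -
      have "2 * (cmod a * cmod b) \<le> R"
        using assms sum_squares_bound[of "cmod a" "cmod b"] by (simp add: R_def)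
      moreover have "\<bar>s\<bar> \<le> 2 * (cmod a * cmod b)" "\<bar>t\<bar> \<le> 2 * (cmod a * cmod b)"
        using abs_Re_le_cmod[of "a * cnj b"] abs_Im_le_cmod[of "a * cnj b"]
        by (simp_all add: s_def t_def norm_mult)
      ultimately show "\<bar>s\<bar> \<le> R" "\<bar>t\<bar> \<le> R" by linarith+
    qed
    let ?A = "(cmod a)\<^sup>2 / R" and ?B = "(cmod b)\<^sup>2 / R"
    have main: "4 * sqrt (1 - 7 / 8 * ?B) \<le> sqrt (1 + s / R) + sqrt (1 - s / R) + sqrt (1 + t / R) + sqrt (1 - t / R)"
    proof (rule sqrt_four_phases[where A = ?A])
      show "?A + ?B \<le> 1" using R assms by (simp add: R_def flip: add_divide_distrib)
      show "(s / R)\<^sup>2 + (t / R)\<^sup>2 = 4 * ?A * ?B"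
        using R st by (simp add: power_divide power2_eq_square flip: add_divide_distrib)
      show "\<bar>s / R\<bar> \<le> 1" "\<bar>t / R\<bar> \<le> 1" using bound R by auto
    qed (use R in auto)
    have scale: "sqrt (R + z) = sqrt R * sqrt (1 + z / R)" for z
      using R by (simp add: distrib_left flip: real_sqrt_mult)
    have "4 * sqrt (R - 7 / 8 * (cmod b)\<^sup>2) = sqrt R * (4 * sqrt (1 - 7 / 8 * ?B))"
      using scale[of "- (7 / 8 * (cmod b)\<^sup>2)"] by simp
    also have "\<dots> \<le> sqrt R * (sqrt (1 + s / R) + sqrt (1 - s / R) + sqrt (1 + t / R) + sqrt (1 - t / R))"
      using main R by (intro mult_left_mono) auto
    also have "\<dots> = sqrt (R + s) + sqrt (R - s) + sqrt (R + t) + sqrt (R - t)"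
      using scale[of s] scale[of "- s"] scale[of t] scale[of "- t"] by (simp add: distrib_left)
    finally show ?thesis unfolding rhs lhs .
  qed
qed

section \<open>Mixed norms\<close>

locale modulation_setting = P: finite_exponent p + Q: finite_exponent q for p q +
  fixes \<psi> :: "real \<Rightarrow> complex"
  assumes window: "\<psi> \<in> schwartz_space"
begin

definition mixed_norm :: "(real \<Rightarrow> real \<Rightarrow> ennreal) \<Rightarrow> ennreal"
  where "mixed_norm F = Lp_norm q (\<lambda>w. Lp_norm p (\<lambda>x. F x w))"

abbreviation tf_measurable :: "(real \<Rightarrow> real \<Rightarrow> ennreal) \<Rightarrow> bool"
  where "tf_measurable F \<equiv> (\<lambda>(w, x). F x w) \<in> borel_measurable (lborel \<Otimes>\<^sub>M lborel)"

lemma tf_measurable_section: "tf_measurable F \<Longrightarrow> (\<lambda>x. F x w) \<in> borel_measurable lborel"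
  using measurable_compose[of "\<lambda>x. (w, x)" lborel "lborel \<Otimes>\<^sub>M lborel" "\<lambda>(w, x). F x w"] by simp

lemma mixed_norm_mono: "(\<And>x w. F x w \<le> G x w) \<Longrightarrow> mixed_norm F \<le> mixed_norm G"
  unfolding mixed_norm_def by (intro P.Lp_norm_mono Q.Lp_norm_mono)

lemma mixed_norm_cmult:
  assumes "tf_measurable F" shows "mixed_norm (\<lambda>x w. c * F x w) = c * mixed_norm F"
  unfolding mixed_norm_def
  using assms by (simp add: P.Lp_norm_cmult Q.Lp_norm_cmult P.measurable_Lp_norm tf_measurable_section)

lemma mixed_norm_triangle:
  assumes "tf_measurable F" "tf_measurable G"
  shows "mixed_norm (\<lambda>x w. F x w + G x w) \<le> mixed_norm F + mixed_norm G"
proof -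
  have "mixed_norm (\<lambda>x w. F x w + G x w) \<le> Lp_norm q (\<lambda>w. Lp_norm p (\<lambda>x. F x w) + Lp_norm p (\<lambda>x. G x w))"
    unfolding mixed_norm_def by (intro Q.Lp_norm_mono P.Lp_norm_triangle tf_measurable_section assms)
  also have "\<dots> \<le> mixed_norm F + mixed_norm G"
    unfolding mixed_norm_def by (intro Q.Lp_norm_triangle P.measurable_Lp_norm assms)
  finally show ?thesis .
qed

lemma mixed_norm_sum:
  assumes "finite I" "\<And>i. i \<in> I \<Longrightarrow> tf_measurable (F i)"
  shows "mixed_norm (\<lambda>x w. \<Sum>i\<in>I. F i x w) \<le> (\<Sum>i\<in>I. mixed_norm (F i))"
  using assms
proof (induct I rule: finite_induct)
  case (insert i I)
  have [measurable]: "tf_measurable (F i)" if "i \<in> I" for i using insert that by simp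
  have m: "tf_measurable (\<lambda>x w. \<Sum>i\<in>I. F i x w)"
    unfolding case_prod_beta by (rule borel_measurable_sum) (use insert in \<open>simp add: case_prod_beta\<close>)
  have "mixed_norm (\<lambda>x w. F i x w + (\<Sum>i\<in>I. F i x w)) \<le> mixed_norm (F i) + mixed_norm (\<lambda>x w. \<Sum>i\<in>I. F i x w)"
    by (rule mixed_norm_triangle) (use insert m in auto)
  also have "\<dots> \<le> mixed_norm (F i) + (\<Sum>i\<in>I. mixed_norm (F i))"
    using insert by (intro add_left_mono) auto
  finally show ?case unfolding sum.insert[OF insert.hyps(1,2)] .
qed (simp add: mixed_norm_def)

lemma mixed_norm_SUP:
  assumes "\<And>n. tf_measurable (F n)" "\<And>x w. incseq (\<lambda>n::nat. F n x w)"
  shows "mixed_norm (\<lambda>x w. SUP n. F n x w) = (SUP n. mixed_norm (F n))"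
proof -
  have "Lp_norm p (\<lambda>x. SUP n. F n x w) = (SUP n. Lp_norm p (\<lambda>x. F n x w))" for w
    by (rule P.Lp_norm_SUP) (use assms in \<open>auto intro: tf_measurable_section\<close>)
  then have "mixed_norm (\<lambda>x w. SUP n. F n x w) = Lp_norm q (\<lambda>w. SUP n. Lp_norm p (\<lambda>x. F n x w))"
    by (simp add: mixed_norm_def)
  also have "\<dots> = (SUP n. mixed_norm (F n))"
    unfolding mixed_norm_def
    by (rule Q.Lp_norm_SUP) (use assms in \<open>auto intro!: P.measurable_Lp_norm P.Lp_norm_mono simp: incseq_def\<close>)
  finally show ?thesis .
qed

lemma mixed_norm_dominated:
  assumes "\<And>n. tf_measurable (F n)" "tf_measurable G" "\<And>n x w. F n x w \<le> G x w" "mixed_norm G < top"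
    and "\<And>x w. G x w < top \<Longrightarrow> (\<lambda>n::nat. F n x w) \<longlonglongrightarrow> 0"
  shows "(\<lambda>n. mixed_norm (F n)) \<longlonglongrightarrow> 0"
  unfolding mixed_norm_def
proof (rule Q.Lp_norm_dominated)
  show "Lp_norm q (\<lambda>w. Lp_norm p (\<lambda>x. G x w)) < top" using assms(4) by (simp add: mixed_norm_def)
  show "(\<lambda>n. Lp_norm p (\<lambda>x. F n x w)) \<longlonglongrightarrow> 0" if "Lp_norm p (\<lambda>x. G x w) < top" for w
    by (rule P.Lp_norm_dominated[OF _ _ _ that]) (use assms in \<open>auto intro: tf_measurable_section\<close>)
qed (use assms in \<open>auto intro!: P.measurable_Lp_norm P.Lp_norm_mono\<close>)

lemma modulation_norm_eq: "modulation_norm \<psi> p q f = mixed_norm (\<lambda>x w. ennreal (cmod (stft \<psi> f x w)))"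
  by (simp add: modulation_norm_def mixed_norm_def)

lemma measurable_stft_pair:
  assumes "f \<in> tempered_distributions"
  shows "(\<lambda>(w, x). stft \<psi> f x w) \<in> borel_measurable (lborel \<Otimes>\<^sub>M lborel)"
proof -
  have "(\<lambda>z::real \<times> real. (snd z, fst z)) \<in> borel_measurable borel"
    by (intro borel_measurable_continuous_onI continuous_intros)
  from measurable_compose[OF this measurable_stft[OF assms window]]
  have "(\<lambda>(w, x). stft \<psi> f x w) \<in> borel_measurable borel" by (simp add: case_prod_beta)
  then show ?thesis by (simp add: lborel_prod)
qed

end

section \<open>Modulation spaces contain no copy of the null sequences\<close>

lemma tempered_add_closed:
  assumes f: "f \<in> tempered_distributions" and g: "g \<in> tempered_distributions"
  shows "f + g \<in> tempered_distributions"
proof -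
  obtain C K where C: "0 \<le> C" "\<And>\<phi>. \<phi> \<in> schwartz_space \<Longrightarrow>
    cmod (f \<phi>) \<le> C * (\<Sum>m\<le>K. \<Sum>n\<le>K. schwartz_seminorm m n \<phi>)" using tempered_bound[OF f] by blast
  obtain D L where D: "0 \<le> D" "\<And>\<phi>. \<phi> \<in> schwartz_space \<Longrightarrow>
    cmod (g \<phi>) \<le> D * (\<Sum>m\<le>L. \<Sum>n\<le>L. schwartz_seminorm m n \<phi>)" using tempered_bound[OF g] by blast
  have mono: "(\<Sum>m\<le>k. \<Sum>n\<le>k. schwartz_seminorm m n \<phi>) \<le> (\<Sum>m\<le>max K L. \<Sum>n\<le>max K L. schwartz_seminorm m n \<phi>)"
    if "k \<le> max K L" "\<phi> \<in> schwartz_space" for k \<phi>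
  proof -
    have "(\<Sum>m\<le>k. \<Sum>n\<le>k. schwartz_seminorm m n \<phi>) \<le> (\<Sum>m\<le>k. \<Sum>n\<le>max K L. schwartz_seminorm m n \<phi>)"
      using that by (intro sum_mono sum_mono2 schwartz_seminorm_nonneg) auto
    also have "\<dots> \<le> (\<Sum>m\<le>max K L. \<Sum>n\<le>max K L. schwartz_seminorm m n \<phi>)"
      using that by (intro sum_mono2 sum_nonneg schwartz_seminorm_nonneg) auto
    finally show ?thesis .
  qed
  have "cmod ((f + g) \<phi>) \<le> (C + D) * (\<Sum>m\<le>max K L. \<Sum>n\<le>max K L. schwartz_seminorm m n \<phi>)"
    if \<phi>: "\<phi> \<in> schwartz_space" for \<phi>
  proof -
    have "cmod ((f + g) \<phi>) \<le> cmod (f \<phi>) + cmod (g \<phi>)" by (simp add: norm_triangle_ineq)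
    also have "\<dots> \<le> C * (\<Sum>m\<le>max K L. \<Sum>n\<le>max K L. schwartz_seminorm m n \<phi>)
        + D * (\<Sum>m\<le>max K L. \<Sum>n\<le>max K L. schwartz_seminorm m n \<phi>)"
      using mono[OF _ \<phi>, of K] mono[OF _ \<phi>, of L] C(1) D(1)
      by (intro add_mono order_trans[OF C(2)[OF \<phi>]] order_trans[OF D(2)[OF \<phi>]] mult_left_mono) auto
    finally show ?thesis by (simp add: distrib_right)
  qed
  then have "\<exists>(C::real) K. \<forall>\<phi>\<in>schwartz_space.
      cmod ((f + g) \<phi>) \<le> C * (\<Sum>m\<le>K. \<Sum>n\<le>K. schwartz_seminorm m n \<phi>)" by blast
  then show ?thesis
    using f g unfolding tempered_distributions_def by (simp add: algebra_simps)
qed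

lemma tempered_scale_closed:
  assumes f: "f \<in> tempered_distributions"
  shows "c *\<^sub>C f \<in> tempered_distributions"
proof -
  obtain C K where C: "0 \<le> C" "\<And>\<phi>. \<phi> \<in> schwartz_space \<Longrightarrow>
    cmod (f \<phi>) \<le> C * (\<Sum>m\<le>K. \<Sum>n\<le>K. schwartz_seminorm m n \<phi>)" using tempered_bound[OF f] by blast
  have "cmod ((c *\<^sub>C f) \<phi>) \<le> (cmod c * C) * (\<Sum>m\<le>K. \<Sum>n\<le>K. schwartz_seminorm m n \<phi>)"
    if "\<phi> \<in> schwartz_space" for \<phi>
    using mult_left_mono[OF C(2)[OF that], of "cmod c"] by (simp add: norm_mult mult.assoc)
  then have "\<exists>(C::real) K. \<forall>\<phi>\<in>schwartz_space.
      cmod ((c *\<^sub>C f) \<phi>) \<le> C * (\<Sum>m\<le>K. \<Sum>n\<le>K. schwartz_seminorm m n \<phi>)" by blast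
  then show ?thesis
    using f unfolding tempered_distributions_def by (simp add: algebra_simps)
qed

lemma tempered_zero: "0 \<in> tempered_distributions"
  unfolding tempered_distributions_def by (auto intro!: exI[of _ "0::real"])

lemma stft_add: "stft \<psi> (u + v) x w = stft \<psi> u x w + stft \<psi> v x w"
  by (simp add: stft_def)

lemma stft_scale: "stft \<psi> (c *\<^sub>C u) x w = c * stft \<psi> u x w"
  by (simp add: stft_def)

context modulation_setting
begin

lemma tf_measurable_stft:
  assumes "f \<in> tempered_distributions" shows "tf_measurable (\<lambda>x w. ennreal (cmod (stft \<psi> f x w)))"
proof -
  note [measurable] = measurable_stft_pair[OF assms]
  show ?thesis by measurable
qed

sublocale M: seminormed_function_space "modulation_space \<psi> p q" "modulation_norm \<psi> p q"
proof
  have tri: "modulation_norm \<psi> p q (u + v) \<le> modulation_norm \<psi> p q u + modulation_norm \<psi> p q v"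
    if "u \<in> tempered_distributions" "v \<in> tempered_distributions" for u v
  proof -
    have "modulation_norm \<psi> p q (u + v)
        \<le> mixed_norm (\<lambda>x w. ennreal (cmod (stft \<psi> u x w)) + ennreal (cmod (stft \<psi> v x w)))"
      unfolding modulation_norm_eq stft_add
      by (intro mixed_norm_mono) (simp add: norm_triangle_ineq flip: ennreal_plus)
    also have "\<dots> \<le> modulation_norm \<psi> p q u + modulation_norm \<psi> p q v"
      unfolding modulation_norm_eq by (intro mixed_norm_triangle tf_measurable_stft that)
    finally show ?thesis .
  qed
  have scale: "modulation_norm \<psi> p q (c *\<^sub>C u) = ennreal (cmod c) * modulation_norm \<psi> p q u"
    if "u \<in> tempered_distributions" for c u
    unfolding modulation_norm_eq stft_scale norm_mult
    by (simp add: ennreal_mult mixed_norm_cmult tf_measurable_stft that)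
  show "0 \<in> modulation_space \<psi> p q"
    using tempered_zero by (simp add: modulation_space_def modulation_norm_eq stft_def mixed_norm_def)
  fix u v c assume u: "u \<in> modulation_space \<psi> p q"
  then have u': "u \<in> tempered_distributions" and fin: "modulation_norm \<psi> p q u < top"
    by (simp_all add: modulation_space_def)
  show "modulation_norm \<psi> p q u < top" by (rule fin)
  show "modulation_norm \<psi> p q (c *\<^sub>C u) = ennreal (cmod c) * modulation_norm \<psi> p q u"
    by (rule scale[OF u'])
  then show "c *\<^sub>C u \<in> modulation_space \<psi> p q"
    using fin by (simp add: modulation_space_def tempered_scale_closed u' ennreal_mult_less_top)
  assume v: "v \<in> modulation_space \<psi> p q"
  show t: "modulation_norm \<psi> p q (u + v) \<le> modulation_norm \<psi> p q u + modulation_norm \<psi> p q v"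
    by (rule tri) (use u v in \<open>auto simp: modulation_space_def\<close>)
  have "modulation_norm \<psi> p q u + modulation_norm \<psi> p q v < top"
    using u v by (simp add: modulation_space_def)
  with t have "modulation_norm \<psi> p q (u + v) < top" by (rule le_less_trans)
  then show "u + v \<in> modulation_space \<psi> p q"
    using u v by (simp add: modulation_space_def tempered_add_closed)
qed

lemma modulation_space_tempered: "f \<in> modulation_space \<psi> p q \<Longrightarrow> f \<in> tempered_distributions"
  by (simp add: modulation_space_def)

definition square_function :: "distribution \<Rightarrow> (nat \<Rightarrow> distribution) \<Rightarrow> nat \<Rightarrow> real \<Rightarrow> real \<Rightarrow> real"
  where "square_function v u n x w =
    sqrt ((cmod (stft \<psi> v x w))\<^sup>2 + (\<Sum>j<n. (cmod (stft \<psi> (u j) x w))\<^sup>2 / 8))"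

lemma tf_measurable_square_function:
  assumes "v \<in> tempered_distributions" "\<And>j. u j \<in> tempered_distributions"
  shows "tf_measurable (\<lambda>x w. ennreal (square_function v u n x w))"
proof -
  note [measurable] = measurable_stft_pair[OF assms(1)] measurable_stft_pair[OF assms(2)]
  show ?thesis unfolding square_function_def by measurable
qed

text \<open>
  Induction on the number of vectors: the hypothesis for the four starting vectors
  \<open>v + \<i>\<^sup>k u\<^sub>n\<close> is averaged, using the pointwise inequality for four phases and the triangle
  inequality of the mixed norm.
\<close>

lemma mixed_norm_square_function_le:
  assumes u: "\<And>j. u j \<in> modulation_space \<psi> p q" and v: "v \<in> modulation_space \<psi> p q"
    and bound: "\<And>a. (\<And>j. cmod (a j) \<le> 1) \<Longrightarrow> modulation_norm \<psi> p q (v + (\<Sum>j<n. a j *\<^sub>C u j)) \<le> C"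
  shows "mixed_norm (\<lambda>x w. ennreal (square_function v u n x w)) \<le> C"
  using v bound
proof (induct n arbitrary: v)
  case 0
  then show ?case using 0(2)[of "\<lambda>_. 0"] by (simp add: square_function_def modulation_norm_eq)
next
  case (Suc n)
  let ?v = "\<lambda>k. v + (\<i> ^ k) *\<^sub>C u n"
  have vX: "?v k \<in> modulation_space \<psi> p q" for k
    by (intro M.add_mem M.scale_mem Suc.prems(1) u)
  have each: "mixed_norm (\<lambda>x w. ennreal (square_function (?v k) u n x w)) \<le> C" for k
  proof (rule Suc.hyps[OF vX])
    fix a :: "nat \<Rightarrow> complex" assume a: "\<And>j. cmod (a j) \<le> 1"
    have "(\<Sum>j<Suc n. (a(n := \<i> ^ k)) j *\<^sub>C u j) = (\<Sum>j<n. a j *\<^sub>C u j) + (\<i> ^ k) *\<^sub>C u n"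
      by simp
    then have eq: "?v k + (\<Sum>j<n. a j *\<^sub>C u j) = v + (\<Sum>j<Suc n. (a(n := \<i> ^ k)) j *\<^sub>C u j)"
      by (simp only: add.assoc add.commute)
    show "modulation_norm \<psi> p q (?v k + (\<Sum>j<n. a j *\<^sub>C u j)) \<le> C"
      unfolding eq by (rule Suc.prems(2)) (use a in \<open>simp add: norm_power\<close>)
  qed
  have pointwise: "4 * square_function v u (Suc n) x w \<le> (\<Sum>k<4. square_function (?v k) u n x w)" for x w
  proof -
    define D where "D = (\<Sum>j<n. (cmod (stft \<psi> (u j) x w))\<^sup>2 / 8)"
    have D: "0 \<le> D" unfolding D_def by (intro sum_nonneg) simp
    have "square_function v u (Suc n) x w = sqrt ((cmod (stft \<psi> v x w))\<^sup>2 + (cmod (stft \<psi> (u n) x w))\<^sup>2 / 8 + D)"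
      by (simp add: square_function_def D_def)
    moreover have "square_function (?v k) u n x w
        = sqrt ((cmod (stft \<psi> v x w + \<i> ^ k * stft \<psi> (u n) x w))\<^sup>2 + D)" for k
      by (simp add: square_function_def D_def stft_add stft_scale)
    ultimately show ?thesis using phase_average_lower_bound[OF D] by (simp del: sum.lessThan_Suc)
  qed
  have meas: "tf_measurable (\<lambda>x w. ennreal (square_function (?v k) u n x w))" for k
    by (intro tf_measurable_square_function modulation_space_tempered vX u)
  have nonneg: "0 \<le> square_function v' u n' x w" for v' n' x w
    unfolding square_function_def by (intro real_sqrt_ge_zero add_nonneg_nonneg sum_nonneg) auto
  have "4 * mixed_norm (\<lambda>x w. ennreal (square_function v u (Suc n) x w))
      = mixed_norm (\<lambda>x w. 4 * ennreal (square_function v u (Suc n) x w))"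
    by (intro mixed_norm_cmult[symmetric] tf_measurable_square_function modulation_space_tempered Suc.prems(1) u)
  also have "\<dots> \<le> mixed_norm (\<lambda>x w. \<Sum>k<4. ennreal (square_function (?v k) u n x w))"
  proof (rule mixed_norm_mono)
    fix x w
    have "4 * ennreal (square_function v u (Suc n) x w) = ennreal (4 * square_function v u (Suc n) x w)"
      by (simp add: ennreal_mult nonneg)
    also have "\<dots> \<le> ennreal (\<Sum>k<4. square_function (?v k) u n x w)"
      by (intro ennreal_leI pointwise)
    also have "\<dots> = (\<Sum>k<4. ennreal (square_function (?v k) u n x w))"
      by (rule sum_ennreal[symmetric]) (rule nonneg)
    finally show "4 * ennreal (square_function v u (Suc n) x w) \<le> (\<Sum>k<4. ennreal (square_function (?v k) u n x w))" .
  qed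
  also have "\<dots> \<le> (\<Sum>k<4. mixed_norm (\<lambda>x w. ennreal (square_function (?v k) u n x w)))"
    by (intro mixed_norm_sum meas) simp
  also have "\<dots> \<le> (\<Sum>k<(4::nat). C)" by (intro sum_mono each)
  also have "\<dots> = 4 * C" by simp
  finally show ?case by (simp add: ennreal_mult_le_mult_iff)
qed

text \<open>
  By monotone convergence the square function of the whole sequence has finite mixed norm.  Up to a
  factor 3 it dominates every \<open>\<bar>V u\<^sub>j\<bar>\<close>, and where it is finite the numbers \<open>\<bar>V u\<^sub>j\<bar>\<^sup>2\<close> are summable.
\<close>

lemma contains_no_c0_modulation_space: "M.contains_no_c0"
  unfolding M.contains_no_c0_def
proof (intro allI impI)
  fix u :: "nat \<Rightarrow> distribution" and C :: real
  assume uX: "\<forall>j. u j \<in> modulation_space \<psi> p q"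
    and bound: "\<forall>a J. finite J \<longrightarrow> (\<forall>j. cmod (a j) \<le> 1) \<longrightarrow> M.rnorm (\<Sum>j\<in>J. a j *\<^sub>C u j) \<le> C"
  then have u: "u j \<in> modulation_space \<psi> p q" for j by blast
  define S where "S n x w = ennreal (square_function 0 u n x w)" for n x w
  \<comment> \<open>The factor 3 makes up for the constant 1/8 in the square function.\<close>
  define G where "G x w = 3 * (SUP n. S n x w)" for x w
  have S_meas: "tf_measurable (S n)" for n
    unfolding S_def by (intro tf_measurable_square_function tempered_zero modulation_space_tempered u)
  have G_meas: "tf_measurable G"
  proof -
    note [measurable] = S_meas
    show ?thesis unfolding G_def by measurable
  qed
  have inc: "incseq (\<lambda>n. S n x w)" for x w
    unfolding S_def square_function_def
    by (intro incseq_SucI ennreal_leI real_sqrt_le_mono add_left_mono) simp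
  have S_le: "mixed_norm (S n) \<le> ennreal C" for n
    unfolding S_def
  proof (rule mixed_norm_square_function_le[OF u M.zero_mem])
    fix a :: "nat \<Rightarrow> complex" assume "\<And>j. cmod (a j) \<le> 1"
    then have "M.rnorm (\<Sum>j<n. a j *\<^sub>C u j) \<le> C" using bound by blast
    moreover have "(\<Sum>j<n. a j *\<^sub>C u j) \<in> modulation_space \<psi> p q" by (intro M.sum_mem M.scale_mem u)
    ultimately show "modulation_norm \<psi> p q (0 + (\<Sum>j<n. a j *\<^sub>C u j)) \<le> ennreal C"
      by (simp add: M.nrm_eq ennreal_leI)
  qed
  have "mixed_norm G = 3 * (SUP n. mixed_norm (S n))"
  proof -
    have "tf_measurable (\<lambda>x w. SUP n. S n x w)"
    proof -
      note [measurable] = S_meas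
      show ?thesis by measurable
    qed
    then show ?thesis unfolding G_def by (simp only: mixed_norm_cmult mixed_norm_SUP[OF S_meas inc])
  qed
  also have "\<dots> \<le> 3 * ennreal C" by (intro mult_left_mono SUP_least S_le) auto
  also have "\<dots> < top" by (simp add: ennreal_mult_less_top)
  finally have G_fin: "mixed_norm G < top" .
  have "(\<lambda>j. mixed_norm (\<lambda>x w. ennreal (cmod (stft \<psi> (u j) x w)))) \<longlonglongrightarrow> 0"
  proof (rule mixed_norm_dominated[OF _ G_meas _ G_fin])
    show "tf_measurable (\<lambda>x w. ennreal (cmod (stft \<psi> (u j) x w)))" for j
      by (intro tf_measurable_stft modulation_space_tempered u)
    show "ennreal (cmod (stft \<psi> (u j) x w)) \<le> G x w" for j x w
    proof -
      have "(cmod (stft \<psi> (u j) x w))\<^sup>2 \<le> 9 * ((cmod (stft \<psi> (u j) x w))\<^sup>2 / 8)" by simp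
      also have "\<dots> \<le> 9 * (\<Sum>i<Suc j. (cmod (stft \<psi> (u i) x w))\<^sup>2 / 8)"
        by (intro mult_left_mono member_le_sum) auto
      also have "\<dots> = (3 * square_function 0 u (Suc j) x w)\<^sup>2"
        unfolding square_function_def power_mult_distrib by (subst real_sqrt_pow2) (auto simp: stft_def intro!: sum_nonneg add_nonneg_nonneg)
      finally have "cmod (stft \<psi> (u j) x w) \<le> 3 * square_function 0 u (Suc j) x w"
        by (rule power2_le_imp_le) (auto simp: square_function_def intro!: sum_nonneg add_nonneg_nonneg)
      then have "ennreal (cmod (stft \<psi> (u j) x w)) \<le> 3 * S (Suc j) x w"
        unfolding S_def using ennreal_leI by (fastforce simp: ennreal_mult')
      also have "\<dots> \<le> G x w" unfolding G_def by (intro mult_left_mono SUP_upper) auto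
      finally show ?thesis .
    qed
    fix x w assume "G x w < top"
    then have "(SUP n. S n x w) < top" by (auto simp: G_def ennreal_mult_less_top)
    then obtain r where r: "0 \<le> r" "(SUP n. S n x w) = ennreal r" by (metis less_top_ennreal)
    have "square_function 0 u n x w \<le> r" for n
    proof -
      have "S n x w \<le> ennreal r" unfolding r(2)[symmetric] by (rule SUP_upper) simp
      then show ?thesis using r(1) by (simp add: S_def)
    qed
    then have "(\<Sum>j<n. (cmod (stft \<psi> (u j) x w))\<^sup>2 / 8) \<le> r\<^sup>2" for n
      unfolding square_function_def by (metis (no_types, lifting) add_0 real_sqrt_le_iff sqrt_le_D norm_zero stft_def zero_fun_apply zero_power2)
    then have "summable (\<lambda>j. (cmod (stft \<psi> (u j) x w))\<^sup>2 / 8)"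
      by (intro summableI_nonneg_bounded) auto
    then have "(\<lambda>j. (cmod (stft \<psi> (u j) x w))\<^sup>2 / 8) \<longlonglongrightarrow> 0" by (rule summable_LIMSEQ_zero)
    from tendsto_real_sqrt[OF tendsto_mult_left[OF this, of 8]]
    have "(\<lambda>j. cmod (stft \<psi> (u j) x w)) \<longlonglongrightarrow> 0" by simp
    then show "(\<lambda>j. ennreal (cmod (stft \<psi> (u j) x w))) \<longlonglongrightarrow> 0"
      using tendsto_ennrealI by fastforce
  qed
  then have "(\<lambda>j. ennreal (M.rnorm (u j))) \<longlonglongrightarrow> ennreal 0"
    using M.nrm_eq[OF u] by (simp add: modulation_norm_eq)
  then show "(\<lambda>j. M.rnorm (u j)) \<longlonglongrightarrow> 0"
    by (subst (asm) tendsto_ennreal_iff) (auto simp: M.rnorm_nonneg)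
qed

end

section \<open>A nonzero element of the modulation space\<close>

text \<open>
  Two integrations by parts at once: \<open>(k' - c k) e\<^sup>c\<^sup>t\<close> has derivative \<open>(k'' - c\<^sup>2 k) e\<^sup>c\<^sup>t\<close> and
  vanishes at both ends.
\<close>

lemma oscillatory_integral_bound:
  fixes k k' k'' :: "real \<Rightarrow> complex"
  assumes "a \<le> b"
    and k: "\<And>t. (k has_vector_derivative k' t) (at t)" "\<And>t. (k' has_vector_derivative k'' t) (at t)"
    and cont: "continuous_on {a..b} k''"
    and ends: "k a = 0" "k b = 0" "k' a = 0" "k' b = 0"
    and B: "\<And>t. t \<in> {a..b} \<Longrightarrow> cmod (k t) \<le> B" "\<And>t. t \<in> {a..b} \<Longrightarrow> cmod (k'' t) \<le> B"
  shows "cmod (integral {a..b} (\<lambda>t. k t * exp (char_exponent w * of_real t))) * (1 + w\<^sup>2) \<le> 2 * B * (b - a)"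
proof -
  let ?c = "char_exponent w" and ?e = "\<lambda>t::real. exp (char_exponent w * of_real t)"
  let ?I = "integral {a..b} (\<lambda>t. k t * ?e t)"
  have e: "(?e has_vector_derivative ?c * ?e t) (at t)" for t
    by (rule has_vector_derivative_real_field) (auto intro!: derivative_eq_intros)
  have cont_e: "continuous_on S ?e" for S by (intro continuous_intros)
  have cont_k: "continuous_on S k" for S
    using k(1) by (meson continuous_at_imp_continuous_on has_vector_derivative_continuous)
  have D: "((\<lambda>t. (k' t - ?c * k t) * ?e t) has_vector_derivative
      (k' t - ?c * k t) * (?c * ?e t) + (k'' t - ?c * k' t) * ?e t) (at t)" for t
    by (intro has_vector_derivative_mult has_vector_derivative_diff has_vector_derivative_mult_right k e)
  have D_eq: "(k' t - ?c * k t) * (?c * ?e t) + (k'' t - ?c * k' t) * ?e t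
      = k'' t * ?e t - ?c\<^sup>2 * (k t * ?e t)" for t
    by (simp add: algebra_simps power2_eq_square)
  have "((\<lambda>t. (k' t - ?c * k t) * ?e t) has_vector_derivative
      k'' t * ?e t - ?c\<^sup>2 * (k t * ?e t)) (at t within {a..b})" for t
    using D[of t] unfolding D_eq by (rule has_vector_derivative_at_within)
  from fundamental_theorem_of_calculus[OF assms(1) this]
  have "((\<lambda>t. k'' t * ?e t - ?c\<^sup>2 * (k t * ?e t)) has_integral 0) {a..b}"
    by (simp add: ends)
  then have "integral {a..b} (\<lambda>t. k'' t * ?e t - ?c\<^sup>2 * (k t * ?e t)) = 0" by (rule integral_unique)
  then have "?c\<^sup>2 * ?I = integral {a..b} (\<lambda>t. k'' t * ?e t)"
    by (subst (asm) integral_diff)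
      (auto intro!: integrable_continuous_real continuous_on_mult cont cont_e cont_k continuous_on_const)
  then have "(cmod ?c)\<^sup>2 * cmod ?I = cmod (integral {a..b} (\<lambda>t. k'' t * ?e t))"
    by (metis norm_mult norm_power)
  also have "\<dots> \<le> B * (b - a)"
    using B(2) by (intro integral_bound assms(1) continuous_on_mult cont cont_e) (simp add: norm_mult)
  finally have 1: "(2 * pi * \<bar>w\<bar>)\<^sup>2 * cmod ?I \<le> B * (b - a)" by (simp add: norm_char_exponent)
  \<comment> \<open>Discarding \<open>2 \<pi>\<close> leaves the factor \<open>1 + w\<^sup>2\<close> of the statement.\<close>
  have "\<bar>w\<bar> \<le> 2 * pi * \<bar>w\<bar>" using pi_gt3 by (simp add: mult_le_cancel_right1)
  then have "\<bar>w\<bar>\<^sup>2 \<le> (2 * pi * \<bar>w\<bar>)\<^sup>2" by (intro power_mono) auto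
  then have "w\<^sup>2 * cmod ?I \<le> (2 * pi * \<bar>w\<bar>)\<^sup>2 * cmod ?I" by (intro mult_right_mono) auto
  moreover have "cmod ?I \<le> B * (b - a)"
    using B(1) by (intro integral_bound assms(1) continuous_on_mult cont_k cont_e) (simp add: norm_mult)
  ultimately show ?thesis using 1 by (simp add: algebra_simps)
qed

lemma schwartz_decay_shifted:
  assumes "\<phi> \<in> schwartz_space"
  obtains B where "0 \<le> B" "\<And>t x. \<bar>t\<bar> \<le> R \<Longrightarrow> cmod (nth_derivative n \<phi> (t - x)) * (1 + x\<^sup>2) \<le> B"
proof -
  obtain B0 where B0: "\<And>t. \<bar>t\<bar> ^ 0 * cmod (nth_derivative n \<phi> t) \<le> B0" using schwartz_bound[OF assms] by blast
  obtain B2 where B2: "\<And>t. \<bar>t\<bar> ^ 2 * cmod (nth_derivative n \<phi> t) \<le> B2" using schwartz_bound[OF assms] by blast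
  have "cmod (nth_derivative n \<phi> (t - x)) * (1 + x\<^sup>2) \<le> (1 + 2 * R\<^sup>2) * B0 + 2 * B2" if "\<bar>t\<bar> \<le> R" for t x
  proof -
    have "x\<^sup>2 \<le> 2 * t\<^sup>2 + 2 * (t - x)\<^sup>2" using zero_le_power2[of "2 * t - x"] by (simp add: power2_eq_square algebra_simps)
    moreover have "t\<^sup>2 \<le> R\<^sup>2" using that by (simp add: abs_le_square_iff[symmetric])
    ultimately have "1 + x\<^sup>2 \<le> (1 + 2 * R\<^sup>2) + 2 * \<bar>t - x\<bar>\<^sup>2" by simp
    then have "cmod (nth_derivative n \<phi> (t - x)) * (1 + x\<^sup>2)
        \<le> cmod (nth_derivative n \<phi> (t - x)) * ((1 + 2 * R\<^sup>2) + 2 * \<bar>t - x\<bar>\<^sup>2)" by (intro mult_left_mono) auto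
    also have "\<dots> = (1 + 2 * R\<^sup>2) * cmod (nth_derivative n \<phi> (t - x))
        + 2 * (\<bar>t - x\<bar>\<^sup>2 * cmod (nth_derivative n \<phi> (t - x)))" by (simp add: algebra_simps)
    also have "\<dots> \<le> (1 + 2 * R\<^sup>2) * B0 + 2 * B2"
      using B0[of "t - x"] B2[of "t - x"] by (intro add_mono mult_left_mono) auto
    finally show ?thesis .
  qed
  then show ?thesis by (intro that[of "max 0 ((1 + 2 * R\<^sup>2) * B0 + 2 * B2)"]) (auto simp: le_max_iff_disj)
qed

lemma continuous_on_bounded_interval:
  fixes f :: "real \<Rightarrow> complex"
  assumes "continuous_on {a..b} f"
  obtains B where "0 \<le> B" "\<And>t. t \<in> {a..b} \<Longrightarrow> cmod (f t) \<le> B"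
proof -
  have "bounded (f ` {a..b})" using assms by (intro compact_imp_bounded compact_continuous_image) auto
  then obtain B where "\<forall>z\<in>f ` {a..b}. cmod z \<le> B" unfolding bounded_iff by blast
  then show ?thesis by (intro that[of "max 0 B"]) (auto simp: le_max_iff_disj)
qed

definition function_distribution :: "real \<Rightarrow> real \<Rightarrow> (real \<Rightarrow> complex) \<Rightarrow> distribution"
  where "function_distribution a b c = (\<lambda>\<phi>. if \<phi> \<in> schwartz_space then integral {a..b} (\<lambda>t. c t * cnj (\<phi> t)) else 0)"

lemma schwartz_continuous: "\<phi> \<in> schwartz_space \<Longrightarrow> continuous_on S (nth_derivative n \<phi>)"
  using schwartz_has_derivative
  by (meson continuous_at_imp_continuous_on has_vector_derivative_continuous)

lemma function_distribution_tempered: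
  assumes c: "continuous_on {a..b} c" and "a \<le> b"
  shows "function_distribution a b c \<in> tempered_distributions"
proof -
  have cont: "continuous_on {a..b} (\<lambda>t. c t * cnj (\<phi> t))" if "\<phi> \<in> schwartz_space" for \<phi>
    using schwartz_continuous[OF that, of _ 0] c by (auto intro!: continuous_intros)
  have int: "(\<lambda>t. c t * cnj (\<phi> t)) integrable_on {a..b}" if "\<phi> \<in> schwartz_space" for \<phi>
    by (rule integrable_continuous_real[OF cont[OF that]])
  obtain B where B: "0 \<le> B" "\<And>t. t \<in> {a..b} \<Longrightarrow> cmod (c t) \<le> B" using continuous_on_bounded_interval[OF c] by blast
  have add: "\<phi> + \<theta> \<in> schwartz_space" if "\<phi> \<in> schwartz_space" "\<theta> \<in> schwartz_space" for \<phi> \<theta>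
    using schwartz_lincomb(1)[OF that, of 1] by (simp add: plus_fun_def)
  have scale: "s *\<^sub>C \<phi> \<in> schwartz_space" if "\<phi> \<in> schwartz_space" for s \<phi>
    using schwartz_lincomb(1)[OF that that, of "s - 1"] by (simp add: cscale_def algebra_simps)
  have bound: "cmod (function_distribution a b c \<phi>) \<le> (B * (b - a)) * (\<Sum>m\<le>0. \<Sum>n\<le>0. schwartz_seminorm m n \<phi>)"
    if \<phi>: "\<phi> \<in> schwartz_space" for \<phi>
  proof -
    have "\<forall>m n. bdd_above (range (\<lambda>t. \<bar>t\<bar> ^ m * cmod (nth_derivative n \<phi> t)))"
      using \<phi> by (simp add: schwartz_space_def)
    from this[rule_format, of 0 0] have "\<bar>t\<bar> ^ 0 * cmod (nth_derivative 0 \<phi> t) \<le> schwartz_seminorm 0 0 \<phi>" for t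
      unfolding schwartz_seminorm_def by (rule cSUP_upper[OF UNIV_I])
    then have "cmod (\<phi> t) \<le> schwartz_seminorm 0 0 \<phi>" for t by simp
    then have "cmod (c t * cnj (\<phi> t)) \<le> B * schwartz_seminorm 0 0 \<phi>" if "t \<in> {a..b}" for t
      using B that by (auto simp: norm_mult intro!: mult_mono)
    from integral_bound[OF assms(2) cont[OF \<phi>] this]
    have "cmod (integral {a..b} (\<lambda>t. c t * cnj (\<phi> t))) \<le> B * schwartz_seminorm 0 0 \<phi> * (b - a)" .
    then show ?thesis using \<phi> by (simp add: function_distribution_def mult_ac)
  qed
  have "function_distribution a b c (\<phi> + \<theta>) = function_distribution a b c \<phi> + function_distribution a b c \<theta>"
    if "\<phi> \<in> schwartz_space" "\<theta> \<in> schwartz_space" for \<phi> \<theta>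
    using that add int by (simp add: function_distribution_def distrib_left integral_add)
  moreover have "function_distribution a b c (s *\<^sub>C \<phi>) = cnj s * function_distribution a b c \<phi>"
    if "\<phi> \<in> schwartz_space" for \<phi> s
  proof -
    have "(\<lambda>t. c t * cnj ((s *\<^sub>C \<phi>) t)) = (\<lambda>t. cnj s * (c t * cnj (\<phi> t)))"
      by (simp add: fun_eq_iff cscale_def)
    then show ?thesis using that scale by (simp only: function_distribution_def if_True integral_mult_right)
  qed
  moreover have "\<exists>(C::real) K. \<forall>\<phi>\<in>schwartz_space.
      cmod (function_distribution a b c \<phi>) \<le> C * (\<Sum>m\<le>K. \<Sum>n\<le>K. schwartz_seminorm m n \<phi>)"
    by (rule exI[of _ "B * (b - a)"], rule exI[of _ 0], rule ballI) (rule bound)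
  moreover have "function_distribution a b c \<phi> = 0" if "\<phi> \<notin> schwartz_space" for \<phi>
    using that by (simp add: function_distribution_def)
  ultimately show ?thesis
    unfolding tempered_distributions_def mem_Collect_eq by blast
qed

lemma stft_function_distribution:
  assumes "\<psi> \<in> schwartz_space"
  shows "stft \<psi> (function_distribution a b c) x w
    = integral {a..b} (\<lambda>t. c t * cnj (\<psi> (t - x)) * exp (char_exponent (- w) * of_real t))"
proof -
  have "cnj (exp (char_exponent w * of_real t)) = exp (char_exponent (- w) * of_real t)" for t :: real
    by (simp add: exp_cnj char_exponent_def)
  then show ?thesis
    using schwartz_tf_shift(1)[OF assms, of w x]
    by (simp add: stft_def function_distribution_def modulate_eq translate_def mult_ac)
qed

text \<open>
  The decay in \<open>w\<close> comes from integration by parts, the decay in \<open>x\<close> from that of the window and its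
  derivatives on the shifted interval.
\<close>

lemma stft_function_distribution_decay:
  assumes \<psi>: "\<psi> \<in> schwartz_space" and "a \<le> b"
    and c: "\<And>t. (c has_vector_derivative c' t) (at t)" "\<And>t. (c' has_vector_derivative c'' t) (at t)"
    and c'': "continuous_on {a..b} c''" and ends: "c a = 0" "c b = 0" "c' a = 0" "c' b = 0"
  obtains B where "0 \<le> B"
    "\<And>x w. cmod (stft \<psi> (function_distribution a b c) x w) \<le> B * ((1 / (1 + w\<^sup>2)) * (1 / (1 + x\<^sup>2)))"
proof -
  have cont: "continuous_on {a..b} c" "continuous_on {a..b} c'"
    using c by (meson continuous_at_imp_continuous_on has_vector_derivative_continuous)+
  obtain C0 where C0: "0 \<le> C0" "\<And>t. t \<in> {a..b} \<Longrightarrow> cmod (c t) \<le> C0" using continuous_on_bounded_interval[OF cont(1)] by blast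
  obtain C1 where C1: "0 \<le> C1" "\<And>t. t \<in> {a..b} \<Longrightarrow> cmod (c' t) \<le> C1" using continuous_on_bounded_interval[OF cont(2)] by blast
  obtain C2 where C2: "0 \<le> C2" "\<And>t. t \<in> {a..b} \<Longrightarrow> cmod (c'' t) \<le> C2" using continuous_on_bounded_interval[OF c''] by blast
  define R where "R = max \<bar>a\<bar> \<bar>b\<bar>"
  have R: "\<bar>t\<bar> \<le> R" if "t \<in> {a..b}" for t using that by (auto simp: R_def)
  let ?d = "\<lambda>n t x. nth_derivative n \<psi> (t - x)"
  obtain D0 where D0: "0 \<le> D0" "\<And>t x. \<bar>t\<bar> \<le> R \<Longrightarrow> cmod (?d 0 t x) * (1 + x\<^sup>2) \<le> D0" using schwartz_decay_shifted[OF \<psi>] by blast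
  obtain D1 where D1: "0 \<le> D1" "\<And>t x. \<bar>t\<bar> \<le> R \<Longrightarrow> cmod (?d 1 t x) * (1 + x\<^sup>2) \<le> D1" using schwartz_decay_shifted[OF \<psi>] by blast
  obtain D2 where D2: "0 \<le> D2" "\<And>t x. \<bar>t\<bar> \<le> R \<Longrightarrow> cmod (?d 2 t x) * (1 + x\<^sup>2) \<le> D2" using schwartz_decay_shifted[OF \<psi>] by blast
  define E where "E = C0 * D0 + (C2 * D0 + 2 * C1 * D1 + C0 * D2)"
  have E: "0 \<le> E" using C0 C1 C2 D0 D1 D2 by (simp add: E_def)
  have "cmod (stft \<psi> (function_distribution a b c) x w) \<le> (2 * E * (b - a)) * ((1 / (1 + w\<^sup>2)) * (1 / (1 + x\<^sup>2)))" for x w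
  proof -
    have pos: "0 < 1 + x\<^sup>2" "0 < 1 + w\<^sup>2" by (smt (verit) zero_le_power2)+
    define k where "k t = c t * cnj (?d 0 t x)" for t
    define k' where "k' t = c t * cnj (?d 1 t x) + c' t * cnj (?d 0 t x)" for t
    define k'' where "k'' t = (c t * cnj (?d 2 t x) + c' t * cnj (?d 1 t x)) + (c' t * cnj (?d 1 t x) + c'' t * cnj (?d 0 t x))" for t
    have d: "((\<lambda>t. cnj (?d n t x)) has_vector_derivative cnj (?d (Suc n) t x)) (at t)" for n t
    proof -
      have "((\<lambda>t. t - x) has_vector_derivative 1) (at t)"
        by (simp add: has_vector_derivative_diff_const has_vector_derivative_id)
      from vector_diff_chain_at[OF this schwartz_has_derivative[OF \<psi>, of n "t - x"]]
      have "((\<lambda>t. ?d n t x) has_vector_derivative ?d (Suc n) t x) (at t)" by (simp add: o_def)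
      then show ?thesis by (rule bounded_linear.has_vector_derivative[OF bounded_linear_cnj])
    qed
    have k: "(k has_vector_derivative k' t) (at t)" for t
      unfolding k_def[abs_def] k'_def using d[of 0 t] by (intro has_vector_derivative_mult c) simp
    have k': "(k' has_vector_derivative k'' t) (at t)" for t
      unfolding k'_def[abs_def] k''_def using d[of 0 t] d[of 1 t]
      by (intro has_vector_derivative_add has_vector_derivative_mult c) (simp_all add: numeral_2_eq_2)
    have cd: "continuous_on {a..b} (\<lambda>t. cnj (?d n t x))" for n
      using d by (meson continuous_at_imp_continuous_on has_vector_derivative_continuous)
    have k''c: "continuous_on {a..b} k''"
      unfolding k''_def[abs_def] by (intro continuous_on_add continuous_on_mult cont c'' cd)
    have bound: "cmod (u * cnj (?d n t x)) \<le> C * D / (1 + x\<^sup>2)"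
      if "cmod u \<le> C" "cmod (?d n t x) * (1 + x\<^sup>2) \<le> D" "0 \<le> C" for u C D n t
    proof -
      have "cmod (?d n t x) \<le> D / (1 + x\<^sup>2)" using that(2) pos by (simp add: field_simps)
      then have "cmod u * cmod (?d n t x) \<le> C * (D / (1 + x\<^sup>2))" by (intro mult_mono that) auto
      then show ?thesis by (simp add: norm_mult)
    qed
    have "cmod (integral {a..b} (\<lambda>t. k t * exp (char_exponent (- w) * of_real t))) * (1 + (- w)\<^sup>2)
        \<le> 2 * (E / (1 + x\<^sup>2)) * (b - a)"
    proof (rule oscillatory_integral_bound[OF assms(2) k k' k''c])
      show "k a = 0" "k b = 0" "k' a = 0" "k' b = 0" by (simp_all add: k_def k'_def ends)
      fix t assume t: "t \<in> {a..b}"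
      have "cmod (k t) \<le> C0 * D0 / (1 + x\<^sup>2)"
        unfolding k_def by (intro bound C0 D0 R t)
      also have "\<dots> \<le> E / (1 + x\<^sup>2)"
        using pos C0 C1 C2 D0 D1 D2 by (intro divide_right_mono) (auto simp: E_def)
      finally show "cmod (k t) \<le> E / (1 + x\<^sup>2)" .
      have "cmod (k'' t) \<le> (cmod (c t * cnj (?d 2 t x)) + cmod (c' t * cnj (?d 1 t x)))
          + (cmod (c' t * cnj (?d 1 t x)) + cmod (c'' t * cnj (?d 0 t x)))"
        unfolding k''_def by (intro order_trans[OF norm_triangle_ineq] add_mono norm_triangle_ineq)
      also have "\<dots> \<le> (C0 * D2 / (1 + x\<^sup>2) + C1 * D1 / (1 + x\<^sup>2)) + (C1 * D1 / (1 + x\<^sup>2) + C2 * D0 / (1 + x\<^sup>2))"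
        by (intro add_mono bound C0 C1 C2 D0 D1 D2 R t)
      also have "\<dots> = (C2 * D0 + 2 * C1 * D1 + C0 * D2) / (1 + x\<^sup>2)" by (simp add: add_divide_distrib)
      also have "\<dots> \<le> E / (1 + x\<^sup>2)"
        using pos C0 D0 by (intro divide_right_mono) (auto simp: E_def)
      finally show "cmod (k'' t) \<le> E / (1 + x\<^sup>2)" .
    qed
    then have "cmod (stft \<psi> (function_distribution a b c) x w) * (1 + w\<^sup>2) \<le> 2 * (E / (1 + x\<^sup>2)) * (b - a)"
      by (simp add: stft_function_distribution[OF \<psi>] k_def)
    then have "cmod (stft \<psi> (function_distribution a b c) x w) \<le> 2 * (E / (1 + x\<^sup>2)) * (b - a) / (1 + w\<^sup>2)"
      using pos by (simp only: pos_le_divide_eq)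
    then show ?thesis by (simp add: mult_ac)
  qed
  then show ?thesis using that[of "2 * E * (b - a)"] E assms(2) by simp
qed

text \<open>
  The function is bounded by 1, so for \<open>P \<ge> 1\<close> its \<open>P\<close>-th power is at most the function itself.
\<close>

lemma (in finite_exponent) Lp_norm_Cauchy_density_finite: "Lp_norm p (\<lambda>x. ennreal (1 / (1 + x\<^sup>2))) < top"
proof -
  have "integrable lborel (\<lambda>x::real. inverse (1 + x\<^sup>2))"
    using integrable_inverse_1_plus_square by (simp add: set_integrable_def)
  then have "(\<integral>\<^sup>+x. ennreal (inverse (1 + x\<^sup>2)) \<partial>lborel) < top"
    using integrableD(2)[of lborel "\<lambda>x::real. inverse (1 + x\<^sup>2)"]
    by (simp add: integrable_iff_bounded)
  moreover have "epowr (ennreal (1 / (1 + x\<^sup>2))) P \<le> ennreal (inverse (1 + x\<^sup>2))" for x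
  proof -
    have "0 < 1 + x\<^sup>2" "1 \<le> 1 + x\<^sup>2" by (smt (verit) zero_le_power2)+
    then have "1 / (1 + x\<^sup>2) \<le> 1" by (simp only: divide_le_eq_1_pos)
    with \<open>0 < 1 + x\<^sup>2\<close> have "(1 / (1 + x\<^sup>2)) powr P \<le> (1 / (1 + x\<^sup>2)) powr 1"
      by (intro powr_mono' P_ge) auto
    then show ?thesis
      using \<open>0 < 1 + x\<^sup>2\<close> by (simp add: epowr_ennreal inverse_eq_divide ennreal_leI)
  qed
  then have "(\<integral>\<^sup>+x. epowr (ennreal (1 / (1 + x\<^sup>2))) P \<partial>lborel) \<le> (\<integral>\<^sup>+x. ennreal (inverse (1 + x\<^sup>2)) \<partial>lborel)"
    by (rule nn_integral_mono)
  ultimately have "(\<integral>\<^sup>+x. epowr (ennreal (1 / (1 + x\<^sup>2))) P \<partial>lborel) < top" by (rule le_less_trans[rotated])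
  then show ?thesis unfolding Lp_norm_eq epowr_less_top_iff .
qed

lemma AE_lborel_interval:
  assumes "AE x in lborel. Q x" "(a::real) < b"
  obtains x where "a < x" "x < b" "Q x"
proof (rule ccontr)
  note found = that
  assume "\<not> thesis"
  then have "\<not> Q x" if "x \<in> {a<..<b}" for x using found[of x] that by auto
  then have "AE x in lborel. x \<notin> {a<..<b}" using assms(1) by (auto elim: eventually_mono)
  then have "{a<..<b} \<in> null_sets lborel" by (subst AE_iff_null_sets) auto
  then have "emeasure lborel {a<..<b} = 0" by (rule null_setsD1)
  then show False using assms(2) by simp
qed

context modulation_setting
begin

text \<open>
  By continuity the transform does not vanish on a square around the origin, which has positive
  measure in both variables.
\<close>

lemma modulation_norm_neq_0:
  assumes f: "f \<in> tempered_distributions" and nz: "stft \<psi> f 0 0 \<noteq> 0"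
  shows "modulation_norm \<psi> p q f \<noteq> 0"
proof
  assume 0: "modulation_norm \<psi> p q f = 0"
  have "isCont (\<lambda>z. stft \<psi> f (fst z) (snd z)) (0, 0)"
    using continuous_stft[OF f window] by (simp add: continuous_on_eq_continuous_at)
  then obtain d where d: "0 < d" "\<And>z. dist z (0, 0) < d \<Longrightarrow> stft \<psi> f (fst z) (snd z) \<noteq> 0"
    using continuous_at_avoid[of "(0,0)" "\<lambda>z. stft \<psi> f (fst z) (snd z)" 0] nz
    by (auto simp: dist_commute)
  let ?F = "\<lambda>x w. ennreal (cmod (stft \<psi> f x w))"
  note meas = tf_measurable_stft[OF f]
  have "AE w in lborel. Lp_norm p (\<lambda>x. ?F x w) = 0"
    using 0 unfolding modulation_norm_eq mixed_norm_def
    by (intro Q.Lp_norm_eq_0D P.measurable_Lp_norm meas)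
  then obtain w where w: "- (d / 2) < w" "w < d / 2" "Lp_norm p (\<lambda>x. ?F x w) = 0"
    by (rule AE_lborel_interval[of _ "- (d / 2)" "d / 2"]) (use d in auto)
  have "AE x in lborel. ?F x w = 0"
    by (intro P.Lp_norm_eq_0D w(3) tf_measurable_section meas)
  then obtain x where x: "- (d / 2) < x" "x < d / 2" "?F x w = 0"
    by (rule AE_lborel_interval[of _ "- (d / 2)" "d / 2"]) (use d in auto)
  have "dist (x, w) (0, 0) \<le> \<bar>x\<bar> + \<bar>w\<bar>"
    by (simp add: dist_Pair_Pair dist_real_def sqrt_sum_squares_le_sum_abs)
  also have "\<dots> < d" using w x by linarith
  finally show False using d(2)[of "(x, w)"] x(3) by simp
qed

text \<open>
  The function \<open>b\<^sub>0 \<psi>\<close> with the bump \<open>b\<^sub>0 t = (1 - (t - t\<^sub>0)\<^sup>2)\<^sup>2\<close> on \<open>[t\<^sub>0 - 1, t\<^sub>0 + 1]\<close> vanishes to second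
  order at the end points, so its transform decays quadratically in both variables.  The transform
  at the origin is \<open>\<integral> b\<^sub>0 \<bar>\<psi>\<bar>\<^sup>2 > 0\<close>.
\<close>

lemma exists_norm_neq_0:
  assumes "\<psi> t0 \<noteq> 0"
  obtains f where "f \<in> modulation_space \<psi> p q" "modulation_norm \<psi> p q f \<noteq> 0"
proof -
  let ?a = "t0 - 1" and ?b = "t0 + 1"
  define b0 where "b0 t = (1 - (t - t0)\<^sup>2)\<^sup>2" for t
  define b1 where "b1 t = - 4 * (t - t0) * (1 - (t - t0)\<^sup>2)" for t
  define b2 where "b2 t = 12 * (t - t0)\<^sup>2 - 4" for t
  let ?\<psi> = "\<lambda>n. nth_derivative n \<psi>"
  define c where "c t = b0 t *\<^sub>R \<psi> t" for t
  define c' where "c' t = b0 t *\<^sub>R ?\<psi> 1 t + b1 t *\<^sub>R \<psi> t" for t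
  define c'' where "c'' t = (b0 t *\<^sub>R ?\<psi> 2 t + b1 t *\<^sub>R ?\<psi> 1 t) + (b1 t *\<^sub>R ?\<psi> 1 t + b2 t *\<^sub>R \<psi> t)" for t
  have b: "(b0 has_field_derivative b1 t) (at t)" "(b1 has_field_derivative b2 t) (at t)" for t
    unfolding b0_def[abs_def] b1_def[abs_def] b2_def
    by (auto intro!: derivative_eq_intros simp: power2_eq_square algebra_simps)
  have \<psi>': "(\<psi> has_vector_derivative ?\<psi> 1 t) (at t)" "(?\<psi> 1 has_vector_derivative ?\<psi> 2 t) (at t)" for t
    using schwartz_has_derivative[OF window, of 0 t] schwartz_has_derivative[OF window, of 1 t]
    by (simp_all add: numeral_2_eq_2)
  have c1: "(c has_vector_derivative c' t) (at t)" for t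
    unfolding c_def[abs_def] c'_def by (intro has_vector_derivative_scaleR b \<psi>')
  have c2: "(c' has_vector_derivative c'' t) (at t)" for t
    unfolding c'_def[abs_def] c''_def
    by (intro has_vector_derivative_add has_vector_derivative_scaleR b \<psi>')
  have cont_\<psi>: "continuous_on S (?\<psi> n)" for S n by (rule schwartz_continuous[OF window])
  have cont_c'': "continuous_on {?a..?b} c''"
    unfolding c''_def[abs_def] b0_def b1_def b2_def
    using cont_\<psi>[of _ 0] by (intro continuous_intros cont_\<psi>) simp
  have ends: "c ?a = 0" "c ?b = 0" "c' ?a = 0" "c' ?b = 0"
    by (simp_all add: c_def c'_def b0_def b1_def)
  define f where "f = function_distribution ?a ?b c"
  have cont_c: "continuous_on {?a..?b} c"
    using c1 by (meson continuous_at_imp_continuous_on has_vector_derivative_continuous)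
  have f: "f \<in> tempered_distributions"
    unfolding f_def by (rule function_distribution_tempered[OF cont_c]) simp
  obtain B where B: "0 \<le> B" "\<And>x w. cmod (stft \<psi> f x w) \<le> B * ((1 / (1 + w\<^sup>2)) * (1 / (1 + x\<^sup>2)))"
    using stft_function_distribution_decay[OF window _ c1 c2 cont_c'' ends] unfolding f_def by auto
  let ?u = "\<lambda>x::real. ennreal (1 / (1 + x\<^sup>2))"
  have "modulation_norm \<psi> p q f \<le> mixed_norm (\<lambda>x w. (ennreal B * ?u w) * ?u x)"
    unfolding modulation_norm_eq
  proof (rule mixed_norm_mono)
    fix x w
    have "ennreal (cmod (stft \<psi> f x w)) \<le> ennreal (B * ((1 / (1 + w\<^sup>2)) * (1 / (1 + x\<^sup>2))))"
      by (intro ennreal_leI B)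
    also have "\<dots> = (ennreal B * ?u w) * ?u x"
      using B(1) by (simp add: ennreal_mult mult.assoc del: times_divide_eq_left times_divide_eq_right)
    finally show "ennreal (cmod (stft \<psi> f x w)) \<le> (ennreal B * ?u w) * ?u x" .
  qed
  also have "\<dots> = Lp_norm q (\<lambda>w. (Lp_norm p ?u * ennreal B) * ?u w)"
    unfolding mixed_norm_def by (subst P.Lp_norm_cmult) (simp_all add: mult_ac)
  also have "\<dots> = (Lp_norm p ?u * ennreal B) * Lp_norm q ?u"
    by (subst Q.Lp_norm_cmult) simp_all
  also have "\<dots> < top"
    using P.Lp_norm_Cauchy_density_finite Q.Lp_norm_Cauchy_density_finite by (simp add: ennreal_mult_less_top)
  finally have 1: "f \<in> modulation_space \<psi> p q" using f by (simp add: modulation_space_def)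

  have eq: "stft \<psi> f 0 0 = integral {?a..?b} (\<lambda>t. c t * cnj (\<psi> t))"
    by (simp add: f_def stft_function_distribution[OF window] char_exponent_def)
  have int: "(\<lambda>t. c t * cnj (\<psi> t)) integrable_on {?a..?b}"
    using cont_\<psi>[of _ 0] by (intro integrable_continuous_real continuous_intros cont_c) simp
  have "Re (c t * cnj (\<psi> t)) = b0 t * (cmod (\<psi> t))\<^sup>2" for t
    unfolding cmod_power2 by (simp add: c_def power2_eq_square algebra_simps)
  then have "Re (integral {?a..?b} (\<lambda>t. c t * cnj (\<psi> t))) = integral {?a..?b} (\<lambda>t. b0 t * (cmod (\<psi> t))\<^sup>2)"
    using integral_linear[OF int bounded_linear_Re] by (simp only: o_def)
  moreover have "integral {?a..?b} (\<lambda>t. b0 t * (cmod (\<psi> t))\<^sup>2) \<noteq> 0"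
  proof
    assume "integral {?a..?b} (\<lambda>t. b0 t * (cmod (\<psi> t))\<^sup>2) = 0"
    then have "\<forall>t\<in>{?a..?b}. b0 t * (cmod (\<psi> t))\<^sup>2 = 0"
      using cont_\<psi>[of "{?a..?b}" 0]
      by (subst (asm) integral_eq_0_iff) (auto intro!: continuous_intros simp: b0_def)
    then have "b0 t0 * (cmod (\<psi> t0))\<^sup>2 = 0" by (rule bspec) simp
    then show False using assms by (simp add: b0_def)
  qed
  ultimately have "stft \<psi> f 0 0 \<noteq> 0" unfolding eq by (metis zero_complex.sel(1))
  then show ?thesis using that[OF 1] modulation_norm_neq_0[OF f] by blast
qed

lemma modulation_norm_gabor:
  assumes f: "f \<in> tempered_distributions"
  shows "modulation_norm \<psi> p q (gabor \<alpha> \<beta> f (k, n)) = modulation_norm \<psi> p q f"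
proof -
  let ?F = "\<lambda>x w. ennreal (cmod (stft \<psi> f x w))"
  note meas = tf_measurable_stft[OF f]
  have "modulation_norm \<psi> p q (gabor \<alpha> \<beta> f (k, n))
      = Lp_norm q (\<lambda>w. Lp_norm p (\<lambda>x. ?F (x - \<alpha> * of_int k) (w - \<beta> * of_int n)))"
    by (simp add: modulation_norm_eq mixed_norm_def stft_gabor[OF f window])
  also have "\<dots> = Lp_norm q (\<lambda>w. Lp_norm p (\<lambda>x. ?F x (w - \<beta> * of_int n)))"
    by (simp add: P.Lp_norm_translate[OF tf_measurable_section[OF meas]])
  also have "\<dots> = Lp_norm q (\<lambda>w. Lp_norm p (\<lambda>x. ?F x w))"
    by (rule Q.Lp_norm_translate[OF P.measurable_Lp_norm[OF meas]])
  finally show ?thesis by (simp add: modulation_norm_eq mixed_norm_def)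
qed

text \<open>
  All Gabor vectors have the norm of \<open>g\<close>.  If it were 0, then all partial sums of frame expansions
  would have norm 0, and so would every element of the space.
\<close>

lemma schauder_frame_gabor_norm_neq_0:
  assumes frame: "schauder_frame (modulation_space \<psi> p q) (modulation_norm \<psi> p q) (\<lambda>j. gabor \<alpha> \<beta> g (enum j)) y"
    and enum: "bij enum" and "\<psi> t0 \<noteq> 0"
  shows "M.rnorm (gabor \<alpha> \<beta> g (enum j)) \<noteq> 0"
proof
  let ?x = "\<lambda>j. gabor \<alpha> \<beta> g (enum j)"
  assume "M.rnorm (?x j) = 0"
  have x: "?x i \<in> modulation_space \<psi> p q" for i using frame by (simp add: schauder_frame_def)
  obtain j0 where "enum j0 = (0, 0)" using enum by (metis bij_pointE)
  then have g: "g \<in> tempered_distributions"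
    using x[of j0] by (simp add: gabor_tempered_0 modulation_space_def)
  have "modulation_norm \<psi> p q (?x i) = modulation_norm \<psi> p q g" for i
    using modulation_norm_gabor[OF g] by (metis surj_pair)
  then have x0: "M.rnorm (?x i) = 0" for i
    using \<open>M.rnorm (?x j) = 0\<close> by (simp add: M.rnorm_def)
  obtain f where f: "f \<in> modulation_space \<psi> p q" "modulation_norm \<psi> p q f \<noteq> 0"
    using exists_norm_neq_0[OF assms(3)] by blast
  have "(\<lambda>N. M.rnorm (psum ?x (\<lambda>i. y i f) N - f)) \<longlonglongrightarrow> 0"
    using frame f(1) M.norm_sums_psum[of ?x f "\<lambda>i. y i f", OF x f(1)]
    by (simp add: schauder_frame_def reproducing_def)
  moreover have "M.rnorm f \<le> M.rnorm (psum ?x (\<lambda>i. y i f) N - f)" for N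
  proof -
    let ?s = "psum ?x (\<lambda>i. y i f) N"
    have "M.rnorm ?s \<le> (\<Sum>i<N. M.rnorm (y i f *\<^sub>C ?x i))"
      unfolding psum_def by (intro M.rnorm_sum M.scale_mem x)
    also have "\<dots> = 0" by (simp add: M.rnorm_scale x x0)
    finally have "M.rnorm ?s \<le> 0" .
    moreover have "M.rnorm (?s - (?s - f)) \<le> M.rnorm ?s + M.rnorm (?s - f)"
      by (intro M.rnorm_diff M.diff_mem M.psum_mem x f)
    ultimately show ?thesis by simp
  qed
  ultimately have "M.rnorm f \<le> 0" by (intro LIMSEQ_le_const) auto
  then have "M.rnorm f = 0" using M.rnorm_nonneg[of f] by linarith
  then show False using M.nrm_eq[OF f(1)] f(2) by simp
qed

end

section \<open>The equivalence for Gabor frames\<close>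

theorem corollary5p17:
  fixes p q p' q' :: ennreal
    and \<alpha> \<beta> :: real
    and \<psi> :: "real \<Rightarrow> complex"
    and g \<gamma> :: distribution
    and enum :: "nat \<Rightarrow> int \<times> int"
  defines "X \<equiv> modulation_space \<psi> p q"
    and "nrm \<equiv> modulation_norm \<psi> p q"
  assumes p: "1 \<le> p" "p < top" "inverse p + inverse p' = 1"
    and q: "1 \<le> q" "q < top" "inverse q + inverse q' = 1"
    and pos: "\<alpha> > 0" "\<beta> > 0"
    and window: "\<psi> \<in> schwartz_space" "(\<integral>t. (cmod (\<psi> t))\<^sup>2 \<partial>lborel) = 1"
    and enum: "bij enum"
    and dual_window: "\<And>k n. gabor \<alpha> \<beta> \<gamma> (k, n) \<in> modulation_space \<psi> p' q'"
    and frame: "schauder_frame X nrm (\<lambda>j. gabor \<alpha> \<beta> g (enum j))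
                  (\<lambda>j. modulation_functional \<psi> (gabor \<alpha> \<beta> \<gamma> (enum j)))"
  shows "unconditional_basis_plus_finite X nrm (\<lambda>j. gabor \<alpha> \<beta> g (enum j)) \<longleftrightarrow>
    (\<forall>\<phi> :: int \<times> int \<Rightarrow> distribution \<Rightarrow> complex.
       alternative_dual X nrm (\<lambda>j. gabor \<alpha> \<beta> g (enum j)) (\<lambda>j. \<phi> (enum j)) \<longrightarrow>
       (\<forall>f\<in>X.
          norm_sums nrm (\<lambda>j. \<phi> (enum j) f *\<^sub>C gabor \<alpha> \<beta> g (enum j)) f \<and>
          unconditionally_convergent X nrm (\<lambda>j. \<phi> (enum j) f *\<^sub>C gabor \<alpha> \<beta> g (enum j))))"
proof -
  interpret MS: modulation_setting p q \<psi>
    using p q window by unfold_locales auto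
  have "\<exists>t0. \<psi> t0 \<noteq> 0"
  proof (rule ccontr)
    assume "\<not> ?thesis"
    then have "(\<integral>t. (cmod (\<psi> t))\<^sup>2 \<partial>lborel) = 0" by simp
    then show False using window(2) by simp
  qed
  then obtain t0 where t0: "\<psi> t0 \<noteq> 0" by blast
  let ?x = "\<lambda>j. gabor \<alpha> \<beta> g (enum j)"
  have "unconditional_basis_plus_finite X nrm ?x \<longleftrightarrow>
    (\<forall>\<Phi>. alternative_dual X nrm ?x \<Phi> \<longrightarrow>
      (\<forall>f\<in>X. unconditionally_convergent X nrm (\<lambda>j. \<Phi> j f *\<^sub>C ?x j)))" (is "_ \<longleftrightarrow> ?seq")
    unfolding X_def nrm_def
    by (rule MS.M.near_basis_iff_alternative_duals_unconditional[OF frame[unfolded X_def nrm_def]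
        MS.schauder_frame_gabor_norm_neq_0[OF frame[unfolded X_def nrm_def] enum t0] MS.contains_no_c0_modulation_space])
  also have "?seq \<longleftrightarrow> (\<forall>\<phi> :: int \<times> int \<Rightarrow> distribution \<Rightarrow> complex.
       alternative_dual X nrm ?x (\<lambda>j. \<phi> (enum j)) \<longrightarrow>
       (\<forall>f\<in>X. unconditionally_convergent X nrm (\<lambda>j. \<phi> (enum j) f *\<^sub>C ?x j)))" (is "_ \<longleftrightarrow> ?lat")
  proof
    show ?lat if ?seq using that by blast
    show ?seq if lat: ?lat
    proof (intro allI impI)
      fix \<Phi> assume \<Phi>: "alternative_dual X nrm ?x \<Phi>"
      have "(\<lambda>j. \<Phi> (inv enum (enum j))) = \<Phi>" using enum by (simp add: bij_is_inj)
      then show "\<forall>f\<in>X. unconditionally_convergent X nrm (\<lambda>j. \<Phi> j f *\<^sub>C ?x j)"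
        using lat[rule_format, of "\<lambda>z. \<Phi> (inv enum z)"] \<Phi> enum by (simp add: bij_is_inj)
    qed
  qed
  also have "?lat \<longleftrightarrow> (\<forall>\<phi> :: int \<times> int \<Rightarrow> distribution \<Rightarrow> complex.
       alternative_dual X nrm ?x (\<lambda>j. \<phi> (enum j)) \<longrightarrow>
       (\<forall>f\<in>X. norm_sums nrm (\<lambda>j. \<phi> (enum j) f *\<^sub>C ?x j) f \<and>
          unconditionally_convergent X nrm (\<lambda>j. \<phi> (enum j) f *\<^sub>C ?x j)))"
    unfolding alternative_dual_def reproducing_def by blast
  finally show ?thesis .
qed

end
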